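(* Let $(X_i,Y_i)$, $i=1,\dots,n$, be i.i.d. with $X_i\sim\mathcal N(0,M)$ in $\mathbb R^d$, $M\succ0$, and $Y_i\mid X_i\sim\mathrm{Bernoulli}(\sigma(X_i^\top\beta))$. Let $$V(b)=nv(b)=-\sum_{i=1}^nY_iX_i^\top b+\sum_{i=1}^n\psi(X_i^\top b)+\frac12b^\top\Sigma_0^{-1}b,\qquad b\in\mathbb R^d,$$ i.e. the negative log posterior of the logistic regression coefficient vector given a Gaussian prior $\mathcal N(0,\Sigma_0)$ or a flat prior ($\Sigma_0^{-1}=0$). There exist constants $C(\|\beta\|_M)>0$ such that if $$\|\Sigma_0^{-1}\|_M\le C(\|\beta\|_M)\,n,\qquad(\sqrt d\vee\log(2n))\sqrt{d/n}\le C(\|\beta\|_M)\wedge1,$$ then the intersection of the following events holds with probability at least $1-C\exp\big(-C(\|\beta\|_M)\max(\sqrt d,\log n)\big)$: 1. There exists a unique global minimizer $\hat b$ of $v$, and $H_v=\nabla^2v(\hat b)\succeq C(\|\beta\|_M)M$. 2. $$\sup_{b\in\mathbb R^d}\|\nabla^kv(b)\|_{H_v}\le C(\|\beta\|_M)\Big(\frac{d^{k/2}}{n}\vee1\Big),\qquad\forall k=3,4,5.$$ 3. $v(b)-v(\hat b)\ge\sqrt{d/n}\,\|b-\hat b\|_{H_v}$ for all $b\in\mathbb R^d$ with $\|b-\hat b\|_{H_v}>4\sqrt{d/n}$. The probability is with respect to the joint feature-label distribution of $(X_i,Y_i)_{i=1}^n$.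
   Context: $\sigma(t)=(1+e^{-t})^{-1}$, $\psi(t)=\log(1+e^t)$. For symmetric positive definite $H$, $\|x\|_H=\sqrt{x^\top Hx}$ for vectors and $\|T\|_H=\sup_{\|u\|_H=1}|\langle T,u^{\otimes k}\rangle|$ for symmetric tensors $T$ of order $k\ge2$ (symmetric matrices being $k=2$), with $\langle\cdot,\cdot\rangle$ the entrywise inner product. $a\vee b=\max(a,b)$, $a\wedge b=\min(a,b)$. $C>0$ denotes an absolute constant and $C(\|\beta\|_M)>0$ a constant depending only on $\|\beta\|_M$; both may take different values at different occurrences. *)

theory Defs
  imports "HOL-Probability.Probability" "Jordan_Normal_Form.Matrix"
begin

text \<open>
  The constants of the theorem are uniform in the dimension \<open>d\<close>, so \<open>d\<close> has to be a term and not a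
  type: vectors in \<open>\<real>\<^sup>d\<close> are elements of \<^term>\<open>carrier_vec d\<close>, matrices of \<^term>\<open>carrier_mat d d\<close>.
\<close>

unbundle no inner_syntax
unbundle no vec_syntax

subsection \<open>Norms\<close>

definition psd :: "nat \<Rightarrow> real mat \<Rightarrow> bool" where
  "psd d A \<longleftrightarrow> A \<in> carrier_mat d d \<and> transpose_mat A = A \<and>
     (\<forall>u\<in>carrier_vec d. 0 \<le> u \<bullet> (A *\<^sub>v u))"

definition spd :: "nat \<Rightarrow> real mat \<Rightarrow> bool" where
  "spd d A \<longleftrightarrow> A \<in> carrier_mat d d \<and> transpose_mat A = A \<and>
     (\<forall>u\<in>carrier_vec d. u \<noteq> 0\<^sub>v d \<longrightarrow> 0 < u \<bullet> (A *\<^sub>v u))"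

definition loewner_le :: "nat \<Rightarrow> real mat \<Rightarrow> real mat \<Rightarrow> bool" where
  "loewner_le d A B \<longleftrightarrow> psd d (B - A)"

definition vnorm :: "real mat \<Rightarrow> real vec \<Rightarrow> real" where
  "vnorm H x = sqrt (x \<bullet> (H *\<^sub>v x))"

text \<open>
  A tensor of order \<open>k\<close> is given by its entries, indexed by lists of length \<open>k\<close> over
  \<^term>\<open>{..<d}\<close>; \<open>tensor_pow_inner d k T u\<close> is its entrywise inner product with the
  \<open>k\<close>-th tensor power of \<open>u\<close>.
\<close>

definition tensor_pow_inner :: "nat \<Rightarrow> nat \<Rightarrow> (nat list \<Rightarrow> real) \<Rightarrow> real vec \<Rightarrow> real" where
  "tensor_pow_inner d k T u =
     (\<Sum>is | length is = k \<and> set is \<subseteq> {..<d}. T is * (\<Prod>i\<leftarrow>is. u $ i))"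

text \<open>
  For \<open>d \<ge> 1\<close> and positive definite \<open>H\<close> the supremum is over a nonempty bounded set.
\<close>

definition tensor_norm :: "nat \<Rightarrow> nat \<Rightarrow> real mat \<Rightarrow> (nat list \<Rightarrow> real) \<Rightarrow> real" where
  "tensor_norm d k H T =
     (SUP u\<in>{u \<in> carrier_vec d. vnorm H u = 1}. \<bar>tensor_pow_inner d k T u\<bar>)"

definition mat_norm :: "nat \<Rightarrow> real mat \<Rightarrow> real mat \<Rightarrow> real" where
  "mat_norm d H A = tensor_norm d 2 H (\<lambda>is. A $$ (is ! 0, is ! 1))"

subsection \<open>Derivatives\<close>

definition partial_deriv :: "nat \<Rightarrow> nat \<Rightarrow> (real vec \<Rightarrow> real) \<Rightarrow> real vec \<Rightarrow> real" where
  "partial_deriv d i f b = deriv (\<lambda>t. f (b + t \<cdot>\<^sub>v unit_vec d i)) 0"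

primrec iter_partial :: "nat \<Rightarrow> nat list \<Rightarrow> (real vec \<Rightarrow> real) \<Rightarrow> real vec \<Rightarrow> real" where
  "iter_partial d [] f = f"
| "iter_partial d (i # is) f = partial_deriv d i (iter_partial d is f)"

text \<open>The order of the tensor \<open>\<nabla>\<^sup>kf(b)\<close> is the length of the index list it is applied to.\<close>

definition nabla :: "nat \<Rightarrow> (real vec \<Rightarrow> real) \<Rightarrow> real vec \<Rightarrow> nat list \<Rightarrow> real" where
  "nabla d f b is = iter_partial d is f b"

definition hessian :: "nat \<Rightarrow> (real vec \<Rightarrow> real) \<Rightarrow> real vec \<Rightarrow> real mat" where
  "hessian d f b = mat d d (\<lambda>(i, j). nabla d f b [i, j])"

subsection \<open>The logistic regression model\<close>

definition sigmoid :: "real \<Rightarrow> real" where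
  "sigmoid t = inverse (1 + exp (- t))"

definition softplus :: "real \<Rightarrow> real" where
  "softplus t = ln (1 + exp t)"

definition borel_vec :: "nat \<Rightarrow> real vec measure" where
  "borel_vec d = vimage_algebra (carrier_vec d) (\<lambda>x. \<lambda>i\<in>{..<d}. x $ i) (\<Pi>\<^sub>M i\<in>{..<d}. borel)"

text \<open>
  \<open>\<mu> = N(0, M)\<close>: the law of \<open>A Z\<close> with \<open>A A\<^sup>T = M\<close> and \<open>Z\<close> having independent standard normal
  entries. The law does not depend on the choice of the factor \<open>A\<close>.
\<close>

definition gaussian_law :: "nat \<Rightarrow> real mat \<Rightarrow> real vec measure \<Rightarrow> bool" where
  "gaussian_law d M \<mu> \<longleftrightarrow> (\<exists>A\<in>carrier_mat d d. A * transpose_mat A = M \<and>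
     \<mu> = distr (\<Pi>\<^sub>M i\<in>{..<d}. std_normal_distribution) (borel_vec d) (\<lambda>z. A *\<^sub>v vec d z))"

text \<open>
  Joint law of \<open>(X, Y)\<close> for \<open>X \<sim> \<mu>\<close> and \<open>Y | X \<sim> Bernoulli(\<sigma>(X\<^sup>T\<beta>))\<close>; the labels \<open>0, 1\<close> are
  encoded as \<^typ>\<open>bool\<close>.
\<close>

definition logit_law :: "real vec measure \<Rightarrow> real vec \<Rightarrow> (real vec \<times> bool) measure" where
  "logit_law \<mu> \<beta> = density (\<mu> \<Otimes>\<^sub>M count_space UNIV)
     (\<lambda>(x, y). ennreal (pmf (bernoulli_pmf (sigmoid (x \<bullet> \<beta>))) y))"

definition sample_law ::
    "nat \<Rightarrow> real vec measure \<Rightarrow> real vec \<Rightarrow> (nat \<Rightarrow> real vec \<times> bool) measure" where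
  "sample_law n \<mu> \<beta> = (\<Pi>\<^sub>M i\<in>{..<n}. logit_law \<mu> \<beta>)"

text \<open>\<open>Q\<close> is \<open>\<Sigma>\<^sub>0\<^sup>-\<^sup>1\<close> for a Gaussian prior \<open>N(0, \<Sigma>\<^sub>0)\<close>, or zero for the flat prior.\<close>

definition prior_precision :: "nat \<Rightarrow> real mat \<Rightarrow> bool" where
  "prior_precision d Q \<longleftrightarrow> Q = 0\<^sub>m d d \<or>
     (\<exists>\<Sigma>\<^sub>0. spd d \<Sigma>\<^sub>0 \<and> Q \<in> carrier_mat d d \<and> inverts_mat \<Sigma>\<^sub>0 Q \<and> inverts_mat Q \<Sigma>\<^sub>0)"

definition neg_log_post ::
    "nat \<Rightarrow> real mat \<Rightarrow> (nat \<Rightarrow> real vec \<times> bool) \<Rightarrow> real vec \<Rightarrow> real" where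
  "neg_log_post n Q \<omega> b =
     - (\<Sum>i<n. of_bool (snd (\<omega> i)) * (fst (\<omega> i) \<bullet> b))
     + (\<Sum>i<n. softplus (fst (\<omega> i) \<bullet> b)) + 1 / 2 * (b \<bullet> (Q *\<^sub>v b))"

definition scaled_nlp ::
    "nat \<Rightarrow> real mat \<Rightarrow> (nat \<Rightarrow> real vec \<times> bool) \<Rightarrow> real vec \<Rightarrow> real" where
  "scaled_nlp n Q \<omega> b = neg_log_post n Q \<omega> b / real n"

end

theory Submission
  imports Defs "Jordan_Normal_Form.Determinant"
begin

text \<open>
  All features enter through \<open>X\<^sub>i \<bullet> w\<close>, which is normal with standard deviation \<open>\<parallel>w\<parallel>\<^sub>M\<close>. By a
  Chernoff bound and a union bound over a finite net of the unit ball of \<open>\<parallel>\<sqdot>\<parallel>\<^sub>M\<close>, uniformly in the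
  direction \<open>u\<close> the following hold up to constants: \<open>\<Sum> (X\<^sub>i \<bullet> u)\<^sup>2 \<ge> n \<parallel>u\<parallel>\<^sup>2\<close>,
  \<open>\<Sum> \<bar>X\<^sub>i \<bullet> u\<bar>\<^sup>k \<le> (n + d\<^sup>k\<^sup>/\<^sup>2) \<parallel>u\<parallel>\<^sup>k\<close> for \<open>k \<le> 5\<close>, and the score at \<open>\<beta>\<close> is at most \<open>\<eta> n \<parallel>u\<parallel>\<close> for a small
  \<open>\<eta>\<close>. The second and fourth moments bound the Hessian from below on the unit ball around \<open>\<beta>\<close>, so the
  small score confines the minimizer to that ball. Since \<open>d\<^sup>2\<close> is small compared to \<open>n\<close>, the third
  derivative is bounded, and Taylor expansion at the minimizer up to radius \<open>4 \<surd>(d/n)\<close>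
  together with convexity gives the linear growth.

  For \<open>k > 2\<close> the powers \<open>\<bar>X\<^sub>i \<bullet> u\<bar>\<^sup>k\<close> have no exponential moments. At a level \<open>t\<close> with \<open>t\<^sup>k\<close> of order
  \<open>n + d\<^sup>k\<^sup>/\<^sup>2\<close>, the function \<open>\<bar>x\<bar>\<^sup>k t\<^sup>2\<^sup>-\<^sup>k\<close> is therefore replaced by \<open>x\<^sup>2\<close> beyond \<open>t\<close>. Sums of these
  functions obey a Chernoff bound, and they still control the \<open>k\<close>-th powers because the sum of the
  squares of the large terms is of order \<open>t\<^sup>2\<close>.
\<close>

subsection \<open>Nets of ellipsoids\<close>

text \<open>Randomness and calculus are kept apart. The good event is cut out by finitely many
  inequalities per net point, so it is measurable without any claim about measurability of the
  minimizer or of suprema over \<open>b\<close>; the geometric conclusions then concern one fixed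
  sample.

  The union bound pays a factor \<open>K ^ d\<close>. This dictates the level
  \<open>t k = root k (real n) + B * sqrt (real d)\<close> with \<open>B\<^sup>2 = ln K + 1\<close>:
  the second summand beats the net and leaves \<open>exp (- real d)\<close>, the first makes
  \<open>real n \<le> t k ^ k\<close> and supplies the decay in \<open>ln (real n)\<close>.

  The constants must not become circular. A fine mesh is required for the lower bound on second
  moments, and this mesh depends on the constant of the upper bound. Upper bounds need only mesh
  1/2, and up to order 4 the smallness of \<open>d^2 / n\<close> absorbs \<open>B\<close>, so their
  constants do not involve \<open>K\<close>. The order of choice is therefore: moment constants,
  mesh, \<open>K\<close>, \<open>B\<close>; the thresholds on \<open>d\<close> and \<open>n\<close>,
  which also involve the curvature constant, come last.\<close>

lemma sum_exp_neg_square_le: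
  "(\<Sum>z\<in>{- int n..int n}. exp (- (real_of_int z)\<^sup>2)) \<le> 4 - 2 * (1 / 2) ^ n"
proof (induction n)
  case 0
  then show ?case by simp
next
  case (Suc n)
  have eq: "{- int (Suc n)..int (Suc n)} = insert (- int (Suc n)) (insert (int (Suc n)) {- int n..int n})"
    by auto
  have e1: "exp (-1::real) \<le> 1 / 2"
    using exp_ge_add_one_self[of "1::real"] by (simp add: exp_minus field_simps)
  \<comment> \<open>A step adds two terms of size at most \<open>(1 / 2) ^ Suc n\<close>, exactly
    the growth of the claimed bound. The subtracted term exists for this induction; later only the
    uniform bound 4 matters.\<close>
  have "exp (- (real (Suc n))\<^sup>2) \<le> exp (- real (Suc n))"
    by (simp add: power2_eq_square algebra_simps)
  also have "\<dots> = exp (-1) ^ Suc n"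
    by (simp only: exp_of_nat_mult[symmetric]) simp
  also have "\<dots> \<le> (1 / 2) ^ Suc n"
    by (intro power_mono e1) simp
  finally have e: "exp (- (real (Suc n))\<^sup>2) \<le> (1 / 2) ^ Suc n" .
  have "(\<Sum>z\<in>{- int (Suc n)..int (Suc n)}. exp (- (real_of_int z)\<^sup>2))
      = 2 * exp (- (real (Suc n))\<^sup>2) + (\<Sum>z\<in>{- int n..int n}. exp (- (real_of_int z)\<^sup>2))"
    unfolding eq by (subst sum.insert; simp)+ (simp add: power2_eq_square algebra_simps)
  then show ?case using Suc e by simp
qed

text \<open>Counting by exponential weights: every point of \<open>S\<close> has weight at least 1
  under \<open>exp (r - (\<Sum>i\<in>I. (f i)\<^sup>2))\<close>, and over the whole box this weight
  factorizes into one-dimensional sums, each at most 4. The box makes the sum finite; its size does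
  not enter the bound.\<close>

lemma card_integer_ball_le:
  assumes "finite I" and "\<And>f. f \<in> S \<Longrightarrow> f \<in> (\<Pi>\<^sub>E i\<in>I. {- int L..int L})"
    and "\<And>f. f \<in> S \<Longrightarrow> (\<Sum>i\<in>I. (real_of_int (f i))\<^sup>2) \<le> r"
  shows "finite S" and "real (card S) \<le> exp r * 4 ^ card I"
proof -
  have fin: "finite (\<Pi>\<^sub>E i\<in>I. {- int L..int L})"
    using assms(1) by (intro finite_PiE) auto
  show fS: "finite S"
    using fin assms(2) by (meson finite_subset subsetI)
  have "real (card S) = (\<Sum>f\<in>S. 1)"
    by simp
  also have "\<dots> \<le> (\<Sum>f\<in>S. exp (r - (\<Sum>i\<in>I. (real_of_int (f i))\<^sup>2)))"
    using assms(3) by (intro sum_mono) simp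
  also have "\<dots> \<le> (\<Sum>f\<in>(\<Pi>\<^sub>E i\<in>I. {- int L..int L}). exp (r - (\<Sum>i\<in>I. (real_of_int (f i))\<^sup>2)))"
    using fin assms(2) by (intro sum_mono2) auto
  also have "\<dots> = exp r * (\<Sum>f\<in>(\<Pi>\<^sub>E i\<in>I. {- int L..int L}). \<Prod>i\<in>I. exp (- (real_of_int (f i))\<^sup>2))"
    using assms(1) by (simp add: sum_distrib_left exp_diff exp_sum exp_minus sum_negf inverse_eq_divide prod_dividef)
  also have "\<dots> = exp r * (\<Prod>i\<in>I. \<Sum>z\<in>{- int L..int L}. exp (- (real_of_int z)\<^sup>2))"
    using assms(1) by (subst prod_sum_PiE) auto
  also have "\<dots> \<le> exp r * (\<Prod>i\<in>I. 4)"
    by (intro mult_left_mono prod_mono conjI sum_nonneg order.trans[OF sum_exp_neg_square_le]) auto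
  finally show "real (card S) \<le> exp r * 4 ^ card I"
    by simp
qed

text \<open>Rounding towards zero never increases the absolute value, so a rounded point of the unit
  ball stays in the ball. Rounding to the nearest integer would lose this, and the tail bounds are
  applied at net points of norm at most 1.\<close>

definition round_to_zero :: "real \<Rightarrow> int" where
  "round_to_zero a = (if 0 \<le> a then \<lfloor>a\<rfloor> else \<lceil>a\<rceil>)"

lemma round_to_zero_square_le: "(real_of_int (round_to_zero a))\<^sup>2 \<le> a\<^sup>2"
proof -
  have "\<bar>real_of_int (round_to_zero a)\<bar> \<le> \<bar>a\<bar>"
    unfolding round_to_zero_def by (simp split: if_split)
  then show ?thesis by (simp add: abs_le_square_iff)
qed

lemma round_to_zero_error: "(a - real_of_int (round_to_zero a))\<^sup>2 \<le> 1"
proof -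
  have "\<bar>a - real_of_int (round_to_zero a)\<bar> \<le> 1"
    unfolding round_to_zero_def by (auto simp: abs_if) linarith+
  then show ?thesis by (simp add: abs_square_le_1)
qed

lemma scalar_prod_self:
  fixes u :: "real vec"
  assumes "u \<in> carrier_vec d"
  shows "u \<bullet> u = (\<Sum>i<d. (u $ i)\<^sup>2)"
  using assms by (auto simp: scalar_prod_def power2_eq_square atLeast0LessThan)

text \<open>The net is the grid of spacing \<open>\<epsilon> / sqrt (real d)\<close> inside the
  ball. Each coordinate moves by at most the spacing, so the total error is at most \<epsilon>. In
  grid units the squared radius is \<open>real d / \<epsilon>\<^sup>2\<close>, linear in
  \<open>d\<close>, which turns the exponential count into \<open>K ^ d\<close>.\<close>

lemma euclidean_net:
  fixes \<epsilon> :: real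
  assumes "0 < \<epsilon>"
  shows "\<exists>K\<ge>1. \<forall>d\<ge>1. \<exists>N. finite N \<and> N \<subseteq> carrier_vec d \<and> real (card N) \<le> K ^ d \<and>
    (\<forall>u\<in>carrier_vec d. u \<bullet> u \<le> 1 \<longrightarrow> (\<exists>z\<in>N. z \<bullet> z \<le> 1 \<and> (u - z) \<bullet> (u - z) \<le> \<epsilon>\<^sup>2))"
proof (intro exI[of _ "exp (1 / \<epsilon>\<^sup>2) * 4"] conjI allI impI)
  have "exp (1 / \<epsilon>\<^sup>2) \<ge> 1"
    by simp
  then show "1 \<le> exp (1 / \<epsilon>\<^sup>2) * (4::real)"
    by linarith
next
  fix d :: nat
  assume d: "1 \<le> d"
  define \<delta> where "\<delta> = \<epsilon> / sqrt (real d)"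
  have \<delta>: "\<delta> > 0" and \<delta>2: "\<delta>\<^sup>2 * real d = \<epsilon>\<^sup>2"
    using assms d by (auto simp: \<delta>_def power_divide)
  define r where "r = real d / \<epsilon>\<^sup>2"
  have r: "r > 0" and r2: "1 / \<delta>\<^sup>2 = r"
    using assms d by (auto simp: r_def \<delta>_def power_divide)
  define L where "L = nat \<lceil>r\<rceil>"
  define S where "S = {f \<in> (\<Pi>\<^sub>E i\<in>{..<d}. {- int L..int L}). (\<Sum>i<d. (real_of_int (f i))\<^sup>2) \<le> r}"
  have Sm: "f \<in> (\<Pi>\<^sub>E i\<in>{..<d}. {- int L..int L})" "(\<Sum>i<d. (real_of_int (f i))\<^sup>2) \<le> r" if "f \<in> S" for f
    using that unfolding S_def by blast+
  have fS: "finite S" and cS: "real (card S) \<le> exp r * 4 ^ d"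
    using card_integer_ball_le[OF finite_lessThan Sm] by simp_all
  define vc where "vc = (\<lambda>f::nat \<Rightarrow> int. vec d (\<lambda>i. \<delta> * real_of_int (f i)))"
  have "real (card (vc ` S)) \<le> (exp (1 / \<epsilon>\<^sup>2) * 4) ^ d"
    using card_image_le[OF fS, of vc] cS
    by (simp add: power_mult_distrib exp_of_nat_mult[symmetric] r_def)
  moreover have "\<exists>z\<in>vc ` S. z \<bullet> z \<le> 1 \<and> (u - z) \<bullet> (u - z) \<le> \<epsilon>\<^sup>2"
    if u: "u \<in> carrier_vec d" and u1: "u \<bullet> u \<le> 1" for u
  proof
    define f where "f = (\<lambda>i\<in>{..<d}. round_to_zero (u $ i / \<delta>))"
    have "(\<Sum>i<d. (real_of_int (f i))\<^sup>2) \<le> (\<Sum>i<d. (u $ i / \<delta>)\<^sup>2)"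
      by (intro sum_mono) (auto simp: f_def round_to_zero_square_le)
    also have "\<dots> = (u \<bullet> u) / \<delta>\<^sup>2"
      by (simp add: scalar_prod_self[OF u] power_divide sum_divide_distrib)
    also have "\<dots> \<le> r"
      using u1 \<delta> unfolding r2[symmetric] by (intro divide_right_mono) auto
    finally have fr: "(\<Sum>i<d. (real_of_int (f i))\<^sup>2) \<le> r" .
    have "f i \<in> {- int L..int L}" if i: "i < d" for i
    proof -
      \<comment> \<open>An integer is at most its square in absolute value, so the bound
        \<open>r\<close> on the sum of squares already confines each coordinate to the box.\<close>
      have "\<bar>f i\<bar> \<le> (f i)\<^sup>2"
        using mult_left_mono[of 1 "\<bar>f i\<bar>" "\<bar>f i\<bar>"]
        by (cases "f i = 0") (auto simp: power2_eq_square)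
      then have "real_of_int \<bar>f i\<bar> \<le> (real_of_int (f i))\<^sup>2"
        by (metis of_int_le_iff of_int_power)
      also have "\<dots> \<le> (\<Sum>i<d. (real_of_int (f i))\<^sup>2)"
        using i by (intro member_le_sum) auto
      finally have "\<bar>f i\<bar> \<le> \<lceil>r\<rceil>"
        using fr by linarith
      then show ?thesis
        using r by (auto simp: L_def)
    qed
    then have fS': "f \<in> S"
      using fr by (auto simp: S_def f_def)
    then show "vc f \<in> vc ` S" by simp
    have c: "vc f \<in> carrier_vec d"
      by (simp add: vc_def)
    have "vc f \<bullet> vc f = \<delta>\<^sup>2 * (\<Sum>i<d. (real_of_int (f i))\<^sup>2)"
      unfolding scalar_prod_self[OF c] by (simp add: vc_def power_mult_distrib sum_distrib_left)
    also have "\<dots> \<le> \<delta>\<^sup>2 * r"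
      using fr by (intro mult_left_mono) auto
    finally have 1: "vc f \<bullet> vc f \<le> 1"
      using \<delta> by (simp add: r2[symmetric])
    have c': "u - vc f \<in> carrier_vec d"
      using u c by simp
    have "(u - vc f) \<bullet> (u - vc f) = (\<Sum>i<d. \<delta>\<^sup>2 * (u $ i / \<delta> - real_of_int (round_to_zero (u $ i / \<delta>)))\<^sup>2)"
      unfolding scalar_prod_self[OF c'] using \<delta> u
      by (intro sum.cong refl) (auto simp: vc_def f_def power_mult_distrib[symmetric] algebra_simps)
    also have "\<dots> \<le> (\<Sum>i<d. \<delta>\<^sup>2 * 1)"
      by (intro sum_mono mult_left_mono round_to_zero_error) auto
    finally show "vc f \<bullet> vc f \<le> 1 \<and> (u - vc f) \<bullet> (u - vc f) \<le> \<epsilon>\<^sup>2"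
      using 1 \<delta>2 by (simp add: mult.commute)
  qed
  ultimately show "\<exists>N. finite N \<and> N \<subseteq> carrier_vec d \<and> real (card N) \<le> (exp (1 / \<epsilon>\<^sup>2) * 4) ^ d \<and>
    (\<forall>u\<in>carrier_vec d. u \<bullet> u \<le> 1 \<longrightarrow> (\<exists>z\<in>N. z \<bullet> z \<le> 1 \<and> (u - z) \<bullet> (u - z) \<le> \<epsilon>\<^sup>2))"
    using fS by (intro exI[of _ "vc ` S"]) (auto simp: vc_def)
qed

text \<open>The transpose of the factor \<open>A\<close> from \<open>gaussian_law\<close> carries
  \<open>vnorm M\<close> to the Euclidean norm. This transports the net and identifies the law of
  the features.\<close>

lemma vnorm_factor:
  assumes "A \<in> carrier_mat d d" "A * transpose_mat A = M" "w \<in> carrier_vec d"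
  shows "w \<bullet> (M *\<^sub>v w) = (transpose_mat A *\<^sub>v w) \<bullet> (transpose_mat A *\<^sub>v w)"
    and "vnorm M w = sqrt ((transpose_mat A *\<^sub>v w) \<bullet> (transpose_mat A *\<^sub>v w))"
proof -
  have "M *\<^sub>v w = A *\<^sub>v (transpose_mat A *\<^sub>v w)"
    unfolding assms(2)[symmetric] using assms(1,3) by simp
  then show 1: "w \<bullet> (M *\<^sub>v w) = (transpose_mat A *\<^sub>v w) \<bullet> (transpose_mat A *\<^sub>v w)"
    using assms transpose_vec_mult_scalar[OF assms(1), of "transpose_mat A *\<^sub>v w" w] by simp
  show "vnorm M w = sqrt ((transpose_mat A *\<^sub>v w) \<bullet> (transpose_mat A *\<^sub>v w))"
    by (simp add: vnorm_def 1)
qed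

lemma spd_factor_inverse:
  assumes spd: "spd d M" and A: "A \<in> carrier_mat d d" and AM: "A * transpose_mat A = M"
  obtains B where "B \<in> carrier_mat d d" "transpose_mat A * B = 1\<^sub>m d" "B * transpose_mat A = 1\<^sub>m d"
proof -
  let ?T = "transpose_mat A"
  have T: "?T \<in> carrier_mat d d" using A by simp
  have "det ?T \<noteq> 0"
  proof
    assume "det ?T = 0"
    then obtain v where v: "v \<in> carrier_vec d" "v \<noteq> 0\<^sub>v d" "?T *\<^sub>v v = 0\<^sub>v d"
      using det_0_iff_vec_prod_zero_field[OF T] by blast
    have "v \<bullet> (M *\<^sub>v v) = 0"
      using vnorm_factor(1)[OF A AM v(1)] v(3) by simp
    then show False
      using spd v by (auto simp: spd_def)
  qed
  then obtain B where "B \<in> carrier_mat d d" "B * ?T = 1\<^sub>m d"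
    using T det_non_zero_imp_unit[OF T] 
    by (auto simp: Units_def ring_mat_simps)
  then show ?thesis
    using that mat_mult_left_right_inverse T by metis
qed

text \<open>The Euclidean net is pulled back along \<open>transpose_mat A\<close>. Since this map
  preserves the norms, \<open>K\<close> depends on \<epsilon> alone.\<close>

lemma elliptic_net:
  fixes \<epsilon> :: real
  assumes "0 < \<epsilon>"
  shows "\<exists>K\<ge>1. \<forall>d M A. 1 \<le> d \<longrightarrow> spd d M \<longrightarrow> A \<in> carrier_mat d d \<longrightarrow> A * transpose_mat A = M \<longrightarrow>
    (\<exists>W. finite W \<and> W \<subseteq> carrier_vec d \<and> real (card W) \<le> K ^ d \<and>
      (\<forall>u\<in>carrier_vec d. vnorm M u \<le> 1 \<longrightarrow> (\<exists>w\<in>W. vnorm M w \<le> 1 \<and> vnorm M (u - w) \<le> \<epsilon>)))"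
proof -
  obtain K :: real where K: "K \<ge> 1" and N: "\<And>d. d \<ge> 1 \<Longrightarrow> \<exists>N. finite N \<and> N \<subseteq> carrier_vec d \<and> real (card N) \<le> K ^ d \<and>
    (\<forall>u\<in>carrier_vec d. u \<bullet> u \<le> 1 \<longrightarrow> (\<exists>z\<in>N. z \<bullet> z \<le> 1 \<and> (u - z) \<bullet> (u - z) \<le> \<epsilon>\<^sup>2))"
    using euclidean_net[OF assms] by blast
  show ?thesis
  proof (intro exI[of _ K] conjI K allI impI)
    fix d :: nat and M A :: "real mat"
    assume d: "1 \<le> d" and spd: "spd d M" and A: "A \<in> carrier_mat d d" and AM: "A * transpose_mat A = M"
    let ?T = "transpose_mat A"
    obtain B where B: "B \<in> carrier_mat d d" and TB: "?T * B = 1\<^sub>m d" and BT: "B * ?T = 1\<^sub>m d"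
      using spd_factor_inverse[OF spd A AM] .
    obtain N where fN: "finite N" and cN: "N \<subseteq> carrier_vec d" and K: "real (card N) \<le> K ^ d"
      and net: "\<And>u. u\<in>carrier_vec d \<Longrightarrow> u \<bullet> u \<le> 1 \<Longrightarrow> (\<exists>z\<in>N. z \<bullet> z \<le> 1 \<and> (u - z) \<bullet> (u - z) \<le> \<epsilon>\<^sup>2)"
      using N[OF d] by blast
    define W where "W = (\<lambda>z. B *\<^sub>v z) ` N"
    have TBz: "?T *\<^sub>v (B *\<^sub>v z) = z" if "z \<in> carrier_vec d" for z
    proof -
      have "?T *\<^sub>v (B *\<^sub>v z) = (?T * B) *\<^sub>v z"
        using that A B by simp
      then show ?thesis
        using that by (simp only: TB one_mult_mat_vec)
    qed
    have "\<exists>w\<in>W. vnorm M w \<le> 1 \<and> vnorm M (u - w) \<le> \<epsilon>" if u: "u \<in> carrier_vec d" and u1: "vnorm M u \<le> 1" for u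
    proof -
      have Tu: "?T *\<^sub>v u \<in> carrier_vec d"
        using A u by simp
      have "(?T *\<^sub>v u) \<bullet> (?T *\<^sub>v u) \<le> 1"
        using u1 unfolding vnorm_factor(2)[OF A AM u] by simp
      then obtain z where z: "z \<in> N" "z \<bullet> z \<le> 1" "(?T *\<^sub>v u - z) \<bullet> (?T *\<^sub>v u - z) \<le> \<epsilon>\<^sup>2"
        using net[OF Tu] by blast
      have zc: "z \<in> carrier_vec d" using z cN by blast
      have Bz: "B *\<^sub>v z \<in> carrier_vec d" using B zc by simp
      have uBz: "u - B *\<^sub>v z \<in> carrier_vec d" using Bz u by simp
      have eq: "?T *\<^sub>v (u - B *\<^sub>v z) = ?T *\<^sub>v u - z"
        using A u Bz TBz[OF zc] by (simp add: mult_minus_distrib_mat_vec[of _ d d])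
      have "vnorm M (B *\<^sub>v z) \<le> 1"
        using z(2) by (simp add: vnorm_factor(2)[OF A AM Bz] TBz[OF zc])
      moreover have "vnorm M (u - B *\<^sub>v z) \<le> \<epsilon>"
        unfolding vnorm_factor(2)[OF A AM uBz] eq using z(3) assms by (intro real_le_lsqrt) auto
      ultimately show ?thesis
        using z(1) by (auto simp: W_def)
    qed
    moreover have "real (card W) \<le> K ^ d"
      using card_image_le[OF fN, of "\<lambda>z. B *\<^sub>v z"] K unfolding W_def by linarith
    ultimately show "\<exists>W. finite W \<and> W \<subseteq> carrier_vec d \<and> real (card W) \<le> K ^ d \<and>
      (\<forall>u\<in>carrier_vec d. vnorm M u \<le> 1 \<longrightarrow> (\<exists>w\<in>W. vnorm M w \<le> 1 \<and> vnorm M (u - w) \<le> \<epsilon>))"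
      using fN cN B by (intro exI[of _ W]) (auto simp: W_def)
  qed
qed

text \<open>This constant depends on \<open>M\<close> and serves qualitative purposes only:
  boundedness of suprema and compactness of balls. It never enters a constant of the
  theorem.\<close>

lemma vnorm_coordinate_bound:
  assumes spd: "spd d M" and A: "A \<in> carrier_mat d d" and AM: "A * transpose_mat A = M"
  shows "\<exists>c\<ge>0. \<forall>u\<in>carrier_vec d. \<forall>i<d. \<bar>u $ i\<bar> \<le> c * vnorm M u"
proof -
  let ?T = "transpose_mat A"
  obtain B where B: "B \<in> carrier_mat d d" and TB: "?T * B = 1\<^sub>m d" and BT: "B * ?T = 1\<^sub>m d"
    using spd_factor_inverse[OF spd A AM] .
  define c where "c = (\<Sum>i<d. \<Sum>j<d. \<bar>B $$ (i, j)\<bar>)"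
  have "\<bar>u $ i\<bar> \<le> c * vnorm M u" if u: "u \<in> carrier_vec d" and i: "i < d" for u i
  proof -
    define z where "z = ?T *\<^sub>v u"
    have z: "z \<in> carrier_vec d" using A u by (simp add: z_def)
    have "B *\<^sub>v z = (B * ?T) *\<^sub>v u"
      unfolding z_def using A B u by simp
    then have uz: "u = B *\<^sub>v z"
      using u by (simp only: BT one_mult_mat_vec)
    have zn: "\<bar>z $ j\<bar> \<le> vnorm M u" if "j < d" for j
    proof -
      have "(z $ j)\<^sup>2 \<le> (\<Sum>j<d. (z $ j)\<^sup>2)"
        using that by (intro member_le_sum) auto
      then show ?thesis
        unfolding vnorm_factor(2)[OF A AM u] z_def[symmetric] scalar_prod_self[OF z]
        using real_sqrt_le_mono by fastforce
    qed
    have "\<bar>u $ i\<bar> = \<bar>\<Sum>j<d. B $$ (i, j) * z $ j\<bar>"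
      unfolding uz using B z i by (auto simp: scalar_prod_def atLeast0LessThan)
    also have "\<dots> \<le> (\<Sum>j<d. \<bar>B $$ (i, j)\<bar> * \<bar>z $ j\<bar>)"
      by (rule order.trans[OF sum_abs]) (simp add: abs_mult)
    also have "\<dots> \<le> (\<Sum>j<d. \<bar>B $$ (i, j)\<bar> * vnorm M u)"
      using zn by (intro sum_mono mult_left_mono) auto
    also have "\<dots> = (\<Sum>j<d. \<bar>B $$ (i, j)\<bar>) * vnorm M u"
      by (simp add: sum_distrib_right)
    also have "\<dots> \<le> c * vnorm M u"
      unfolding c_def using i zn[of i] by (intro mult_right_mono member_le_sum[of i]) (auto intro: sum_nonneg)
    finally show ?thesis .
  qed
  moreover have "c \<ge> 0" by (auto simp: c_def intro!: sum_nonneg)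
  ultimately show ?thesis by blast
qed

subsection \<open>Tail bounds for the sample\<close>

lemma prob_space_std_normal: "prob_space std_normal_distribution"
  by (rule prob_space_normal_density) simp

lemma distributed_scaled_std_normal:
  assumes "s > 0" and "prob_space P" and "distributed P lborel X std_normal_density"
  shows "distributed P lborel (\<lambda>z. s * X z) (normal_density 0 s)"
proof -
  interpret prob_space P by fact
  show ?thesis
    using normal_density_affine[of X 0 1 s 0] assms by simp
qed

lemma nn_integral_distributed_eq:
  assumes "distributed P lborel X g" "distributed Q lborel Y g" "f \<in> borel_measurable borel"
  shows "(\<integral>\<^sup>+ x. f (X x) \<partial>P) = (\<integral>\<^sup>+ y. f (Y y) \<partial>Q)"
  using distributed_nn_integral[OF assms(1), of f] distributed_nn_integral[OF assms(2), of f] assms(3)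
  by simp

text \<open>Independent normals add up to a normal whose variance is the sum of the variances. A
  normal density requires a positive standard deviation, so zero coefficients are dropped first
  (\<open>J\<close>); if none remains, both integrands are the constant \<open>f 0\<close>.\<close>

lemma nn_integral_std_normal_linear:
  fixes a :: "nat \<Rightarrow> real"
  assumes f: "f \<in> borel_measurable borel"
  shows "(\<integral>\<^sup>+ z. f (\<Sum>i<d. a i * z i) \<partial>(\<Pi>\<^sub>M i\<in>{..<d}. std_normal_distribution))
       = (\<integral>\<^sup>+ x. f (sqrt (\<Sum>i<d. (a i)\<^sup>2) * x) \<partial>std_normal_distribution)"
proof -
  define P where "P = (\<Pi>\<^sub>M i\<in>{..<d}. std_normal_distribution)"
  define J where "J = {i\<in>{..<d}. a i \<noteq> 0}"
  interpret N: prob_space std_normal_distribution by (rule prob_space_std_normal)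
  interpret P: prob_space P
    unfolding P_def by (rule prob_space_PiM) (rule prob_space_std_normal)
  have sJ: "(\<Sum>i<d. a i * z i) = (\<Sum>i\<in>J. a i * z i)" for z
    unfolding J_def by (rule sum.mono_neutral_right) auto
  have qJ: "(\<Sum>i<d. (a i)\<^sup>2) = (\<Sum>i\<in>J. (a i)\<^sup>2)"
    unfolding J_def by (rule sum.mono_neutral_right) auto
  show ?thesis
  proof (cases "J = {}")
    case True
    then show ?thesis
      unfolding sJ qJ P_def[symmetric] using P.emeasure_space_1 N.emeasure_space_1 by simp
  next
    case False
    have fJ: "finite J" by (simp add: J_def)
    define s where "s = sqrt (\<Sum>i\<in>J. (a i)\<^sup>2)"
    have s: "s > 0"
      unfolding s_def using False fJ by (auto intro!: sum_pos simp: J_def)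
    have meas: "(\<lambda>z. z i) \<in> borel_measurable P" if "i \<in> J" for i
    proof -
      have "(\<lambda>z. z i) \<in> measurable P std_normal_distribution"
        using that unfolding P_def J_def by (intro measurable_component_singleton) auto
      then show ?thesis by simp
    qed
    have comp: "distr P borel (\<lambda>z. z i) = std_normal_distribution" if "i \<in> J" for i
    proof -
      have "distr P std_normal_distribution (\<lambda>z. z i) = std_normal_distribution"
        using that unfolding P_def J_def
        by (intro distr_PiM_component prob_space_std_normal) auto
      moreover have "distr P borel (\<lambda>z. z i) = distr P std_normal_distribution (\<lambda>z. z i)"
        by (intro distr_cong) auto
      ultimately show ?thesis by simp
    qed
    have dist: "distributed P lborel (\<lambda>z. z i) std_normal_density" if "i \<in> J" for i
      unfolding distributed_def using comp[OF that] meas[OF that]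
      by (auto cong: distr_cong)
    have "P.indep_vars (\<lambda>_. std_normal_distribution) (\<lambda>i z. z i) {..<d}"
    proof (subst P.indep_vars_iff_distr_eq_PiM')
      show "{..<d} \<noteq> {}" using False by (auto simp: J_def)
      show "(\<lambda>z. z i) \<in> measurable P std_normal_distribution" if "i \<in> {..<d}" for i
        using that unfolding P_def by (intro measurable_component_singleton) auto
      have "distr P P (\<lambda>x. \<lambda>i\<in>{..<d}. x i) = distr P P (\<lambda>x. x)"
        by (intro distr_cong) (auto simp: P_def space_PiM PiE_def extensional_def restrict_def fun_eq_iff)
      moreover have "(\<Pi>\<^sub>M i\<in>{..<d}. distr P std_normal_distribution (\<lambda>z. z i)) = P"
        unfolding P_def
        by (intro PiM_cong refl distr_PiM_component prob_space_std_normal) auto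
      ultimately show "distr P (\<Pi>\<^sub>M i\<in>{..<d}. std_normal_distribution) (\<lambda>x. \<lambda>i\<in>{..<d}. x i)
          = (\<Pi>\<^sub>M i\<in>{..<d}. distr P std_normal_distribution (\<lambda>z. z i))"
        by (simp add: P_def[symmetric])
    qed
    then have "P.indep_vars (\<lambda>_. std_normal_distribution) (\<lambda>i z. z i) J"
      by (rule P.indep_vars_subset) (auto simp: J_def)
    then have "P.indep_vars (\<lambda>_. borel) (\<lambda>i z. a i * z i) J"
      by (rule P.indep_vars_compose2) auto
    moreover have "distributed P lborel (\<lambda>z. a i * z i) (normal_density 0 \<bar>a i\<bar>)" if "i \<in> J" for i
      using P.normal_density_affine[OF dist[OF that], of "a i" 0] that by (auto simp: J_def)
    ultimately have "distributed P lborel (\<lambda>z. \<Sum>i\<in>J. a i * z i)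
        (normal_density (\<Sum>i\<in>J. 0) (sqrt (\<Sum>i\<in>J. \<bar>a i\<bar>\<^sup>2)))"
      using False fJ by (intro P.sum_indep_normal) (auto simp: J_def)
    then have D1: "distributed P lborel (\<lambda>z. \<Sum>i\<in>J. a i * z i) (normal_density 0 s)"
      by (simp add: s_def)
    have "distributed std_normal_distribution lborel (\<lambda>x. x) std_normal_density"
      unfolding distributed_def by (auto intro!: distr_id2)
    then have D2: "distributed std_normal_distribution lborel (\<lambda>x. s * x) (normal_density 0 s)"
      by (intro distributed_scaled_std_normal s prob_space_std_normal)
    show ?thesis
      unfolding sJ qJ P_def[symmetric] s_def[symmetric]
      by (rule nn_integral_distributed_eq[OF D1 D2 f])
  qed
qed

text \<open>The exponent is such that the integrand times the standard density is \<sigma> times the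
  density with standard deviation \<sigma>. The value 2 for \<sigma> gives the exponent 3/8 to which
  the upper tails are reduced, the value 1/2 gives -3/2 for the lower tail of the energy.\<close>

lemma nn_integral_std_normal_exp_square:
  assumes "\<sigma> > 0"
  shows "(\<integral>\<^sup>+ x. ennreal (exp ((1 - 1 / \<sigma>\<^sup>2) / 2 * x\<^sup>2)) \<partial>std_normal_distribution) = ennreal \<sigma>"
proof -
  have eq: "ennreal (std_normal_density x) * ennreal (exp ((1 - 1 / \<sigma>\<^sup>2) / 2 * x\<^sup>2))
      = ennreal \<sigma> * ennreal (normal_density 0 \<sigma> x)" for x
  proof -
    have "std_normal_density x * exp ((1 - 1 / \<sigma>\<^sup>2) / 2 * x\<^sup>2) = \<sigma> * normal_density 0 \<sigma> x"
      using assms by (simp add: normal_density_def real_sqrt_mult exp_add[symmetric] algebra_simps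
          diff_divide_distrib add_divide_distrib)
    then show ?thesis using assms by (simp add: ennreal_mult'[symmetric])
  qed
  interpret prob_space "density lborel (\<lambda>x. ennreal (normal_density 0 \<sigma> x))"
    by (rule prob_space_normal_density) fact
  have "(\<integral>\<^sup>+ x. ennreal (normal_density 0 \<sigma> x) \<partial>lborel) = 1"
    using emeasure_space_1 by (simp add: emeasure_density)
  moreover have "(\<integral>\<^sup>+ x. ennreal (exp ((1 - 1 / \<sigma>\<^sup>2) / 2 * x\<^sup>2)) \<partial>std_normal_distribution)
      = (\<integral>\<^sup>+ x. ennreal \<sigma> * ennreal (normal_density 0 \<sigma> x) \<partial>lborel)"
    unfolding eq[symmetric] by (rule nn_integral_density) simp_all
  ultimately show ?thesis
    by (simp add: nn_integral_cmult)
qed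

section \<open>Exponential moments of a single observation\<close>

lemma abs_power_le_exp_square:
  fixes x :: real
  assumes "k \<ge> 1"
  shows "\<bar>x\<bar> ^ k \<le> (1 + (8 * real k) ^ k) * exp (x\<^sup>2 / 8)"
proof (cases "\<bar>x\<bar> \<le> 1")
  case True
  then have "\<bar>x\<bar> ^ k \<le> 1" by (simp add: power_le_one)
  also have "1 \<le> (1 + (8 * real k) ^ k) * exp (x\<^sup>2 / 8)"
    using mult_mono[of 1 "1 + (8 * real k) ^ k" 1 "exp (x\<^sup>2 / 8)"] by simp
  finally show ?thesis .
next
  case False
  let ?y = "x\<^sup>2 / (8 * real k)"
  have "\<bar>x\<bar> ^ k \<le> (x\<^sup>2) ^ k"
    using False power_increasing[of k "2 * k" "\<bar>x\<bar>"] by (simp add: power_mult)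
  also have "(x\<^sup>2) ^ k = (8 * real k) ^ k * ?y ^ k"
    unfolding power_mult_distrib[symmetric] using assms by simp
  also have "\<dots> \<le> (8 * real k) ^ k * exp ?y ^ k"
  proof (intro mult_left_mono power_mono)
    show "?y \<le> exp ?y"
      using exp_ge_add_one_self[of ?y] by linarith
  qed auto
  also have "exp ?y ^ k = exp (x\<^sup>2 / 8)"
    using assms by (simp add: exp_of_nat_mult[symmetric])
  also have "(8 * real k) ^ k * exp (x\<^sup>2 / 8) \<le> (1 + (8 * real k) ^ k) * exp (x\<^sup>2 / 8)"
    by (intro mult_right_mono) auto
  finally show ?thesis .
qed

text \<open>
  Equals \<open>\<bar>x\<bar>\<^sup>k / (4 t\<^sup>k\<^sup>-\<^sup>2)\<close> for \<open>\<bar>x\<bar> \<le> t\<close> and \<open>x\<^sup>2 / 4\<close> beyond, so that it has an exponential moment.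
\<close>

definition tempered_power :: "nat \<Rightarrow> real \<Rightarrow> real \<Rightarrow> real" where
  "tempered_power k t x = x\<^sup>2 / 4 * min 1 ((\<bar>x\<bar> / t) ^ (k - 2))"

text \<open>The bracket is the constant of \<open>abs_power_le_exp_square\<close>; the factor 2 is
  the Gaussian integral of \<open>exp (3 / 8 * x\<^sup>2)\<close>.\<close>

definition moment_const :: "nat \<Rightarrow> real" where
  "moment_const k = 2 * (1 + (8 * real k) ^ k)"

lemma tempered_power_measurable [measurable]: "tempered_power k t \<in> borel_measurable borel"
  unfolding tempered_power_def[abs_def] by measurable

lemma exp_le_one_add_mult_exp: "exp y \<le> 1 + y * exp y" for y :: real
proof -
  have "(1 - y) * exp y \<le> exp (- y) * exp y"
    using exp_ge_add_one_self[of "-y"] by (intro mult_right_mono) auto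
  then show ?thesis by (simp add: exp_minus algebra_simps)
qed

text \<open>By \<open>exp_le_one_add_mult_exp\<close> it is enough to integrate
  \<open>h * exp h\<close>. The two bounds on \<open>h\<close> are used in different places: the
  \<open>k\<close>-th power for the factor, which yields the small \<open>1 / t ^ (k - 2)\<close>,
  and \<open>x\<^sup>2 / 4\<close> in the exponent, which keeps it integrable. With the 1/8 from
  \<open>abs_power_le_exp_square\<close> the exponents add up to 3/8, below the critical 1/2. The
  scale \<open>s\<close> stands for \<open>vnorm M w\<close>.\<close>

lemma nn_integral_exp_tempered_power_le:
  assumes k: "k \<ge> 2" and t: "t > 0" and s: "0 \<le> s" "s \<le> 1"
  shows "(\<integral>\<^sup>+ x. ennreal (exp (tempered_power k t (s * x))) \<partial>std_normal_distribution)
    \<le> ennreal (exp (moment_const k / t ^ (k - 2)))"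
proof -
  define D where "D = (1 + (8 * real k) ^ k) / t ^ (k - 2)"
  have D: "D \<ge> 0" using t by (auto simp: D_def)
  interpret N: prob_space std_normal_distribution by (rule prob_space_std_normal)
  have bound: "exp (tempered_power k t (s * x)) \<le> 1 + D * exp (3 / 8 * x\<^sup>2)" for x
  proof -
    let ?h = "tempered_power k t (s * x)"
    have sx: "(s * x)\<^sup>2 \<le> x\<^sup>2"
      using s mult_right_mono[of "s\<^sup>2" 1 "x\<^sup>2"] by (simp add: power_mult_distrib power_le_one)
    have sa: "\<bar>s * x\<bar> \<le> \<bar>x\<bar>"
      using sx by (simp add: abs_le_square_iff)
    have h0: "?h \<ge> 0"
      using t by (auto simp: tempered_power_def)
    have "?h \<le> (s * x)\<^sup>2 / 4 * 1"
      unfolding tempered_power_def by (intro mult_left_mono) auto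
    then have h1: "?h \<le> x\<^sup>2 / 4"
      using sx by simp
    have "?h \<le> (s * x)\<^sup>2 / 4 * (\<bar>s * x\<bar> / t) ^ (k - 2)"
      unfolding tempered_power_def by (intro mult_left_mono) auto
    also have "\<dots> = (\<bar>s * x\<bar>\<^sup>2 * \<bar>s * x\<bar> ^ (k - 2)) / (4 * t ^ (k - 2))"
      by (simp add: power_divide)
    also have "\<bar>s * x\<bar>\<^sup>2 * \<bar>s * x\<bar> ^ (k - 2) = \<bar>s * x\<bar> ^ k"
      using k by (metis le_add_diff_inverse power_add)
    also have "\<dots> / (4 * t ^ (k - 2)) \<le> \<bar>x\<bar> ^ k / t ^ (k - 2)"
      using t power_mono[OF sa, of k] by (intro frac_le) auto
    finally have h2: "?h \<le> \<bar>x\<bar> ^ k / t ^ (k - 2)" .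
    have "?h * exp ?h \<le> (\<bar>x\<bar> ^ k / t ^ (k - 2)) * exp (x\<^sup>2 / 4)"
      using h0 h1 h2 t by (intro mult_mono) auto
    also have "\<dots> \<le> ((1 + (8 * real k) ^ k) * exp (x\<^sup>2 / 8) / t ^ (k - 2)) * exp (x\<^sup>2 / 4)"
      using abs_power_le_exp_square[of k x] k t by (intro mult_right_mono divide_right_mono) auto
    also have "\<dots> = D * exp (x\<^sup>2 / 8 + x\<^sup>2 / 4)"
      unfolding exp_add by (simp add: D_def)
    also have "x\<^sup>2 / 8 + x\<^sup>2 / 4 = 3 / 8 * x\<^sup>2" by simp
    finally show ?thesis
      using exp_le_one_add_mult_exp[of ?h] by linarith
  qed
  have "(\<integral>\<^sup>+ x. ennreal (exp (tempered_power k t (s * x))) \<partial>std_normal_distribution)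
      \<le> (\<integral>\<^sup>+ x. 1 + ennreal D * ennreal (exp ((1 - 1 / 2\<^sup>2) / 2 * x\<^sup>2)) \<partial>std_normal_distribution)"
  proof (intro nn_integral_mono)
    fix x
    have "ennreal (exp (tempered_power k t (s * x))) \<le> ennreal (1 + D * exp (3 / 8 * x\<^sup>2))"
      by (intro ennreal_leI bound)
    then show "ennreal (exp (tempered_power k t (s * x)))
        \<le> 1 + ennreal D * ennreal (exp ((1 - 1 / 2\<^sup>2) / 2 * x\<^sup>2))"
      using D by (simp add: ennreal_mult')
  qed
  also have "\<dots> = 1 + ennreal D * ennreal 2"
    using N.emeasure_space_1
    by (subst nn_integral_add, simp, simp, subst nn_integral_cmult, simp,
        subst nn_integral_std_normal_exp_square) auto
  also have "\<dots> = ennreal (1 + D * 2)"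
    using D by (simp add: ennreal_mult'')
  also have "\<dots> \<le> ennreal (exp (D * 2))"
    by (intro ennreal_leI) simp
  also have "D * 2 = moment_const k / t ^ (k - 2)"
    by (simp add: D_def moment_const_def)
  finally show ?thesis .
qed

lemma exp_le_quadratic: "exp y \<le> 1 + y + y\<^sup>2 * exp \<bar>y\<bar>" for y :: real
proof (cases "0 \<le> y")
  case True
  have "y * exp y \<le> y * (1 + y * exp y)"
    using True exp_le_one_add_mult_exp by (intro mult_left_mono)
  then show ?thesis
    using True exp_le_one_add_mult_exp[of y] by (simp add: power2_eq_square algebra_simps)
next
  case False
  define z where "z = - y"
  have z: "z > 0" using False by (simp add: z_def)
  have "exp y = 1 / exp z"
    by (simp add: z_def exp_minus inverse_eq_divide)
  also have "\<dots> \<le> 1 / (1 + z)"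
    using z exp_ge_add_one_self[of z] by (intro divide_left_mono) auto
  also have "\<dots> \<le> 1 - z + z\<^sup>2"
  proof -
    have "(1 - z + z\<^sup>2) * (1 + z) = 1 + z ^ 3"
      by (simp add: power2_eq_square power3_eq_cube algebra_simps)
    then show ?thesis using z by (simp add: pos_divide_le_eq)
  qed
  also have "z\<^sup>2 \<le> z\<^sup>2 * exp \<bar>y\<bar>"
    using mult_left_mono[of 1 "exp \<bar>y\<bar>" "z\<^sup>2"] by simp
  finally show ?thesis by (simp add: z_def)
qed

text \<open>Both exponentials are expanded to second order, and the weights \<open>p\<close> and
  \<open>1 - p\<close> cancel the linear terms because the noise has mean zero. The remainder does
  not depend on \<open>p\<close>, which makes the score bound uniform in \<beta>.\<close>

lemma centered_bernoulli_mgf_le: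
  fixes p x :: real
  assumes "0 \<le> p" "p \<le> 1"
  shows "p * exp ((p - 1) * x) + (1 - p) * exp (p * x) \<le> 1 + x\<^sup>2 * exp \<bar>x\<bar>"
proof -
  have q: "exp (c * x) \<le> 1 + c * x + x\<^sup>2 * exp \<bar>x\<bar>" if "\<bar>c\<bar> \<le> 1" for c
  proof -
    have "\<bar>c * x\<bar> \<le> \<bar>x\<bar>"
      using that mult_right_mono[of "\<bar>c\<bar>" 1 "\<bar>x\<bar>"] by (simp add: abs_mult)
    moreover from this have "(c * x)\<^sup>2 \<le> x\<^sup>2" by (simp add: abs_le_square_iff)
    ultimately have "(c * x)\<^sup>2 * exp \<bar>c * x\<bar> \<le> x\<^sup>2 * exp \<bar>x\<bar>"
      by (intro mult_mono) auto
    then show ?thesis using exp_le_quadratic[of "c * x"] by linarith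
  qed
  let ?B = "x\<^sup>2 * exp \<bar>x\<bar>"
  have "p * exp ((p - 1) * x) + (1 - p) * exp (p * x)
      \<le> p * (1 + (p - 1) * x + ?B) + (1 - p) * (1 + p * x + ?B)"
    using assms q[of "p - 1"] q[of p] by (intro add_mono mult_left_mono) auto
  also have "\<dots> = 1 + ?B" by (simp add: algebra_simps)
  finally show ?thesis .
qed

text \<open>Brings that remainder to the exponent 3/8. In 72 = 8 * 9, the 9 bounds
  \<open>exp 2\<close> and the 8 comes from bounding \<open>x\<^sup>2\<close> by
  \<open>8 * exp (x\<^sup>2 / 8)\<close>.\<close>

lemma square_exp_abs_le: "x\<^sup>2 * exp \<bar>x\<bar> \<le> 72 * exp (3 / 8 * x\<^sup>2)" for x :: real
proof -
  have "\<bar>x\<bar> \<le> 2 + x\<^sup>2 / 8"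
    using zero_le_power2[of "\<bar>x\<bar> - 4"] by (simp add: power2_diff)
  then have "exp \<bar>x\<bar> \<le> exp 2 * exp (x\<^sup>2 / 8)"
    by (simp add: exp_add[symmetric])
  also have "exp (2::real) \<le> 9"
  proof -
    have "exp (2::real) = exp 1 ^ 2" by (simp add: exp_of_nat_mult[symmetric])
    also have "\<dots> \<le> 3\<^sup>2" using exp_le by (intro power_mono) auto
    finally show ?thesis by simp
  qed
  finally have "exp \<bar>x\<bar> \<le> 9 * exp (x\<^sup>2 / 8)" by simp
  moreover have "x\<^sup>2 \<le> 8 * exp (x\<^sup>2 / 8)"
    using exp_ge_add_one_self[of "x\<^sup>2 / 8"] by linarith
  ultimately have "x\<^sup>2 * exp \<bar>x\<bar> \<le> (8 * exp (x\<^sup>2 / 8)) * (9 * exp (x\<^sup>2 / 8))"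
    by (intro mult_mono) auto
  also have "\<dots> = 72 * exp (x\<^sup>2 / 4)"
    by (simp add: exp_add[symmetric])
  also have "\<dots> \<le> 72 * exp (3 / 8 * x\<^sup>2)"
    by simp
  finally show ?thesis .
qed

section \<open>The law of a single observation\<close>

lemma borel_vec_component_measurable:
  assumes "i < d"
  shows "(\<lambda>x. x $ i) \<in> borel_measurable (borel_vec d)"
proof -
  have "(\<lambda>x. \<lambda>i\<in>{..<d}. x $ i) \<in> measurable (borel_vec d) (\<Pi>\<^sub>M i\<in>{..<d}. borel)"
    unfolding borel_vec_def by (rule measurable_vimage_algebra1) (auto simp: space_PiM)
  from measurable_compose[OF this measurable_component_singleton[of i "{..<d}"]] assms
  show ?thesis by simp
qed

lemma borel_vec_scalar_prod_measurable:
  assumes "w \<in> carrier_vec d"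
  shows "(\<lambda>x. x \<bullet> w) \<in> borel_measurable (borel_vec d)"
proof -
  have "(\<lambda>x. \<Sum>i<d. x $ i * w $ i) \<in> borel_measurable (borel_vec d)"
    by (intro borel_measurable_sum borel_measurable_times borel_vec_component_measurable
        borel_measurable_const) auto
  then show ?thesis using assms by (simp add: scalar_prod_def atLeast0LessThan)
qed

lemma space_borel_vec: "space (borel_vec d) = carrier_vec d"
  by (simp add: borel_vec_def)

lemma linear_image_measurable:
  assumes "A \<in> carrier_mat d d"
  shows "(\<lambda>z. A *\<^sub>v vec d z) \<in> measurable (\<Pi>\<^sub>M i\<in>{..<d}. std_normal_distribution) (borel_vec d)"
  unfolding borel_vec_def
proof (rule measurable_vimage_algebra2)
  show "(\<lambda>z. A *\<^sub>v vec d z) \<in> space (\<Pi>\<^sub>M i\<in>{..<d}. std_normal_distribution) \<rightarrow> carrier_vec d"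
    using assms by auto
  have "(\<lambda>z. \<lambda>i\<in>{..<d}. \<Sum>j<d. A $$ (i, j) * z j)
      \<in> measurable (\<Pi>\<^sub>M i\<in>{..<d}. std_normal_distribution) (\<Pi>\<^sub>M i\<in>{..<d}. borel)"
  proof (intro measurable_restrict borel_measurable_sum borel_measurable_times borel_measurable_const)
    fix j assume "j \<in> {..<d}"
    then have "(\<lambda>z. z j) \<in> measurable (\<Pi>\<^sub>M i\<in>{..<d}. std_normal_distribution) std_normal_distribution"
      by (rule measurable_component_singleton)
    then show "(\<lambda>z. z j) \<in> borel_measurable (\<Pi>\<^sub>M i\<in>{..<d}. std_normal_distribution)"
      by simp
  qed
  moreover have "(\<lambda>i\<in>{..<d}. (A *\<^sub>v vec d z) $ i) = (\<lambda>i\<in>{..<d}. \<Sum>j<d. A $$ (i, j) * z j)" for z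
    using assms by (auto simp: fun_eq_iff restrict_def scalar_prod_def atLeast0LessThan)
  ultimately show "(\<lambda>z. \<lambda>i\<in>{..<d}. (A *\<^sub>v vec d z) $ i)
      \<in> measurable (\<Pi>\<^sub>M i\<in>{..<d}. std_normal_distribution) (\<Pi>\<^sub>M i\<in>{..<d}. borel)"
    by simp
qed

lemma gaussian_law_sets:
  assumes "gaussian_law d M \<mu>"
  shows "sets \<mu> = sets (borel_vec d)" "space \<mu> = carrier_vec d"
  using assms by (auto simp: gaussian_law_def space_borel_vec)

lemma gaussian_law_prob_space:
  assumes "gaussian_law d M \<mu>"
  shows "prob_space \<mu>"
proof -
  obtain A where A: "A \<in> carrier_mat d d"
    and \<mu>: "\<mu> = distr (\<Pi>\<^sub>M i\<in>{..<d}. std_normal_distribution) (borel_vec d) (\<lambda>z. A *\<^sub>v vec d z)"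
    using assms by (auto simp: gaussian_law_def)
  interpret prob_space "\<Pi>\<^sub>M i\<in>{..<d}. std_normal_distribution"
    by (rule prob_space_PiM) (rule prob_space_std_normal)
  show ?thesis
    unfolding \<mu> by (rule prob_space_distr) (rule linear_image_measurable[OF A])
qed

text \<open>For \<open>X = A Z\<close> the product \<open>X \<bullet> w\<close> is \<open>Z\<close>
  paired with \<open>transpose_mat A *\<^sub>v w\<close>, whose Euclidean norm is
  \<open>vnorm M w\<close>. Every estimate on the features passes through this reduction to
  dimension one.\<close>

lemma gaussian_law_marginal:
  assumes G: "gaussian_law d M \<mu>" and w: "w \<in> carrier_vec d" and f: "f \<in> borel_measurable borel"
  shows "(\<integral>\<^sup>+ x. f (x \<bullet> w) \<partial>\<mu>) = (\<integral>\<^sup>+ x. f (vnorm M w * x) \<partial>std_normal_distribution)"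
proof -
  obtain A where A: "A \<in> carrier_mat d d" and AM: "A * transpose_mat A = M"
    and \<mu>: "\<mu> = distr (\<Pi>\<^sub>M i\<in>{..<d}. std_normal_distribution) (borel_vec d) (\<lambda>z. A *\<^sub>v vec d z)"
    using G by (auto simp: gaussian_law_def)
  define u where "u = transpose_mat A *\<^sub>v w"
  have u: "u \<in> carrier_vec d" using A w by (simp add: u_def)
  have m: "(\<lambda>x. f (x \<bullet> w)) \<in> borel_measurable (distr (\<Pi>\<^sub>M i\<in>{..<d}. std_normal_distribution)
      (borel_vec d) (\<lambda>z. A *\<^sub>v vec d z))"
    using measurable_compose[OF borel_vec_scalar_prod_measurable[OF w] f] by simp
  have eq: "(A *\<^sub>v vec d z) \<bullet> w = (\<Sum>i<d. u $ i * z i)" for z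
  proof -
    have "(A *\<^sub>v vec d z) \<bullet> w = w \<bullet> (A *\<^sub>v vec d z)"
      using A w by (intro comm_scalar_prod[of _ d]) auto
    also have "\<dots> = u \<bullet> vec d z"
      unfolding u_def by (rule transpose_vec_mult_scalar[symmetric, OF A _ w]) simp
    also have "\<dots> = (\<Sum>i<d. u $ i * z i)"
      by (simp add: scalar_prod_def atLeast0LessThan)
    finally show ?thesis .
  qed
  have v: "vnorm M w = sqrt (\<Sum>i<d. (u $ i)\<^sup>2)"
    unfolding vnorm_factor(2)[OF A AM w] u_def[symmetric] scalar_prod_self[OF u] ..
  show ?thesis
    unfolding \<mu> nn_integral_distr[OF linear_image_measurable[OF A] m] eq v
    by (rule nn_integral_std_normal_linear[OF f])
qed

lemma sigmoid_bounds: "0 < sigmoid t" "sigmoid t < 1"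
  by (auto simp: sigmoid_def add_pos_pos inverse_less_1_iff)

lemma sigmoid_measurable [measurable]: "sigmoid \<in> borel_measurable borel"
  unfolding sigmoid_def[abs_def] by measurable

lemma logit_density_measurable:
  assumes G: "gaussian_law d M \<mu>" and b: "\<beta> \<in> carrier_vec d"
  shows "(\<lambda>(x, y). ennreal (pmf (bernoulli_pmf (sigmoid (x \<bullet> \<beta>))) y))
    \<in> borel_measurable (\<mu> \<Otimes>\<^sub>M count_space (UNIV :: bool set))"
proof -
  have [measurable]: "(\<lambda>x. x \<bullet> \<beta>) \<in> borel_measurable \<mu>"
    using borel_vec_scalar_prod_measurable[OF b] measurable_cong_sets[OF gaussian_law_sets(1)[OF G] refl]
    by blast
  have "(\<lambda>(x, y). ennreal (pmf (bernoulli_pmf (sigmoid (x \<bullet> \<beta>))) y))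
      = (\<lambda>\<xi>. ennreal (if snd \<xi> then sigmoid (fst \<xi> \<bullet> \<beta>) else 1 - sigmoid (fst \<xi> \<bullet> \<beta>)))"
  proof (intro ext, clarify)
    fix x :: "real vec" and y :: bool
    show "ennreal (pmf (bernoulli_pmf (sigmoid (x \<bullet> \<beta>))) y) = ennreal (if snd (x, y)
        then sigmoid (fst (x, y) \<bullet> \<beta>) else 1 - sigmoid (fst (x, y) \<bullet> \<beta>))"
      using sigmoid_bounds[of "x \<bullet> \<beta>"] by (cases y) auto
  qed
  then show ?thesis by simp
qed

lemma logit_law_sets:
  shows "sets (logit_law \<mu> \<beta>) = sets (\<mu> \<Otimes>\<^sub>M count_space UNIV)"
    and "space (logit_law \<mu> \<beta>) = space \<mu> \<times> UNIV"
  by (simp_all add: logit_law_def space_pair_measure)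

lemma nn_integral_logit_law:
  assumes G: "gaussian_law d M \<mu>" and b: "\<beta> \<in> carrier_vec d"
    and f: "f \<in> borel_measurable (\<mu> \<Otimes>\<^sub>M count_space UNIV)"
  shows "(\<integral>\<^sup>+ \<xi>. f \<xi> \<partial>logit_law \<mu> \<beta>)
    = (\<integral>\<^sup>+ x. ennreal (sigmoid (x \<bullet> \<beta>)) * f (x, True) + ennreal (1 - sigmoid (x \<bullet> \<beta>)) * f (x, False) \<partial>\<mu>)"
proof -
  interpret C: sigma_finite_measure "count_space (UNIV :: bool set)"
    by (rule sigma_finite_measure_count_space_finite) simp
  let ?p = "\<lambda>(x, y). ennreal (pmf (bernoulli_pmf (sigmoid (x \<bullet> \<beta>))) y)"
  note m = logit_density_measurable[OF G b]
  have "(\<integral>\<^sup>+ \<xi>. f \<xi> \<partial>logit_law \<mu> \<beta>) = (\<integral>\<^sup>+ \<xi>. ?p \<xi> * f \<xi> \<partial>(\<mu> \<Otimes>\<^sub>M count_space UNIV))"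
    unfolding logit_law_def by (rule nn_integral_density[OF m f])
  also have "\<dots> = (\<integral>\<^sup>+ x. \<integral>\<^sup>+ y. ?p (x, y) * f (x, y) \<partial>count_space UNIV \<partial>\<mu>)"
    using m f by (intro C.nn_integral_fst[symmetric]) simp
  also have "\<dots> = (\<integral>\<^sup>+ x. ennreal (sigmoid (x \<bullet> \<beta>)) * f (x, True) + ennreal (1 - sigmoid (x \<bullet> \<beta>)) * f (x, False) \<partial>\<mu>)"
  proof (intro nn_integral_cong)
    fix x
    show "(\<integral>\<^sup>+ y. ?p (x, y) * f (x, y) \<partial>count_space UNIV)
        = ennreal (sigmoid (x \<bullet> \<beta>)) * f (x, True) + ennreal (1 - sigmoid (x \<bullet> \<beta>)) * f (x, False)"
      using sigmoid_bounds[of "x \<bullet> \<beta>"] by (simp add: nn_integral_count_space_finite UNIV_bool)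
  qed
  finally show ?thesis .
qed

lemma nn_integral_logit_law_fst:
  assumes G: "gaussian_law d M \<mu>" and b: "\<beta> \<in> carrier_vec d" and f: "f \<in> borel_measurable \<mu>"
  shows "(\<integral>\<^sup>+ \<xi>. f (fst \<xi>) \<partial>logit_law \<mu> \<beta>) = (\<integral>\<^sup>+ x. f x \<partial>\<mu>)"
proof -
  have m: "(\<lambda>\<xi>. f (fst \<xi>)) \<in> borel_measurable (\<mu> \<Otimes>\<^sub>M count_space (UNIV :: bool set))"
    using f by measurable
  have "ennreal (sigmoid t) * c + ennreal (1 - sigmoid t) * c = c" for t c
    using sigmoid_bounds[of t]
    by (simp add: distrib_right[symmetric] ennreal_plus[symmetric] del: ennreal_plus)
  then show ?thesis
    unfolding nn_integral_logit_law[OF G b m] by simp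
qed

lemma logit_law_prob_space:
  assumes G: "gaussian_law d M \<mu>" and b: "\<beta> \<in> carrier_vec d"
  shows "prob_space (logit_law \<mu> \<beta>)"
proof
  interpret prob_space \<mu> by (rule gaussian_law_prob_space[OF G])
  have "emeasure (logit_law \<mu> \<beta>) (space (logit_law \<mu> \<beta>)) = (\<integral>\<^sup>+ \<xi>. 1 \<partial>logit_law \<mu> \<beta>)"
    by simp
  also have "\<dots> = 1"
    using nn_integral_logit_law_fst[OF G b, of "\<lambda>_. 1"] by (simp add: emeasure_space_1)
  finally show "emeasure (logit_law \<mu> \<beta>) (space (logit_law \<mu> \<beta>)) = 1" .
qed

section \<open>Chernoff bounds and the union bound over the net\<close>

lemma product_chernoff_bound:
  fixes f :: "'a \<Rightarrow> real" and n :: nat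
  assumes L: "prob_space L" and f: "f \<in> borel_measurable L"
    and mgf: "(\<integral>\<^sup>+ \<xi>. ennreal (exp (f \<xi>)) \<partial>L) \<le> ennreal (exp a)"
    and c: "c \<ge> real n * a + s"
  shows "{\<omega> \<in> space (\<Pi>\<^sub>M i\<in>{..<n}. L). c \<le> (\<Sum>i<n. f (\<omega> i))} \<in> sets (\<Pi>\<^sub>M i\<in>{..<n}. L)"
    and "measure (\<Pi>\<^sub>M i\<in>{..<n}. L) {\<omega> \<in> space (\<Pi>\<^sub>M i\<in>{..<n}. L). c \<le> (\<Sum>i<n. f (\<omega> i))} \<le> exp (- s)"
proof -
  let ?P = "\<Pi>\<^sub>M i\<in>{..<n}. L"
  interpret L: prob_space L by fact
  interpret P: prob_space ?P by (rule prob_space_PiM) (rule L)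
  interpret S: product_sigma_finite "\<lambda>_::nat. L"
    by (rule product_sigma_finite.intro) (rule L.sigma_finite_measure_axioms)
  have fm: "(\<lambda>\<omega>. f (\<omega> i)) \<in> borel_measurable ?P" if "i < n" for i
    using that f by (intro measurable_compose[OF measurable_component_singleton]) auto
  have sm: "(\<lambda>\<omega>. \<Sum>i<n. f (\<omega> i)) \<in> borel_measurable ?P"
    using fm by (intro borel_measurable_sum) auto
  show sets: "{\<omega> \<in> space ?P. c \<le> (\<Sum>i<n. f (\<omega> i))} \<in> sets ?P"
    using sm by measurable
  \<comment> \<open>The Laplace parameter is already contained in \<open>f\<close>, so the event has
    the shape of Markov's inequality for the exponential of the sum; independence then factorizes
    the integral.\<close>
  have eq: "{\<omega> \<in> space ?P. 1 \<le> ennreal (exp (- c)) * ennreal (exp (\<Sum>i<n. f (\<omega> i)))}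
      = {\<omega> \<in> space ?P. c \<le> (\<Sum>i<n. f (\<omega> i))}"
    by (auto simp: ennreal_mult'[symmetric] exp_add[symmetric])
  have "(\<integral>\<^sup>+ \<omega>. ennreal (exp (\<Sum>i<n. f (\<omega> i))) * indicator (space ?P) \<omega> \<partial>?P)
      = (\<integral>\<^sup>+ \<omega>. (\<Prod>i<n. ennreal (exp (f (\<omega> i)))) \<partial>?P)"
    by (intro nn_integral_cong) (simp add: exp_sum prod_ennreal)
  also have "\<dots> = (\<Prod>i<n. \<integral>\<^sup>+ \<xi>. ennreal (exp (f \<xi>)) \<partial>L)"
    using f by (intro S.product_nn_integral_prod) auto
  also have "\<dots> \<le> ennreal (exp a) ^ n"
    using mgf by (simp add: power_mono)
  also have "\<dots> = ennreal (exp (real n * a))"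
    by (simp add: ennreal_power exp_of_nat_mult)
  finally have I: "(\<integral>\<^sup>+ \<omega>. ennreal (exp (\<Sum>i<n. f (\<omega> i))) * indicator (space ?P) \<omega> \<partial>?P)
      \<le> ennreal (exp (real n * a))" .
  have "emeasure ?P {\<omega> \<in> space ?P. c \<le> (\<Sum>i<n. f (\<omega> i))}
      \<le> ennreal (exp (- c)) * (\<integral>\<^sup>+ \<omega>. ennreal (exp (\<Sum>i<n. f (\<omega> i))) * indicator (space ?P) \<omega> \<partial>?P)"
    unfolding eq[symmetric] using sm by (intro nn_integral_Markov_inequality) auto
  also have "\<dots> \<le> ennreal (exp (- c)) * ennreal (exp (real n * a))"
    by (rule mult_left_mono[OF I]) simp
  also have "ennreal (exp (- c)) * ennreal (exp (real n * a)) = ennreal (exp (real n * a - c))"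
    by (simp add: ennreal_mult'[symmetric] exp_add[symmetric])
  also have "\<dots> \<le> ennreal (exp (- s))"
    using c by (intro ennreal_leI) simp
  finally have "emeasure ?P {\<omega> \<in> space ?P. c \<le> (\<Sum>i<n. f (\<omega> i))} \<le> ennreal (exp (- s))" .
  then show "measure ?P {\<omega> \<in> space ?P. c \<le> (\<Sum>i<n. f (\<omega> i))} \<le> exp (- s)"
    unfolding measure_def by (intro enn2real_leI) auto
qed

lemma gaussian_law_vnorm_nonneg:
  assumes "gaussian_law d M \<mu>" "w \<in> carrier_vec d"
  shows "0 \<le> vnorm M w"
proof -
  obtain A where A: "A \<in> carrier_mat d d" and AM: "A * transpose_mat A = M"
    using assms(1) by (auto simp: gaussian_law_def)
  have "transpose_mat A *\<^sub>v w \<in> carrier_vec d" using A assms(2) by simp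
  then show ?thesis
    unfolding vnorm_factor(2)[OF A AM assms(2)] by (simp add: scalar_prod_self sum_nonneg)
qed

lemma sample_law_prob_space:
  assumes "gaussian_law d M \<mu>" "\<beta> \<in> carrier_vec d"
  shows "prob_space (sample_law n \<mu> \<beta>)"
  unfolding sample_law_def by (rule prob_space_PiM) (rule logit_law_prob_space[OF assms])

lemma feature_measurable:
  assumes "gaussian_law d M \<mu>" "w \<in> carrier_vec d"
  shows "(\<lambda>x. x \<bullet> w) \<in> borel_measurable \<mu>"
    and "(\<lambda>\<xi>. fst \<xi> \<bullet> w) \<in> borel_measurable (logit_law \<mu> \<beta>)"
proof -
  show m [measurable]: "(\<lambda>x. x \<bullet> w) \<in> borel_measurable \<mu>"
    using borel_vec_scalar_prod_measurable[OF assms(2)]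
      measurable_cong_sets[OF gaussian_law_sets(1)[OF assms(1)] refl] by blast
  have "(\<lambda>\<xi>. fst \<xi> \<bullet> w) \<in> borel_measurable (\<mu> \<Otimes>\<^sub>M count_space (UNIV :: bool set))"
    by measurable
  then show "(\<lambda>\<xi>. fst \<xi> \<bullet> w) \<in> borel_measurable (logit_law \<mu> \<beta>)"
    using measurable_cong_sets[OF logit_law_sets(1) refl] by blast
qed

lemma label_measurable:
  "(\<lambda>\<xi>. of_bool (snd \<xi>) :: real) \<in> borel_measurable (logit_law \<mu> \<beta>)"
proof -
  have "(\<lambda>\<xi>. of_bool (snd \<xi>) :: real) \<in> borel_measurable (\<mu> \<Otimes>\<^sub>M count_space (UNIV :: bool set))"
    by measurable
  then show ?thesis
    using measurable_cong_sets[OF logit_law_sets(1) refl] by blast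
qed

lemma nn_integral_logit_law_feature:
  assumes G: "gaussian_law d M \<mu>" and b: "\<beta> \<in> carrier_vec d" and w: "w \<in> carrier_vec d"
    and f: "f \<in> borel_measurable borel"
  shows "(\<integral>\<^sup>+ \<xi>. f (fst \<xi> \<bullet> w) \<partial>logit_law \<mu> \<beta>)
    = (\<integral>\<^sup>+ x. f (vnorm M w * x) \<partial>std_normal_distribution)"
  using nn_integral_logit_law_fst[OF G b measurable_compose[OF feature_measurable(1)[OF G w] f]]
    gaussian_law_marginal[OF G w f] by simp

text \<open>The exponents of \<open>n\<close> observations total
  \<open>n * moment_const k / t ^ (k - 2)\<close>, which is at most
  \<open>moment_const k * t\<^sup>2\<close> because \<open>real n \<le> t ^ k\<close>. The
  additional \<open>t\<^sup>2\<close> in the level becomes the exponent of the probability.\<close>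

lemma sample_moment_tail:
  fixes n :: nat
  assumes G: "gaussian_law d M \<mu>" and b: "\<beta> \<in> carrier_vec d" and w: "w \<in> carrier_vec d"
    and w1: "vnorm M w \<le> 1" and k: "k \<ge> 2" and t: "t > 0" "real n \<le> t ^ k"
  defines "Bad \<equiv> {\<omega> \<in> space (sample_law n \<mu> \<beta>).
      (moment_const k + 1) * t\<^sup>2 \<le> (\<Sum>i<n. tempered_power k t (fst (\<omega> i) \<bullet> w))}"
  shows "Bad \<in> sets (sample_law n \<mu> \<beta>)" and "measure (sample_law n \<mu> \<beta>) Bad \<le> exp (- t\<^sup>2)"
proof -
  have m: "(\<lambda>\<xi>. tempered_power k t (fst \<xi> \<bullet> w)) \<in> borel_measurable (logit_law \<mu> \<beta>)"
    by (rule measurable_compose[OF feature_measurable(2)[OF G w] tempered_power_measurable])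
  have "(\<integral>\<^sup>+ \<xi>. ennreal (exp (tempered_power k t (fst \<xi> \<bullet> w))) \<partial>logit_law \<mu> \<beta>)
      \<le> ennreal (exp (moment_const k / t ^ (k - 2)))"
    using nn_integral_exp_tempered_power_le[OF k t(1) gaussian_law_vnorm_nonneg[OF G w] w1]
    by (subst nn_integral_logit_law_feature[OF G b w]) auto
  moreover have "real n * (moment_const k / t ^ (k - 2)) + t\<^sup>2 \<le> (moment_const k + 1) * t\<^sup>2"
  proof -
    have "t ^ k = t\<^sup>2 * t ^ (k - 2)"
      using k by (metis le_add_diff_inverse power_add)
    then have "real n / t ^ (k - 2) \<le> t\<^sup>2"
      using t by (simp add: pos_divide_le_eq)
    then have "moment_const k * (real n / t ^ (k - 2)) \<le> moment_const k * t\<^sup>2"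
      by (intro mult_left_mono) (auto simp: moment_const_def)
    then show ?thesis by (simp add: algebra_simps)
  qed
  ultimately show "Bad \<in> sets (sample_law n \<mu> \<beta>)" "measure (sample_law n \<mu> \<beta>) Bad \<le> exp (- t\<^sup>2)"
    unfolding Bad_def sample_law_def
    by (rule product_chernoff_bound[OF logit_law_prob_space[OF G b] m])+
qed

text \<open>Lower tail by a negative exponent: at parameter \<open>3 / (2 * s\<^sup>2)\<close> the
  Laplace transform is 1/2, at most \<open>exp (- 1 / 2)\<close>. The level 1/6 spends half of the
  resulting gain \<open>n / 2\<close>; the other half is the exponent of the probability.\<close>

lemma sample_energy_tail:
  fixes n :: nat
  assumes G: "gaussian_law d M \<mu>" and b: "\<beta> \<in> carrier_vec d" and w: "w \<in> carrier_vec d"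
  defines "Bad \<equiv> {\<omega> \<in> space (sample_law n \<mu> \<beta>).
      (\<Sum>i<n. (fst (\<omega> i) \<bullet> w)\<^sup>2) < (vnorm M w)\<^sup>2 * real n / 6}"
  shows "Bad \<in> sets (sample_law n \<mu> \<beta>)" and "measure (sample_law n \<mu> \<beta>) Bad \<le> exp (- real n / 4)"
proof -
  interpret P: prob_space "sample_law n \<mu> \<beta>" by (rule sample_law_prob_space[OF G b])
  have m: "(\<lambda>\<xi>. (fst \<xi> \<bullet> w)\<^sup>2) \<in> borel_measurable (logit_law \<mu> \<beta>)"
    by (intro borel_measurable_power feature_measurable(2)[OF G w])
  have "(\<lambda>\<omega>. \<Sum>i<n. (fst (\<omega> i) \<bullet> w)\<^sup>2) \<in> borel_measurable (sample_law n \<mu> \<beta>)"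
    unfolding sample_law_def
    by (intro borel_measurable_sum
        measurable_compose[OF measurable_component_singleton[of _ "{..<n}" "\<lambda>_. logit_law \<mu> \<beta>"] m]) auto
  then show B: "Bad \<in> sets (sample_law n \<mu> \<beta>)"
    unfolding Bad_def by measurable
  show "measure (sample_law n \<mu> \<beta>) Bad \<le> exp (- real n / 4)"
  proof (cases "vnorm M w = 0")
    case True
    have "Bad = {}"
      unfolding Bad_def True by (auto simp: not_less intro!: sum_nonneg)
    then show ?thesis by simp
  next
    case False
    define s where "s = vnorm M w"
    have s: "s > 0"
      using False gaussian_law_vnorm_nonneg[OF G w] by (simp add: s_def)
    define f where "f = (\<lambda>x::real. - (3 / 2) / s\<^sup>2 * x\<^sup>2)"
    have f [measurable]: "f \<in> borel_measurable borel"
      unfolding f_def by measurable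
    have "(\<integral>\<^sup>+ \<xi>. ennreal (exp (f (fst \<xi> \<bullet> w))) \<partial>logit_law \<mu> \<beta>)
        = (\<integral>\<^sup>+ x. ennreal (exp (f (s * x))) \<partial>std_normal_distribution)"
      unfolding s_def by (rule nn_integral_logit_law_feature[OF G b w]) measurable
    also have "\<dots> = (\<integral>\<^sup>+ x. ennreal (exp ((1 - 1 / (1 / 2)\<^sup>2) / 2 * x\<^sup>2)) \<partial>std_normal_distribution)"
      using s by (intro nn_integral_cong arg_cong[where f = ennreal] arg_cong[where f = exp])
        (simp add: f_def power_mult_distrib power2_eq_square)
    also have "\<dots> = ennreal (1 / 2)"
      by (rule nn_integral_std_normal_exp_square) simp
    also have "\<dots> \<le> ennreal (exp (- 1 / 2))"
      using exp_ge_add_one_self[of "- 1 / 2 :: real"] by (intro ennreal_leI) simp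
    finally have mgf: "(\<integral>\<^sup>+ \<xi>. ennreal (exp (f (fst \<xi> \<bullet> w))) \<partial>logit_law \<mu> \<beta>) \<le> ennreal (exp (- 1 / 2))" .
    have fm: "(\<lambda>\<xi>. f (fst \<xi> \<bullet> w)) \<in> borel_measurable (logit_law \<mu> \<beta>)"
      by (rule measurable_compose[OF feature_measurable(2)[OF G w] f])
    have c: "real n * (- 1 / 2) + real n / 4 \<le> - real n / 4" by simp
    let ?B = "{\<omega> \<in> space (sample_law n \<mu> \<beta>). - real n / 4 \<le> (\<Sum>i<n. f (fst (\<omega> i) \<bullet> w))}"
    have ch: "?B \<in> sets (sample_law n \<mu> \<beta>)" "measure (sample_law n \<mu> \<beta>) ?B \<le> exp (- (real n / 4))"
      using product_chernoff_bound[OF logit_law_prob_space[OF G b] fm mgf c] by (simp_all add: sample_law_def)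
    have "Bad \<subseteq> ?B"
    proof
      fix \<omega> assume "\<omega> \<in> Bad"
      then have sp: "\<omega> \<in> space (sample_law n \<mu> \<beta>)"
        and lt: "(\<Sum>i<n. (fst (\<omega> i) \<bullet> w)\<^sup>2) < s\<^sup>2 * real n / 6"
        by (auto simp: Bad_def s_def)
      have "3 / 2 / s\<^sup>2 * (\<Sum>i<n. (fst (\<omega> i) \<bullet> w)\<^sup>2) \<le> 3 / 2 / s\<^sup>2 * (s\<^sup>2 * real n / 6)"
        using lt s by (intro mult_left_mono) auto
      also have "\<dots> = real n / 4" using s by simp
      finally have "- real n / 4 \<le> (\<Sum>i<n. f (fst (\<omega> i) \<bullet> w))"
        unfolding f_def sum_distrib_left[symmetric] by simp
      then show "\<omega> \<in> ?B" using sp by simp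
    qed
    then have "measure (sample_law n \<mu> \<beta>) Bad \<le> measure (sample_law n \<mu> \<beta>) ?B"
      by (intro P.finite_measure_mono ch)
    then show ?thesis using ch by simp
  qed
qed

text \<open>Given the features the score is centered, and its Laplace transform at \<open>l\<close>
  is at most \<open>exp (144 * l\<^sup>2)\<close>, with 144 = 2 * 72. The parameter \<eta> / 288
  minimizes \<open>144 * l\<^sup>2 - l * \<eta>\<close>, with minimum
  \<open>- (\<eta>\<^sup>2 / 576)\<close>. The sign \<delta> covers both tails.\<close>

lemma sample_score_tail:
  fixes n :: nat
  assumes G: "gaussian_law d M \<mu>" and b: "\<beta> \<in> carrier_vec d" and w: "w \<in> carrier_vec d"
    and w1: "vnorm M w \<le> 1" and \<eta>: "0 \<le> \<eta>" "\<eta> \<le> 1" and \<delta>: "\<bar>\<delta>\<bar> = 1"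
  defines "Bad \<equiv> {\<omega> \<in> space (sample_law n \<mu> \<beta>). \<eta>\<^sup>2 / 288 * real n
      \<le> (\<Sum>i<n. \<delta> * \<eta> / 288 * ((sigmoid (fst (\<omega> i) \<bullet> \<beta>) - of_bool (snd (\<omega> i))) * (fst (\<omega> i) \<bullet> w)))}"
  shows "Bad \<in> sets (sample_law n \<mu> \<beta>)"
    and "measure (sample_law n \<mu> \<beta>) Bad \<le> exp (- (real n * \<eta>\<^sup>2 / 576))"
proof -
  interpret N: prob_space std_normal_distribution by (rule prob_space_std_normal)
  define l where "l = \<delta> * \<eta> / 288"
  have l1: "\<bar>l\<bar> \<le> 1" and l2: "l\<^sup>2 = \<eta>\<^sup>2 / 82944"
  proof -
    show "\<bar>l\<bar> \<le> 1" using \<eta> \<delta> by (simp add: l_def abs_mult)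
    have "\<delta>\<^sup>2 = 1" using \<delta> by (metis power2_abs one_power2)
    then show "l\<^sup>2 = \<eta>\<^sup>2 / 82944" by (simp add: l_def power_divide power_mult_distrib)
  qed
  define f where "f = (\<lambda>\<xi>::real vec \<times> bool. l * ((sigmoid (fst \<xi> \<bullet> \<beta>) - of_bool (snd \<xi>)) * (fst \<xi> \<bullet> w)))"
  have f: "f \<in> borel_measurable (logit_law \<mu> \<beta>)"
    unfolding f_def
    by (intro borel_measurable_times borel_measurable_diff borel_measurable_const label_measurable
        feature_measurable(2)[OF G w] measurable_compose[OF feature_measurable(2)[OF G b] sigmoid_measurable])
  have f': "(\<lambda>\<xi>. ennreal (exp (f \<xi>))) \<in> borel_measurable (\<mu> \<Otimes>\<^sub>M count_space UNIV)"
  proof -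
    have [measurable]: "f \<in> borel_measurable (\<mu> \<Otimes>\<^sub>M count_space UNIV)"
      using f measurable_cong_sets[OF logit_law_sets(1) refl] by blast
    show ?thesis by measurable
  qed
  have bound: "sigmoid t * exp (l * ((sigmoid t - 1) * y)) + (1 - sigmoid t) * exp (l * (sigmoid t * y))
      \<le> 1 + 72 * l\<^sup>2 * exp (3 / 8 * y\<^sup>2)" for t y
  proof -
    have "\<bar>l * y\<bar> \<le> \<bar>y\<bar>"
      using l1 mult_right_mono[of "\<bar>l\<bar>" 1 "\<bar>y\<bar>"] by (simp add: abs_mult)
    then have "(l * y)\<^sup>2 * exp \<bar>l * y\<bar> \<le> (l * y)\<^sup>2 * exp \<bar>y\<bar>"
      by (intro mult_left_mono) auto
    also have "\<dots> = l\<^sup>2 * (y\<^sup>2 * exp \<bar>y\<bar>)" by (simp add: power_mult_distrib)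
    also have "\<dots> \<le> l\<^sup>2 * (72 * exp (3 / 8 * y\<^sup>2))"
      by (intro mult_left_mono square_exp_abs_le) auto
    finally show ?thesis
      using centered_bernoulli_mgf_le[of "sigmoid t" "l * y"] sigmoid_bounds[of t]
      by (simp add: algebra_simps)
  qed
  have "(\<integral>\<^sup>+ \<xi>. ennreal (exp (f \<xi>)) \<partial>logit_law \<mu> \<beta>)
      = (\<integral>\<^sup>+ x. ennreal (sigmoid (x \<bullet> \<beta>)) * ennreal (exp (f (x, True)))
          + ennreal (1 - sigmoid (x \<bullet> \<beta>)) * ennreal (exp (f (x, False))) \<partial>\<mu>)"
    by (rule nn_integral_logit_law[OF G b f'])
  also have "\<dots> \<le> (\<integral>\<^sup>+ x. ennreal (1 + 72 * l\<^sup>2 * exp (3 / 8 * (x \<bullet> w)\<^sup>2)) \<partial>\<mu>)"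
  proof (intro nn_integral_mono)
    fix x
    have "ennreal (sigmoid (x \<bullet> \<beta>)) * ennreal (exp (f (x, True)))
        + ennreal (1 - sigmoid (x \<bullet> \<beta>)) * ennreal (exp (f (x, False)))
      = ennreal (sigmoid (x \<bullet> \<beta>) * exp (f (x, True)) + (1 - sigmoid (x \<bullet> \<beta>)) * exp (f (x, False)))"
      using sigmoid_bounds[of "x \<bullet> \<beta>"] by (simp add: ennreal_mult'[symmetric] ennreal_plus[symmetric] del: ennreal_plus)
    also have "\<dots> \<le> ennreal (1 + 72 * l\<^sup>2 * exp (3 / 8 * (x \<bullet> w)\<^sup>2))"
      using bound[of "x \<bullet> \<beta>" "x \<bullet> w"] by (intro ennreal_leI) (simp add: f_def)
    finally show "ennreal (sigmoid (x \<bullet> \<beta>)) * ennreal (exp (f (x, True)))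
        + ennreal (1 - sigmoid (x \<bullet> \<beta>)) * ennreal (exp (f (x, False)))
        \<le> ennreal (1 + 72 * l\<^sup>2 * exp (3 / 8 * (x \<bullet> w)\<^sup>2))" .
  qed
  also have "\<dots> = (\<integral>\<^sup>+ x. ennreal (1 + 72 * l\<^sup>2 * exp (3 / 8 * (vnorm M w * x)\<^sup>2)) \<partial>std_normal_distribution)"
    by (rule gaussian_law_marginal[OF G w]) measurable
  also have "\<dots> \<le> (\<integral>\<^sup>+ x. 1 + ennreal (72 * l\<^sup>2) * ennreal (exp ((1 - 1 / 2\<^sup>2) / 2 * x\<^sup>2)) \<partial>std_normal_distribution)"
  proof (intro nn_integral_mono)
    fix x
    have "(vnorm M w * x)\<^sup>2 \<le> x\<^sup>2"
      using w1 gaussian_law_vnorm_nonneg[OF G w] mult_right_mono[of "(vnorm M w)\<^sup>2" 1 "x\<^sup>2"]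
      by (simp add: power_mult_distrib power_le_one)
    then have "1 + 72 * l\<^sup>2 * exp (3 / 8 * (vnorm M w * x)\<^sup>2) \<le> 1 + 72 * l\<^sup>2 * exp (3 / 8 * x\<^sup>2)"
      by (intro add_left_mono mult_left_mono) auto
    then have "ennreal (1 + 72 * l\<^sup>2 * exp (3 / 8 * (vnorm M w * x)\<^sup>2)) \<le> ennreal (1 + 72 * l\<^sup>2 * exp (3 / 8 * x\<^sup>2))"
      by (rule ennreal_leI)
    then show "ennreal (1 + 72 * l\<^sup>2 * exp (3 / 8 * (vnorm M w * x)\<^sup>2))
        \<le> 1 + ennreal (72 * l\<^sup>2) * ennreal (exp ((1 - 1 / 2\<^sup>2) / 2 * x\<^sup>2))"
      by (simp add: ennreal_mult')
  qed
  also have "\<dots> = 1 + ennreal (72 * l\<^sup>2) * ennreal 2"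
    using N.emeasure_space_1
    by (subst nn_integral_add, simp, simp, subst nn_integral_cmult, simp,
        subst nn_integral_std_normal_exp_square) auto
  also have "ennreal (72 * l\<^sup>2) * ennreal 2 = ennreal (144 * l\<^sup>2)"
    by (subst ennreal_mult''[symmetric]) simp_all
  also have "1 + ennreal (144 * l\<^sup>2) = ennreal (1 + 144 * l\<^sup>2)"
    by simp
  also have "\<dots> \<le> ennreal (exp (144 * l\<^sup>2))"
    by (intro ennreal_leI) simp
  finally have mgf: "(\<integral>\<^sup>+ \<xi>. ennreal (exp (f \<xi>)) \<partial>logit_law \<mu> \<beta>) \<le> ennreal (exp (144 * l\<^sup>2))" .
  have c: "real n * (144 * l\<^sup>2) + real n * \<eta>\<^sup>2 / 576 \<le> \<eta>\<^sup>2 / 288 * real n"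
    by (simp add: l2)
  have Bad: "Bad = {\<omega> \<in> space (sample_law n \<mu> \<beta>). \<eta>\<^sup>2 / 288 * real n \<le> (\<Sum>i<n. f (\<omega> i))}"
    by (simp add: Bad_def f_def l_def)
  show "Bad \<in> sets (sample_law n \<mu> \<beta>)" "measure (sample_law n \<mu> \<beta>) Bad \<le> exp (- (real n * \<eta>\<^sup>2 / 576))"
    using product_chernoff_bound[OF logit_law_prob_space[OF G b] f mgf c]
    unfolding Bad sample_law_def by blast+
qed

text \<open>Seven events are removed per net point: four moments, one energy, and the score with
  both signs. The inequalities obtained concern net points only; the passage to all directions is
  deterministic.\<close>

lemma sample_good_event:
  fixes n :: nat and t :: "nat \<Rightarrow> real" and W :: "real vec set"
  assumes G: "gaussian_law d M \<mu>" and b: "\<beta> \<in> carrier_vec d" and W: "finite W" "W \<subseteq> carrier_vec d"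
    and W1: "\<And>w. w \<in> W \<Longrightarrow> vnorm M w \<le> 1"
    and t: "\<And>k. k \<in> {2..5} \<Longrightarrow> t k > 0 \<and> real n \<le> t k ^ k"
    and \<eta>: "0 < \<eta>" "\<eta> \<le> 1"
  obtains E where "E \<in> sets (sample_law n \<mu> \<beta>)"
    and "measure (sample_law n \<mu> \<beta>) E \<ge> 1 - real (card W) *
      ((\<Sum>k=2..5. exp (- (t k)\<^sup>2)) + exp (- real n / 4) + 2 * exp (- (real n * \<eta>\<^sup>2 / 576)))"
    and "\<And>\<omega> i. \<omega> \<in> E \<Longrightarrow> i < n \<Longrightarrow> fst (\<omega> i) \<in> carrier_vec d"
    and "\<And>\<omega> w k. \<omega> \<in> E \<Longrightarrow> w \<in> W \<Longrightarrow> k \<in> {2..5} \<Longrightarrow>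
      (\<Sum>i<n. tempered_power k (t k) (fst (\<omega> i) \<bullet> w)) \<le> (moment_const k + 1) * (t k)\<^sup>2"
    and "\<And>\<omega> w. \<omega> \<in> E \<Longrightarrow> w \<in> W \<Longrightarrow> (vnorm M w)\<^sup>2 * real n / 6 \<le> (\<Sum>i<n. (fst (\<omega> i) \<bullet> w)\<^sup>2)"
    and "\<And>\<omega> w. \<omega> \<in> E \<Longrightarrow> w \<in> W \<Longrightarrow>
      \<bar>\<Sum>i<n. (sigmoid (fst (\<omega> i) \<bullet> \<beta>) - of_bool (snd (\<omega> i))) * (fst (\<omega> i) \<bullet> w)\<bar> \<le> \<eta> * real n"
proof -
  let ?P = "sample_law n \<mu> \<beta>"
  interpret P: prob_space ?P by (rule sample_law_prob_space[OF G b])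
  define S where "S = (\<lambda>\<omega> :: nat \<Rightarrow> real vec \<times> bool. \<lambda>w.
      \<Sum>i<n. (sigmoid (fst (\<omega> i) \<bullet> \<beta>) - of_bool (snd (\<omega> i))) * (fst (\<omega> i) \<bullet> w))"
  define B1 where "B1 = (\<lambda>w k. {\<omega> \<in> space ?P.
      (moment_const k + 1) * (t k)\<^sup>2 \<le> (\<Sum>i<n. tempered_power k (t k) (fst (\<omega> i) \<bullet> w))})"
  define B2 where "B2 = (\<lambda>w. {\<omega> \<in> space ?P. (\<Sum>i<n. (fst (\<omega> i) \<bullet> w)\<^sup>2) < (vnorm M w)\<^sup>2 * real n / 6})"
  define B3 where "B3 = (\<lambda>\<delta> w. {\<omega> \<in> space ?P. \<eta>\<^sup>2 / 288 * real n
      \<le> (\<Sum>i<n. \<delta> * \<eta> / 288 * ((sigmoid (fst (\<omega> i) \<bullet> \<beta>) - of_bool (snd (\<omega> i))) * (fst (\<omega> i) \<bullet> w)))})"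
  have B1: "B1 w k \<in> sets ?P" "measure ?P (B1 w k) \<le> exp (- (t k)\<^sup>2)" if "w \<in> W" "k \<in> {2..5}" for w k
    unfolding B1_def using that W W1 t by (intro sample_moment_tail[OF G b]; force)+
  have B2: "B2 w \<in> sets ?P" "measure ?P (B2 w) \<le> exp (- real n / 4)" if "w \<in> W" for w
    unfolding B2_def using that W by (intro sample_energy_tail[OF G b]; force)+
  have B3: "B3 \<delta> w \<in> sets ?P" "measure ?P (B3 \<delta> w) \<le> exp (- (real n * \<eta>\<^sup>2 / 576))"
    if "w \<in> W" "\<delta> \<in> {1, -1}" for w \<delta>
    unfolding B3_def using that W W1 \<eta> by (intro sample_score_tail[OF G b]; force)+
  define U where "U = (\<lambda>w. (\<Union>k\<in>{2..5}. B1 w k) \<union> (B2 w \<union> (B3 1 w \<union> B3 (-1) w)))"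
  define E where "E = space ?P - (\<Union>w\<in>W. U w)"
  have U: "U w \<in> sets ?P" if "w \<in> W" for w
    unfolding U_def using B1(1) B2(1) B3(1) that by (intro sets.Un sets.finite_UN) auto
  have mU: "measure ?P (U w) \<le> (\<Sum>k=2..5. exp (- (t k)\<^sup>2)) + exp (- real n / 4) + 2 * exp (- (real n * \<eta>\<^sup>2 / 576))"
    if w: "w \<in> W" for w
  proof -
    have "measure ?P (\<Union>k\<in>{2..5}. B1 w k) \<le> (\<Sum>k=2..5. measure ?P (B1 w k))"
      using B1(1)[OF w] by (intro measure_UNION_le) auto
    also have "\<dots> \<le> (\<Sum>k=2..5. exp (- (t k)\<^sup>2))"
      by (intro sum_mono B1(2)[OF w])
    finally have 1: "measure ?P (\<Union>k\<in>{2..5}. B1 w k) \<le> (\<Sum>k=2..5. exp (- (t k)\<^sup>2))" .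
    have s1: "(\<Union>k\<in>{2..5}. B1 w k) \<in> sets ?P"
      using B1(1)[OF w] by (intro sets.finite_UN) auto
    have s2: "B2 w \<in> sets ?P" "B3 1 w \<in> sets ?P" "B3 (-1) w \<in> sets ?P"
      using B2(1) B3(1) w by auto
    have "measure ?P (U w) \<le> measure ?P (\<Union>k\<in>{2..5}. B1 w k) + measure ?P (B2 w \<union> (B3 1 w \<union> B3 (-1) w))"
      unfolding U_def using s1 s2 by (intro measure_Un_le sets.Un)
    also have "measure ?P (B2 w \<union> (B3 1 w \<union> B3 (-1) w)) \<le> measure ?P (B2 w) + measure ?P (B3 1 w \<union> B3 (-1) w)"
      using s2 by (intro measure_Un_le sets.Un)
    also have "measure ?P (B3 1 w \<union> B3 (-1) w) \<le> measure ?P (B3 1 w) + measure ?P (B3 (-1) w)"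
      using s2 by (intro measure_Un_le)
    finally show ?thesis
      using 1 B2(2)[OF w] B3(2)[OF w, of 1] B3(2)[OF w, of "-1"] by simp
  qed
  show thesis
  proof (rule that[of E])
    have sU: "(\<Union>w\<in>W. U w) \<in> sets ?P"
      using W U by (intro sets.finite_UN) auto
    then show "E \<in> sets ?P" unfolding E_def by auto
    have "measure ?P (\<Union>w\<in>W. U w) \<le> (\<Sum>w\<in>W. measure ?P (U w))"
      using W U by (intro measure_UNION_le) auto
    also have "\<dots> \<le> real (card W) *
      ((\<Sum>k=2..5. exp (- (t k)\<^sup>2)) + exp (- real n / 4) + 2 * exp (- (real n * \<eta>\<^sup>2 / 576)))"
      using mU by (intro sum_bounded_above)
    finally show "measure ?P E \<ge> 1 - real (card W) *
      ((\<Sum>k=2..5. exp (- (t k)\<^sup>2)) + exp (- real n / 4) + 2 * exp (- (real n * \<eta>\<^sup>2 / 576)))"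
      unfolding E_def using P.prob_compl[OF sU] by linarith
  next
    fix \<omega> :: "nat \<Rightarrow> real vec \<times> bool" and i assume "\<omega> \<in> E" "i < n"
    then have "\<omega> i \<in> space (logit_law \<mu> \<beta>)"
      by (auto simp: E_def sample_law_def space_PiM)
    then show "fst (\<omega> i) \<in> carrier_vec d"
      by (auto simp: logit_law_sets gaussian_law_sets(2)[OF G])
  next
    fix \<omega> w and k :: nat assume "\<omega> \<in> E" "w \<in> W" "k \<in> {2..5}"
    then have "\<omega> \<notin> B1 w k" "\<omega> \<in> space ?P" by (auto simp: E_def U_def)
    then show "(\<Sum>i<n. tempered_power k (t k) (fst (\<omega> i) \<bullet> w)) \<le> (moment_const k + 1) * (t k)\<^sup>2"
      by (auto simp: B1_def)
  next
    fix \<omega> w assume "\<omega> \<in> E" "w \<in> W"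
    then have "\<omega> \<notin> B2 w" "\<omega> \<in> space ?P" by (auto simp: E_def U_def)
    then show "(vnorm M w)\<^sup>2 * real n / 6 \<le> (\<Sum>i<n. (fst (\<omega> i) \<bullet> w)\<^sup>2)"
      by (auto simp: B2_def)
  next
    fix \<omega> w assume "\<omega> \<in> E" "w \<in> W"
    then have "\<omega> \<notin> B3 1 w" "\<omega> \<notin> B3 (-1) w" "\<omega> \<in> space ?P" by (auto simp: E_def U_def)
    then have "\<eta> / 288 * S \<omega> w < \<eta>\<^sup>2 / 288 * real n" "- \<eta> / 288 * S \<omega> w < \<eta>\<^sup>2 / 288 * real n"
      by (auto simp: B3_def S_def sum_distrib_left)
    then have "\<eta> * S \<omega> w < \<eta> * (\<eta> * real n)" "\<eta> * - S \<omega> w < \<eta> * (\<eta> * real n)"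
      by (simp_all add: power2_eq_square)
    then have "S \<omega> w < \<eta> * real n" "- S \<omega> w < \<eta> * real n"
      using \<eta>(1) by (simp_all only: mult_less_cancel_left_pos)
    then show "\<bar>\<Sum>i<n. (sigmoid (fst (\<omega> i) \<bullet> \<beta>) - of_bool (snd (\<omega> i))) * (fst (\<omega> i) \<bullet> w)\<bar> \<le> \<eta> * real n"
      unfolding S_def by linarith
  qed
qed

subsection \<open>Quadratic forms and homogeneous functions\<close>

lemma quad_form_line:
  fixes Q :: "real mat"
  assumes Q: "Q \<in> carrier_mat d d" "transpose_mat Q = Q" and b: "b \<in> carrier_vec d" and h: "h \<in> carrier_vec d"
  shows "(b + t \<cdot>\<^sub>v h) \<bullet> (Q *\<^sub>v (b + t \<cdot>\<^sub>v h)) = b \<bullet> (Q *\<^sub>v b) + 2 * t * (h \<bullet> (Q *\<^sub>v b)) + t\<^sup>2 * (h \<bullet> (Q *\<^sub>v h))"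
    and "b \<bullet> (Q *\<^sub>v h) = h \<bullet> (Q *\<^sub>v b)"
    and "h \<bullet> (Q *\<^sub>v (b + t \<cdot>\<^sub>v h)) = h \<bullet> (Q *\<^sub>v b) + t * (h \<bullet> (Q *\<^sub>v h))"
proof -
  have Qb: "Q *\<^sub>v b \<in> carrier_vec d" and Qh: "Q *\<^sub>v h \<in> carrier_vec d"
    using Q b h by auto
  show sym: "b \<bullet> (Q *\<^sub>v h) = h \<bullet> (Q *\<^sub>v b)"
    using transpose_vec_mult_scalar[OF Q(1) h b] Q(2) comm_scalar_prod[OF Qb h] by simp
  have Qbh: "Q *\<^sub>v (b + t \<cdot>\<^sub>v h) = Q *\<^sub>v b + t \<cdot>\<^sub>v (Q *\<^sub>v h)"
    using Q b h by (simp add: mult_add_distrib_mat_vec[of _ d d] mult_mat_vec[of _ d d])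
  show 3: "h \<bullet> (Q *\<^sub>v (b + t \<cdot>\<^sub>v h)) = h \<bullet> (Q *\<^sub>v b) + t * (h \<bullet> (Q *\<^sub>v h))"
    unfolding Qbh using Qb Qh h by (simp add: scalar_prod_add_distrib[of _ d])
  have "b \<bullet> (Q *\<^sub>v (b + t \<cdot>\<^sub>v h)) = b \<bullet> (Q *\<^sub>v b) + t * (h \<bullet> (Q *\<^sub>v b))"
    unfolding Qbh using Qb Qh b sym by (simp add: scalar_prod_add_distrib[of _ d])
  moreover have "(b + t \<cdot>\<^sub>v h) \<bullet> z = b \<bullet> z + t * (h \<bullet> z)" if "z \<in> carrier_vec d" for z
    using that b h by (simp add: add_scalar_prod_distrib[of _ d])
  ultimately show "(b + t \<cdot>\<^sub>v h) \<bullet> (Q *\<^sub>v (b + t \<cdot>\<^sub>v h))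
      = b \<bullet> (Q *\<^sub>v b) + 2 * t * (h \<bullet> (Q *\<^sub>v b)) + t\<^sup>2 * (h \<bullet> (Q *\<^sub>v h))"
    using 3 Q b h by (simp add: power2_eq_square algebra_simps)
qed

lemma quad_form_smult:
  fixes Q :: "real mat"
  assumes "Q \<in> carrier_mat d d" "h \<in> carrier_vec d"
  shows "(t \<cdot>\<^sub>v h) \<bullet> (Q *\<^sub>v (t \<cdot>\<^sub>v h)) = t\<^sup>2 * (h \<bullet> (Q *\<^sub>v h))"
proof -
  have "Q *\<^sub>v h \<in> carrier_vec d" using assms by simp
  then show ?thesis
    using assms by (simp add: mult_mat_vec[of _ d d] power2_eq_square)
qed

lemma quad_form_sum:
  fixes Q :: "real mat"
  assumes "Q \<in> carrier_mat d d" "u \<in> carrier_vec d"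
  shows "u \<bullet> (Q *\<^sub>v u) = (\<Sum>i<d. \<Sum>j<d. Q $$ (i, j) * u $ i * u $ j)"
  using assms by (auto simp: scalar_prod_def atLeast0LessThan sum_distrib_left algebra_simps intro!: sum.cong)

lemma vnorm_smult:
  assumes "Q \<in> carrier_mat d d" "h \<in> carrier_vec d"
  shows "vnorm Q (t \<cdot>\<^sub>v h) = \<bar>t\<bar> * vnorm Q h"
  by (simp add: vnorm_def quad_form_smult[OF assms] real_sqrt_mult)

text \<open>Applied to the prior precision, which vanishes for the flat prior; hence the separate
  treatment of directions where the form is degenerate.\<close>

lemma psd_cauchy_schwarz:
  assumes Q: "psd d Q" and u: "u \<in> carrier_vec d" and b: "b \<in> carrier_vec d"
  shows "\<bar>u \<bullet> (Q *\<^sub>v b)\<bar> \<le> vnorm Q u * vnorm Q b"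
proof -
  let ?q = "\<lambda>u. u \<bullet> (Q *\<^sub>v u)"
  have pos: "0 \<le> ?q b + 2 * t * (u \<bullet> (Q *\<^sub>v b)) + t\<^sup>2 * ?q u" for t
    using Q u b quad_form_line(1)[of Q d b u t] by (metis psd_def add_carrier_vec smult_carrier_vec)
  have qu: "?q u \<ge> 0" and qb: "?q b \<ge> 0" using Q u b by (auto simp: psd_def)
  have "(u \<bullet> (Q *\<^sub>v b))\<^sup>2 \<le> ?q u * ?q b"
  proof (cases "?q u = 0")
    case True
    have "u \<bullet> (Q *\<^sub>v b) = 0"
    proof (rule ccontr)
      assume ne: "u \<bullet> (Q *\<^sub>v b) \<noteq> 0"
      show False
      proof -
        \<comment> \<open>Without a quadratic coefficient the nonnegative polynomial
          \<open>pos\<close> is affine in \<open>t\<close>; at this point it would equal -1.\<close>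
        define t where "t = - (?q b + 1) / (2 * (u \<bullet> (Q *\<^sub>v b)))"
        have "2 * t * (u \<bullet> (Q *\<^sub>v b)) = - (?q b + 1)" using ne by (simp add: t_def)
        then show False using pos[of t] True by simp
      qed
    qed
    then show ?thesis using True by simp
  next
    case False
    then have "?q u > 0" using qu by simp
    then show ?thesis
      using pos[of "- (u \<bullet> (Q *\<^sub>v b)) / ?q u"] by (simp add: field_simps power2_eq_square)
  qed
  then have "\<bar>u \<bullet> (Q *\<^sub>v b)\<bar> \<le> sqrt (?q u * ?q b)"
    by (metis real_sqrt_abs real_sqrt_le_iff)
  then show ?thesis by (simp add: vnorm_def real_sqrt_mult)
qed

lemma spd_imp_psd: "spd d M \<Longrightarrow> psd d M"
  unfolding spd_def psd_def
  by (metis less_eq_real_def mult_mat_vec_carrier scalar_prod_left_zero)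

lemma psd_vnorm_square:
  assumes "psd d Q" "u \<in> carrier_vec d"
  shows "(vnorm Q u)\<^sup>2 = u \<bullet> (Q *\<^sub>v u)" "0 \<le> vnorm Q u"
  using assms by (auto simp: vnorm_def psd_def)

lemma spd_vnorm_pos:
  assumes "spd d M" "u \<in> carrier_vec d" "u \<noteq> 0\<^sub>v d"
  shows "0 < vnorm M u"
  using assms by (auto simp: vnorm_def spd_def)

lemma psd_vnorm_square_add_le:
  assumes Q: "psd d Q" and u: "u \<in> carrier_vec d" and w: "w \<in> carrier_vec d"
  shows "(vnorm Q u)\<^sup>2 \<le> 2 * (vnorm Q w)\<^sup>2 + 2 * (vnorm Q (u - w))\<^sup>2"
proof -
  have Qc: "Q \<in> carrier_mat d d" "transpose_mat Q = Q" using Q by (auto simp: psd_def)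
  define h where "h = u - w"
  have h: "h \<in> carrier_vec d" and uw: "u = w + 1 \<cdot>\<^sub>v h" using u w by (auto simp: h_def)
  have "0 \<le> (w + (-1) \<cdot>\<^sub>v h) \<bullet> (Q *\<^sub>v (w + (-1) \<cdot>\<^sub>v h))"
    using Q w h by (auto simp: psd_def)
  then have "0 \<le> w \<bullet> (Q *\<^sub>v w) - 2 * (h \<bullet> (Q *\<^sub>v w)) + h \<bullet> (Q *\<^sub>v h)"
    unfolding quad_form_line(1)[OF Qc w h] by simp
  moreover have "u \<bullet> (Q *\<^sub>v u) = w \<bullet> (Q *\<^sub>v w) + 2 * (h \<bullet> (Q *\<^sub>v w)) + h \<bullet> (Q *\<^sub>v h)"
    unfolding uw quad_form_line(1)[OF Qc w h] by simp
  ultimately show ?thesis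
    unfolding h_def[symmetric] psd_vnorm_square(1)[OF Q u] psd_vnorm_square(1)[OF Q w] psd_vnorm_square(1)[OF Q h]
    by linarith
qed

text \<open>Convexity of powers, by induction with the rearrangement inequality. It supplies the
  approximate subadditivity that \<open>net_homogeneous_bound\<close> asks for.\<close>

lemma abs_add_power_le:
  fixes a b :: real
  shows "\<bar>a + b\<bar> ^ Suc k \<le> 2 ^ k * (\<bar>a\<bar> ^ Suc k + \<bar>b\<bar> ^ Suc k)"
proof (induction k)
  case 0
  then show ?case by simp
next
  case (Suc k)
  let ?a = "\<bar>a\<bar>" and ?b = "\<bar>b\<bar>"
  have rearr: "0 \<le> (?a - ?b) * (?a ^ Suc k - ?b ^ Suc k)"
  proof (cases "?b \<le> ?a")
    case True
    then have "?b ^ Suc k \<le> ?a ^ Suc k" by (intro power_mono) auto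
    with True show ?thesis by simp
  next
    case False
    then have "?a ^ Suc k \<le> ?b ^ Suc k" by (intro power_mono) auto
    with False show ?thesis by (intro mult_nonpos_nonpos) auto
  qed
  have "\<bar>a + b\<bar> ^ Suc (Suc k) \<le> (?a + ?b) * (2 ^ k * (?a ^ Suc k + ?b ^ Suc k))"
    unfolding power_Suc[of _ "Suc k"] by (intro mult_mono Suc) auto
  also have "\<dots> = 2 ^ k * ((?a + ?b) * (?a ^ Suc k + ?b ^ Suc k))"
    by simp
  also have "\<dots> \<le> 2 ^ k * (2 * (?a ^ Suc (Suc k) + ?b ^ Suc (Suc k)))"
    using rearr by (intro mult_left_mono) (auto simp: algebra_simps)
  finally show ?case by (simp add: algebra_simps)
qed

text \<open>Absorption: let \<open>S\<close> be the supremum over the unit ball and write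
  \<open>u\<close> as a net point plus a remainder of norm at most 1/2. By homogeneity the remainder
  contributes at most \<open>S / 2 ^ k\<close>, and the subadditivity factor
  \<open>2 ^ (k - 1)\<close> leaves \<open>S / 2\<close>, which is absorbed on the left. Hence mesh
  1/2 suffices for every \<open>k\<close>. The bound \<open>B\<close> enters only through the
  finiteness of \<open>S\<close>.\<close>

lemma net_homogeneous_bound:
  fixes F :: "real vec \<Rightarrow> real"
  assumes M: "spd d M" and k: "k \<ge> 1"
    and W: "W \<subseteq> carrier_vec d"
    and net: "\<And>u. u \<in> carrier_vec d \<Longrightarrow> vnorm M u \<le> 1 \<Longrightarrow> \<exists>w\<in>W. vnorm M (u - w) \<le> 1 / 2"
    and bdd: "\<And>u. u \<in> carrier_vec d \<Longrightarrow> vnorm M u \<le> 1 \<Longrightarrow> F u \<le> B"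
    and add: "\<And>u w. u \<in> carrier_vec d \<Longrightarrow> w \<in> carrier_vec d \<Longrightarrow> F (u + w) \<le> 2 ^ (k - 1) * (F u + F w)"
    and hom: "\<And>u c. u \<in> carrier_vec d \<Longrightarrow> F (c \<cdot>\<^sub>v u) = \<bar>c\<bar> ^ k * F u"
    and m: "\<And>w. w \<in> W \<Longrightarrow> F w \<le> m"
    and u: "u \<in> carrier_vec d"
  shows "F u \<le> 2 ^ k * m * vnorm M u ^ k"
proof -
  have Mc: "M \<in> carrier_mat d d" using M by (simp add: spd_def)
  define U where "U = {u \<in> carrier_vec d. vnorm M u \<le> 1}"
  define S where "S = (SUP u\<in>U. F u)"
  have zU: "0\<^sub>v d \<in> U" using Mc by (auto simp: U_def vnorm_def)
  have bd: "bdd_above (F ` U)" using bdd by (auto simp: U_def bdd_above_def)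
  have two: "2 ^ (k - 1) * 2 = (2::real) ^ k" using k by (cases k) auto
  have step: "F u \<le> 2 ^ (k - 1) * m + S / 2" if "u \<in> U" for u
  proof -
    have uc: "u \<in> carrier_vec d" using that by (simp add: U_def)
    obtain w where w: "w \<in> W" and h: "vnorm M (u - w) \<le> 1 / 2" using net[OF uc] \<open>u \<in> U\<close> unfolding U_def by blast
    have wc: "w \<in> carrier_vec d" using w W by auto
    have hc: "u - w \<in> carrier_vec d" using uc wc by simp
    have "2 \<cdot>\<^sub>v (u - w) \<in> U"
      using h hc vnorm_smult[OF Mc hc, of 2] by (auto simp: U_def)
    then have "F (2 \<cdot>\<^sub>v (u - w)) \<le> S"
      unfolding S_def by (rule cSUP_upper) (rule bd)
    then have Fh: "2 ^ k * F (u - w) \<le> S" using hom[OF hc, of 2] by simp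
    have "F u = F (w + (u - w))" using uc wc by (intro arg_cong[where f = F]) auto
    also have "\<dots> \<le> 2 ^ (k - 1) * (F w + F (u - w))" by (rule add[OF wc hc])
    also have "\<dots> \<le> 2 ^ (k - 1) * m + S / 2"
    proof -
      have "2 ^ (k - 1) * F w \<le> 2 ^ (k - 1) * m" by (rule mult_left_mono[OF m[OF w]]) simp
      moreover have "2 ^ (k - 1) * F (u - w) \<le> S / 2" using Fh unfolding two[symmetric] by simp
      ultimately show ?thesis unfolding distrib_left by linarith
    qed
    finally show ?thesis .
  qed
  have "S \<le> 2 ^ (k - 1) * m + S / 2"
    unfolding S_def by (rule cSUP_least) (use zU step in \<open>auto simp: S_def\<close>)
  then have S: "S \<le> 2 ^ k * m" unfolding two[symmetric] by simp
  show ?thesis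
  proof (cases "vnorm M u = 0")
    case True
    then have "u = 0\<^sub>v d" using spd_vnorm_pos[OF M u] by auto
    moreover have "0 \<cdot>\<^sub>v u = 0\<^sub>v d" using u by (intro eq_vecI) auto
    ultimately have "F u = F (0 \<cdot>\<^sub>v u)" by simp
    also have "\<dots> = 0" using hom[OF u, of 0] k by simp
    finally show ?thesis using True k by (cases k) auto
  next
    case False
    then have p: "vnorm M u > 0" using psd_vnorm_square(2)[OF spd_imp_psd[OF M] u] by simp
    define u1 where "u1 = (1 / vnorm M u) \<cdot>\<^sub>v u"
    have u1: "u1 \<in> carrier_vec d" using u by (simp add: u1_def)
    have "vnorm M u1 = 1" using p vnorm_smult[OF Mc u] by (simp add: u1_def)
    then have "u1 \<in> U" using u1 by (simp add: U_def)
    then have "F u1 \<le> S" unfolding S_def by (rule cSUP_upper) (rule bd)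
    then have "F u1 \<le> 2 ^ k * m" using S by simp
    moreover have "u = vnorm M u \<cdot>\<^sub>v u1" using p by (simp add: u1_def smult_smult_assoc)
    then have "F u = vnorm M u ^ k * F u1" using hom[OF u1, of "vnorm M u"] p by simp
    ultimately show ?thesis using p by (simp add: mult.commute mult_left_mono)
  qed
qed

text \<open>After division by \<open>t\<close> the tempered terms \<open>m i\<close> sum to at most
  \<open>D\<close>. A term with \<open>z i > 1\<close> is \<open>(z i)\<^sup>2\<close>, so this
  single square is at most \<open>D\<close>, and then so is \<open>z i\<close>. The power
  \<open>z i ^ (k - 2)\<close> missing in large terms thus costs at most \<open>D ^ (k - 2)\<close>;
  small terms already carry it.\<close>

lemma sum_power_le_of_tempered:
  fixes y :: "nat \<Rightarrow> real"
  assumes t: "t > 0" and D: "D \<ge> 1" and k: "k \<ge> 2"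
    and S: "(\<Sum>i<n. tempered_power k t (y i)) \<le> D / 4 * t\<^sup>2"
  shows "(\<Sum>i<n. \<bar>y i\<bar> ^ k) \<le> D ^ (k - 1) * t ^ k"
proof -
  define z where "z = (\<lambda>i. \<bar>y i\<bar> / t)"
  have z: "z i \<ge> 0" and yz: "\<bar>y i\<bar> = t * z i" for i using t by (auto simp: z_def)
  define m where "m = (\<lambda>i. (z i)\<^sup>2 * min 1 (z i ^ (k - 2)))"
  have m0: "m i \<ge> 0" for i using z by (simp add: m_def)
  have "t\<^sup>2 / 4 * (\<Sum>i<n. m i) = (\<Sum>i<n. tempered_power k t (y i))"
    unfolding sum_distrib_left m_def z_def tempered_power_def using t by (intro sum.cong) (auto simp: power_divide)
  also have "\<dots> \<le> t\<^sup>2 / 4 * D" by (rule order.trans[OF S]) simp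
  finally have mD: "(\<Sum>i<n. m i) \<le> D" using t by simp
  have zk: "z i ^ k \<le> m i * D ^ (k - 2)" if "i < n" for i
  proof (cases "z i \<le> 1")
    case True
    then have "m i = z i ^ (k - 2) * (z i)\<^sup>2" using z by (simp add: m_def power_le_one)
    also have "\<dots> = z i ^ k" using k by (metis le_add_diff_inverse2 power_add)
    finally show ?thesis using mult_left_mono[of 1 "D ^ (k - 2)" "m i"] m0[of i] D by simp
  next
    case False
    then have mi: "m i = (z i)\<^sup>2" by (simp add: m_def one_le_power)
    have "m i \<le> (\<Sum>i<n. m i)" using that m0 by (intro member_le_sum) auto
    then have "(z i)\<^sup>2 \<le> D" using mi mD by simp
    moreover have "z i \<le> (z i)\<^sup>2" using False by (simp add: power2_eq_square)
    ultimately have "z i ^ (k - 2) \<le> D ^ (k - 2)" using z by (intro power_mono) auto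
    then have "(z i)\<^sup>2 * z i ^ (k - 2) \<le> m i * D ^ (k - 2)" unfolding mi by (intro mult_left_mono) auto
    moreover have "(z i)\<^sup>2 * z i ^ (k - 2) = z i ^ k" using k by (metis le_add_diff_inverse power_add)
    ultimately show ?thesis by simp
  qed
  have "(\<Sum>i<n. \<bar>y i\<bar> ^ k) = t ^ k * (\<Sum>i<n. z i ^ k)"
    by (simp add: yz power_mult_distrib sum_distrib_left)
  also have "\<dots> \<le> t ^ k * (\<Sum>i<n. m i * D ^ (k - 2))"
    using t zk by (intro mult_left_mono sum_mono) auto
  also have "\<dots> \<le> t ^ k * (D * D ^ (k - 2))"
    unfolding sum_distrib_right[symmetric] using t mD D by (intro mult_left_mono mult_right_mono) auto
  also have "D * D ^ (k - 2) = D ^ (k - 1)"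
    using k by (metis Suc_1 Suc_diff_le diff_Suc_Suc diff_zero One_nat_def power_Suc)
  finally show ?thesis by (simp add: mult.commute)
qed

subsection \<open>Derivatives of the log posterior\<close>

text \<open>Derivatives of softplus of positive order are polynomials in the sigmoid, by the chain
  rule with derivative \<sigma>(1 - \<sigma>) of \<sigma>, the factor \<open>[:0, 1, -1:]\<close>.
  The index is shifted: polynomial \<open>k\<close> gives the derivative of order
  \<open>Suc k\<close>, since softplus itself is not of this form.\<close>

fun softplus_deriv_poly :: "nat \<Rightarrow> real poly" where
  "softplus_deriv_poly 0 = [:0, 1:]"
| "softplus_deriv_poly (Suc k) = pderiv (softplus_deriv_poly k) * [:0, 1, -1:]"

fun softplus_deriv :: "nat \<Rightarrow> real \<Rightarrow> real" where
  "softplus_deriv 0 t = softplus t"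
| "softplus_deriv (Suc k) t = poly (softplus_deriv_poly k) (sigmoid t)"

lemma sigmoid_DERIV: "(sigmoid has_real_derivative sigmoid t * (1 - sigmoid t)) (at t)"
proof -
  have "1 + exp (- t) \<noteq> 0" using exp_gt_zero[of "- t"] by linarith
  then show ?thesis
    unfolding sigmoid_def[abs_def]
    by (auto intro!: derivative_eq_intros simp: field_simps power2_eq_square)
qed

lemma softplus_deriv_DERIV: "(softplus_deriv k has_real_derivative softplus_deriv (Suc k) t) (at t)"
proof (cases k)
  case 0
  have "1 + exp t > 0" by (simp add: add_pos_pos)
  then have "(softplus has_real_derivative sigmoid t) (at t)"
    unfolding softplus_def[abs_def] sigmoid_def
    by (auto intro!: derivative_eq_intros simp: exp_minus field_simps)
  moreover have "softplus_deriv 0 = softplus" by (rule ext) simp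
  ultimately show ?thesis using 0 by simp
next
  case (Suc j)
  have "((\<lambda>t. poly (softplus_deriv_poly j) (sigmoid t)) has_real_derivative
      poly (pderiv (softplus_deriv_poly j)) (sigmoid t) * (sigmoid t * (1 - sigmoid t))) (at t)"
    by (rule DERIV_chain2[OF poly_DERIV sigmoid_DERIV])
  moreover have "softplus_deriv (Suc j) = (\<lambda>t. poly (softplus_deriv_poly j) (sigmoid t))" by (rule ext) simp
  ultimately show ?thesis using Suc by (simp add: algebra_simps)
qed

lemma softplus_deriv_simps:
  "softplus_deriv (Suc 0) t = sigmoid t"
  "softplus_deriv 2 t = sigmoid t * (1 - sigmoid t)"
  by (simp_all add: numeral_2_eq_2 pderiv_pCons algebra_simps)

text \<open>The sigmoid takes values in a compact interval, where a polynomial is bounded. This is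
  why the tensor bounds hold uniformly in \<open>b\<close>.\<close>

lemma softplus_deriv_bounded: "\<exists>B. \<forall>t. \<bar>softplus_deriv (Suc k) t\<bar> \<le> B"
proof -
  have "compact (poly (softplus_deriv_poly k) ` {0..1})"
    by (intro compact_continuous_image continuous_on_poly) auto
  then have "bounded (poly (softplus_deriv_poly k) ` {0..1})"
    by (rule compact_imp_bounded)
  then obtain B where B: "\<forall>x\<in>{0..1}. \<bar>poly (softplus_deriv_poly k) x\<bar> \<le> B"
    unfolding bounded_iff by auto
  have "\<bar>softplus_deriv (Suc k) t\<bar> \<le> B" for t
    using B sigmoid_bounds[of t] by simp
  then show ?thesis by blast
qed

text \<open>Rests on the form \<open>1 / (2 + exp t + exp (- t))\<close>, which is even and
  decreasing in the absolute value. A bound on a feature product thus bounds its Hessian weight from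
  below.\<close>

lemma softplus_deriv2_bounds: "0 < softplus_deriv 2 t" "\<bar>s\<bar> \<le> t \<Longrightarrow> softplus_deriv 2 t \<le> softplus_deriv 2 s"
proof -
  show "0 < softplus_deriv 2 t"
    using sigmoid_bounds[of t] by (simp add: softplus_deriv_simps)
  assume st: "\<bar>s\<bar> \<le> t"
  have eq: "softplus_deriv 2 r = 1 / (2 + exp r + exp (- r))" for r
  proof -
    have f: "1 + exp (- r) > 0" by (simp add: add_pos_pos)
    then have "softplus_deriv 2 r = exp (- r) / (1 + exp (- r))\<^sup>2"
      by (simp add: softplus_deriv_simps sigmoid_def field_simps power2_eq_square)
    also have "(1 + exp (- r))\<^sup>2 = exp (- r) * (2 + exp r + exp (- r))"
      by (simp add: power2_eq_square algebra_simps exp_add[symmetric])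
    finally show ?thesis by simp
  qed
  have cosh: "exp r + exp (- r) = 2 * cosh r" for r :: real by (simp add: cosh_field_def)
  have "cosh s \<le> cosh t"
    using st by (subst cosh_real_abs[symmetric]) (metis abs_ge_zero cosh_real_nonneg_le_iff order_trans)
  then have "2 + exp s + exp (- s) \<le> 2 + exp t + exp (- t)"
    using cosh[of s] cosh[of t] by linarith
  then show "softplus_deriv 2 t \<le> softplus_deriv 2 s"
    unfolding eq by (intro divide_left_mono) (auto intro!: mult_pos_pos add_pos_pos)
qed

text \<open>Iterated partial derivatives of what remains of the negative log posterior once the
  softplus terms are removed. The remainder is a quadratic polynomial, so nothing is left from order
  three on.\<close>

definition linear_quadratic_deriv :: "nat \<Rightarrow> real mat \<Rightarrow> (nat \<Rightarrow> real vec \<times> bool) \<Rightarrow> nat list \<Rightarrow> real vec \<Rightarrow> real" where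
  "linear_quadratic_deriv n Q \<omega> js b = (case js of
      [] \<Rightarrow> - (\<Sum>i<n. of_bool (snd (\<omega> i)) * (fst (\<omega> i) \<bullet> b)) + 1 / 2 * (b \<bullet> (Q *\<^sub>v b))
    | [j] \<Rightarrow> - (\<Sum>i<n. of_bool (snd (\<omega> i)) * fst (\<omega> i) $ j) + (Q *\<^sub>v b) $ j
    | [j, k] \<Rightarrow> Q $$ (j, k)
    | _ \<Rightarrow> 0)"

text \<open>One fixed sample; everything inside is deterministic. Semidefiniteness of
  \<open>Q\<close> covers both kinds of prior.\<close>

locale logit_sample =
  fixes d n :: nat and M Q :: "real mat" and \<beta> :: "real vec" and \<omega> :: "nat \<Rightarrow> real vec \<times> bool"
  assumes d: "1 \<le> d" and n: "1 \<le> n" and M: "spd d M" and Q: "psd d Q" and beta: "\<beta> \<in> carrier_vec d"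
    and X: "\<And>i. i < n \<Longrightarrow> fst (\<omega> i) \<in> carrier_vec d"
begin

abbreviation x where "x i \<equiv> fst (\<omega> i)"
abbreviation y where "y i \<equiv> (of_bool (snd (\<omega> i)) :: real)"
abbreviation v where "v \<equiv> scaled_nlp n Q \<omega>"

text \<open>Together with \<open>curvature\<close> and \<open>third\<close>: the first three
  derivatives of \<open>v\<close> at \<open>b\<close> along \<open>h\<close>, written out.
  Restriction to lines reduces the calculus to one real variable.\<close>

definition slope where
  "slope b h = ((\<Sum>i<n. (sigmoid (x i \<bullet> b) - y i) * (x i \<bullet> h)) + h \<bullet> (Q *\<^sub>v b)) / real n"

definition curvature where
  "curvature b h = ((\<Sum>i<n. softplus_deriv 2 (x i \<bullet> b) * (x i \<bullet> h)\<^sup>2) + h \<bullet> (Q *\<^sub>v h)) / real n"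

definition third where
  "third b h = (\<Sum>i<n. softplus_deriv 3 (x i \<bullet> b) * (x i \<bullet> h) ^ 3) / real n"

lemma Qc: "Q \<in> carrier_mat d d" "transpose_mat Q = Q"
  using Q by (auto simp: psd_def)

lemma x_line:
  assumes "i < n" "b \<in> carrier_vec d" "h \<in> carrier_vec d"
  shows "x i \<bullet> (b + t \<cdot>\<^sub>v h) = x i \<bullet> b + t * (x i \<bullet> h)"
  using assms X[OF assms(1)] by (simp add: scalar_prod_add_distrib[of _ d])

lemma v_DERIV:
  assumes b: "b \<in> carrier_vec d" and h: "h \<in> carrier_vec d"
  shows "((\<lambda>t. v (b + t \<cdot>\<^sub>v h)) has_real_derivative slope (b + t \<cdot>\<^sub>v h) h) (at t)"
proof -
  have eq: "v (b + t \<cdot>\<^sub>v h) = (- (\<Sum>i<n. y i * (x i \<bullet> b + t * (x i \<bullet> h)))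
      + (\<Sum>i<n. softplus_deriv 0 (x i \<bullet> b + t * (x i \<bullet> h)))
      + 1 / 2 * (b \<bullet> (Q *\<^sub>v b) + 2 * t * (h \<bullet> (Q *\<^sub>v b)) + t\<^sup>2 * (h \<bullet> (Q *\<^sub>v h)))) / real n" for t
    unfolding scaled_nlp_def neg_log_post_def quad_form_line(1)[OF Qc b h] using x_line[OF _ b h] by simp
  have S: "((\<lambda>t. softplus_deriv 0 (x i \<bullet> b + t * (x i \<bullet> h))) has_real_derivative
      softplus_deriv (Suc 0) (x i \<bullet> b + t * (x i \<bullet> h)) * (x i \<bullet> h)) (at t)" for i
    by (rule DERIV_chain2[OF softplus_deriv_DERIV]) (auto intro!: derivative_eq_intros)
  have sl: "slope (b + t \<cdot>\<^sub>v h) h = (- (\<Sum>i<n. y i * (x i \<bullet> h))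
      + (\<Sum>i<n. softplus_deriv (Suc 0) (x i \<bullet> b + t * (x i \<bullet> h)) * (x i \<bullet> h))
      + 1 / 2 * (2 * (h \<bullet> (Q *\<^sub>v b)) + 2 * t * (h \<bullet> (Q *\<^sub>v h)))) / real n"
    unfolding slope_def quad_form_line(3)[OF Qc b h] using x_line[OF _ b h]
    by (simp add: softplus_deriv_simps left_diff_distrib sum_subtractf algebra_simps del: softplus_deriv.simps)
  show ?thesis
    unfolding eq sl using n
    by (auto intro!: derivative_eq_intros S simp del: softplus_deriv.simps)
qed

lemma slope_DERIV:
  assumes b: "b \<in> carrier_vec d" and h: "h \<in> carrier_vec d"
  shows "((\<lambda>t. slope (b + t \<cdot>\<^sub>v h) h) has_real_derivative curvature (b + t \<cdot>\<^sub>v h) h) (at t)"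
proof -
  have eq: "slope (b + t \<cdot>\<^sub>v h) h = ((\<Sum>i<n. (softplus_deriv (Suc 0) (x i \<bullet> b + t * (x i \<bullet> h)) - y i) * (x i \<bullet> h))
      + (h \<bullet> (Q *\<^sub>v b) + t * (h \<bullet> (Q *\<^sub>v h)))) / real n" for t
    unfolding slope_def quad_form_line(3)[OF Qc b h] using x_line[OF _ b h]
    by (simp add: softplus_deriv_simps del: softplus_deriv.simps)
  have S: "((\<lambda>t. softplus_deriv (Suc 0) (x i \<bullet> b + t * (x i \<bullet> h))) has_real_derivative
      softplus_deriv 2 (x i \<bullet> b + t * (x i \<bullet> h)) * (x i \<bullet> h)) (at t)" for i
    unfolding numeral_2_eq_2
    by (rule DERIV_chain2[OF softplus_deriv_DERIV]) (auto intro!: derivative_eq_intros)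
  have sl: "curvature (b + t \<cdot>\<^sub>v h) h = ((\<Sum>i<n. softplus_deriv 2 (x i \<bullet> b + t * (x i \<bullet> h)) * (x i \<bullet> h) * (x i \<bullet> h))
      + h \<bullet> (Q *\<^sub>v h)) / real n"
    unfolding curvature_def using x_line[OF _ b h]
    by (simp add: power2_eq_square mult.assoc del: softplus_deriv.simps)
  show ?thesis
    unfolding eq sl using n
    by (auto intro!: derivative_eq_intros S simp del: softplus_deriv.simps)
qed

lemma curvature_DERIV:
  assumes b: "b \<in> carrier_vec d" and h: "h \<in> carrier_vec d"
  shows "((\<lambda>t. curvature (b + t \<cdot>\<^sub>v h) h) has_real_derivative third (b + t \<cdot>\<^sub>v h) h) (at t)"
proof -
  have eq: "curvature (b + t \<cdot>\<^sub>v h) h = ((\<Sum>i<n. softplus_deriv 2 (x i \<bullet> b + t * (x i \<bullet> h)) * (x i \<bullet> h)\<^sup>2)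
      + h \<bullet> (Q *\<^sub>v h)) / real n" for t
    unfolding curvature_def using x_line[OF _ b h] by (simp del: softplus_deriv.simps)
  have S: "((\<lambda>t. softplus_deriv 2 (x i \<bullet> b + t * (x i \<bullet> h))) has_real_derivative
      softplus_deriv 3 (x i \<bullet> b + t * (x i \<bullet> h)) * (x i \<bullet> h)) (at t)" for i
    unfolding numeral_3_eq_3 numeral_2_eq_2
    by (rule DERIV_chain2[OF softplus_deriv_DERIV]) (auto intro!: derivative_eq_intros)
  have sl: "third (b + t \<cdot>\<^sub>v h) h
      = (\<Sum>i<n. softplus_deriv 3 (x i \<bullet> b + t * (x i \<bullet> h)) * (x i \<bullet> h) * (x i \<bullet> h)\<^sup>2) / real n"
    unfolding third_def using x_line[OF _ b h]
    by (simp add: power2_eq_square power3_eq_cube mult.assoc del: softplus_deriv.simps)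
  show ?thesis
    unfolding eq sl using n
    by (auto intro!: derivative_eq_intros S simp del: softplus_deriv.simps)
qed

lemma curvature_nonneg:
  assumes "h \<in> carrier_vec d"
  shows "0 \<le> curvature b h"
  using assms Q softplus_deriv2_bounds(1) unfolding curvature_def psd_def
  by (intro divide_nonneg_nonneg add_nonneg_nonneg sum_nonneg mult_nonneg_nonneg) (auto simp: less_imp_le)

lemma taylor2:
  assumes b: "b \<in> carrier_vec d" and h: "h \<in> carrier_vec d"
  obtains \<xi> where "0 < \<xi>" "\<xi> < 1" "v (b + h) = v b + slope b h + curvature (b + \<xi> \<cdot>\<^sub>v h) h / 2"
proof -
  define F where "F = (\<lambda>(m::nat) t. if m = 0 then v (b + t \<cdot>\<^sub>v h) else if m = 1 then slope (b + t \<cdot>\<^sub>v h) h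
      else curvature (b + t \<cdot>\<^sub>v h) h)"
  have "\<forall>m t. m < 2 \<and> 0 \<le> t \<and> t \<le> 1 \<longrightarrow> (F m has_real_derivative F (Suc m) t) (at t)"
    using v_DERIV[OF b h] slope_DERIV[OF b h] by (auto simp: F_def less_2_cases_iff)
  from Maclaurin[of 1 2 F "F 0", OF _ _ refl this] obtain \<xi>
    where "0 < \<xi>" "\<xi> < 1" "F 0 1 = (\<Sum>m<2. F m 0 / fact m * 1 ^ m) + F 2 \<xi> / fact 2 * 1\<^sup>2"
    by auto
  moreover have "b + 0 \<cdot>\<^sub>v h = b" "b + 1 \<cdot>\<^sub>v h = b + h" using b h by auto
  ultimately show thesis
    by (intro that[of \<xi>]) (auto simp: F_def numeral_2_eq_2)
qed

lemma taylor3: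
  assumes b: "b \<in> carrier_vec d" and h: "h \<in> carrier_vec d"
  obtains \<xi> where "v (b + h) = v b + slope b h + curvature b h / 2 + third (b + \<xi> \<cdot>\<^sub>v h) h / 6"
proof -
  define F where "F = (\<lambda>(m::nat) t. if m = 0 then v (b + t \<cdot>\<^sub>v h) else if m = 1 then slope (b + t \<cdot>\<^sub>v h) h
      else if m = 2 then curvature (b + t \<cdot>\<^sub>v h) h else third (b + t \<cdot>\<^sub>v h) h)"
  have "\<forall>m t. m < 3 \<and> 0 \<le> t \<and> t \<le> 1 \<longrightarrow> (F m has_real_derivative F (Suc m) t) (at t)"
  proof (intro allI impI, elim conjE)
    fix m :: nat and t :: real assume "m < 3"
    then consider "m = 0" | "m = 1" | "m = 2" by linarith
    then show "(F m has_real_derivative F (Suc m) t) (at t)"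
      using v_DERIV[OF b h, of t] slope_DERIV[OF b h, of t] curvature_DERIV[OF b h, of t]
      by cases (simp_all add: F_def)
  qed
  from Maclaurin[of 1 3 F "F 0", OF _ _ refl this] obtain \<xi>
    where "0 < \<xi>" "\<xi> < 1" "F 0 1 = (\<Sum>m<3. F m 0 / fact m * 1 ^ m) + F 3 \<xi> / fact 3 * 1 ^ 3"
    by auto
  moreover have "b + 0 \<cdot>\<^sub>v h = b" "b + 1 \<cdot>\<^sub>v h = b + h" using b h by auto
  ultimately show thesis
    by (intro that[of \<xi>]) (auto simp: F_def eval_nat_numeral)
qed

lemma v_convex:
  assumes b: "b \<in> carrier_vec d" and h: "h \<in> carrier_vec d" and t: "0 \<le> t" "t \<le> 1"
  shows "v (b + t \<cdot>\<^sub>v h) \<le> (1 - t) * v b + t * v (b + h)"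
proof -
  have "convex_on UNIV (\<lambda>t. v (b + t \<cdot>\<^sub>v h))"
    using curvature_nonneg[OF h] by (intro f''_ge0_imp_convex[OF _ v_DERIV[OF b h] slope_DERIV[OF b h]]) auto
  from convex_onD[OF this t(1) t(2), of 0 1]
  have "v (b + t \<cdot>\<^sub>v h) \<le> (1 - t) * v (b + 0 \<cdot>\<^sub>v h) + t * v (b + 1 \<cdot>\<^sub>v h)" by simp
  moreover have "b + 0 \<cdot>\<^sub>v h = b" "b + 1 \<cdot>\<^sub>v h = b + h" using b h by auto
  ultimately show ?thesis by simp
qed

text \<open>Induction over the index list, whose head is differentiated last. A step raises the
  order of the softplus derivative and multiplies by one more coordinate of the feature. The
  hypothesis has to hold at all \<open>b\<close> because it is itself differentiated.\<close>

lemma iter_partial_v: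
  assumes "set js \<subseteq> {..<d}" "b \<in> carrier_vec d"
  shows "iter_partial d js v b
    = ((\<Sum>i<n. softplus_deriv (length js) (x i \<bullet> b) * (\<Prod>j\<leftarrow>js. x i $ j)) + linear_quadratic_deriv n Q \<omega> js b) / real n"
  using assms
proof (induction js arbitrary: b)
  case Nil
  then show ?case
    by (simp add: scaled_nlp_def neg_log_post_def linear_quadratic_deriv_def algebra_simps add_divide_distrib diff_divide_distrib)
next
  case (Cons j js)
  let ?e = "unit_vec d j :: real vec"
  have j: "j < d" and js: "set js \<subseteq> {..<d}" using Cons.prems by auto
  have e: "?e \<in> carrier_vec d" by simp
  note b = Cons.prems(2)
  have xe: "x i \<bullet> ?e = x i $ j" if "i < n" for i
    using X[OF that] j by simp
  let ?R = "linear_quadratic_deriv n Q \<omega>"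
  have eq: "iter_partial d js v (b + t \<cdot>\<^sub>v ?e) = ((\<Sum>i<n. softplus_deriv (length js) (x i \<bullet> b + t * x i $ j)
      * (\<Prod>j\<leftarrow>js. x i $ j)) + ?R js (b + t \<cdot>\<^sub>v ?e)) / real n" for t
  proof -
    have "b + t \<cdot>\<^sub>v ?e \<in> carrier_vec d" using b by simp
    from Cons.IH[OF js this] show ?thesis using x_line[OF _ b e] xe by simp
  qed
  have S: "((\<lambda>t. softplus_deriv m (x i \<bullet> b + t * x i $ j)) has_real_derivative
      softplus_deriv (Suc m) (x i \<bullet> b + 0 * x i $ j) * x i $ j) (at 0)" for i m
    by (rule DERIV_chain2[OF softplus_deriv_DERIV]) (auto intro!: derivative_eq_intros)
  have R: "((\<lambda>t. ?R js (b + t \<cdot>\<^sub>v ?e)) has_real_derivative ?R (j # js) b) (at 0)"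
  proof -
    consider "js = []" | k where "js = [k]" | k l ks where "js = k # l # ks"
      by (metis list.exhaust)
    then show ?thesis
    proof cases
      case 1
      have "?R js (b + t \<cdot>\<^sub>v ?e) = - (\<Sum>i<n. y i * (x i \<bullet> b + t * x i $ j))
          + 1 / 2 * (b \<bullet> (Q *\<^sub>v b) + 2 * t * (?e \<bullet> (Q *\<^sub>v b)) + t\<^sup>2 * (?e \<bullet> (Q *\<^sub>v ?e)))" for t
        unfolding 1 linear_quadratic_deriv_def list.case quad_form_line(1)[OF Qc b e]
        using x_line[OF _ b e] xe by simp
      moreover have "?e \<bullet> (Q *\<^sub>v b) = (Q *\<^sub>v b) $ j" using Qc b j by simp
      ultimately show ?thesis
        by (auto simp: 1 linear_quadratic_deriv_def intro!: derivative_eq_intros)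
    next
      case 2
      have k: "k < d" using js 2 by simp
      \<comment> \<open>Differentiating \<open>(Q *\<^sub>v b) $ k\<close> in direction
        \<open>j\<close> produces the entry \<open>(k, j)\<close>, whereas the closed form names the
        newest index first; symmetry of \<open>Q\<close> reconciles them.\<close>
      have "Q $$ (k, j) = transpose_mat Q $$ (j, k)" using Qc(1) j k by simp
      then have "Q $$ (k, j) = Q $$ (j, k)" by (simp only: Qc(2))
      moreover have "(Q *\<^sub>v (b + t \<cdot>\<^sub>v ?e)) $ k = (Q *\<^sub>v b) $ k + t * Q $$ (k, j)" for t
      proof -
        have "Q *\<^sub>v (b + t \<cdot>\<^sub>v ?e) = Q *\<^sub>v b + t \<cdot>\<^sub>v (Q *\<^sub>v ?e)"
          using Qc b e by (simp add: mult_add_distrib_mat_vec[of _ d d] mult_mat_vec[of _ d d])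
        then show ?thesis using Qc b k j by simp
      qed
      ultimately show ?thesis
        unfolding 2 linear_quadratic_deriv_def list.case by (auto intro!: derivative_eq_intros)
    next
      case 3
      then show ?thesis by (cases ks) (auto simp: linear_quadratic_deriv_def)
    qed
  qed
  have "((\<lambda>t. iter_partial d js v (b + t \<cdot>\<^sub>v ?e)) has_real_derivative
      ((\<Sum>i<n. softplus_deriv (Suc (length js)) (x i \<bullet> b + 0 * x i $ j) * x i $ j * (\<Prod>j\<leftarrow>js. x i $ j)) + ?R (j # js) b)
        / real n) (at 0)"
    unfolding eq using n by (auto intro!: derivative_eq_intros S R simp del: softplus_deriv.simps)
  then show ?case
    unfolding iter_partial.simps partial_deriv_def
    by (subst DERIV_imp_deriv) (auto simp: algebra_simps simp del: softplus_deriv.simps)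
qed
end

section \<open>Tensors of derivatives and their norms\<close>

lemma sum_lists_prod:
  fixes a :: "nat \<Rightarrow> real"
  shows "(\<Sum>js | length js = k \<and> set js \<subseteq> {..<d}. \<Prod>j\<leftarrow>js. a j) = (\<Sum>j<d. a j) ^ k"
proof (induction k)
  case 0
  have "{js :: nat list. length js = 0 \<and> set js \<subseteq> {..<d}} = {[]}" by auto
  then show ?case by simp
next
  case (Suc k)
  let ?L = "{js. length js = k \<and> set js \<subseteq> {..<d}}"
  have "{js. length js = Suc k \<and> set js \<subseteq> {..<d}} = (\<lambda>(js, j). j # js) ` (?L \<times> {..<d})"
    using lists_length_Suc_eq[of "{..<d}" k] by (simp add: conj_commute)
  moreover have "inj_on (\<lambda>(js, j). j # js) (?L \<times> {..<d})"
    by (auto simp: inj_on_def)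
  ultimately have "(\<Sum>js | length js = Suc k \<and> set js \<subseteq> {..<d}. \<Prod>j\<leftarrow>js. a j)
      = (\<Sum>(js, j)\<in>?L \<times> {..<d}. a j * (\<Prod>j\<leftarrow>js. a j))"
    by (simp add: sum.reindex case_prod_unfold)
  also have "\<dots> = (\<Sum>js\<in>?L. \<Sum>j<d. a j * (\<Prod>j\<leftarrow>js. a j))"
    by (simp add: sum.cartesian_product)
  also have "\<dots> = (\<Sum>js\<in>?L. (\<Sum>j<d. a j) * (\<Prod>j\<leftarrow>js. a j))"
    by (simp add: sum_distrib_right)
  also have "\<dots> = (\<Sum>j<d. a j) ^ Suc k"
    by (simp add: sum_distrib_left[symmetric] Suc)
  finally show ?case .
qed

lemma prod_list_map_mult:
  fixes f g :: "'a \<Rightarrow> real"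
  shows "(\<Prod>j\<leftarrow>js. f j * g j) = (\<Prod>j\<leftarrow>js. f j) * (\<Prod>j\<leftarrow>js. g j)"
  by (induction js) (auto simp: mult_ac)

lemma tensor_pow_inner_mat:
  assumes "Q \<in> carrier_mat d d" "u \<in> carrier_vec d"
  shows "tensor_pow_inner d 2 (\<lambda>js. Q $$ (js ! 0, js ! 1)) u = u \<bullet> (Q *\<^sub>v u)"
proof -
  have "{js. length js = 2 \<and> set js \<subseteq> {..<d}} = (\<lambda>(i, j). [i, j]) ` ({..<d} \<times> {..<d})"
    by (auto simp: numeral_2_eq_2 length_Suc_conv)
  moreover have "inj_on (\<lambda>(i, j). [i, j]) ({..<d} \<times> {..<d})"
    by (auto simp: inj_on_def)
  ultimately have "tensor_pow_inner d 2 (\<lambda>js. Q $$ (js ! 0, js ! 1)) u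
      = (\<Sum>(i, j)\<in>{..<d} \<times> {..<d}. Q $$ (i, j) * (u $ i * u $ j))"
    by (simp add: tensor_pow_inner_def sum.reindex case_prod_unfold)
  then show ?thesis
    by (simp add: sum.cartesian_product[symmetric] quad_form_sum[OF assms] mult.assoc)
qed

text \<open>A real supremum is informative only over a bounded set; the coordinate bound provides
  this. Homogeneity then extends the bound from the unit sphere.\<close>

lemma mat_norm_bound:
  assumes M: "spd d M" and Q: "Q \<in> carrier_mat d d"
    and cc: "0 \<le> cc" and coord: "\<And>u i. u \<in> carrier_vec d \<Longrightarrow> i < d \<Longrightarrow> \<bar>u $ i\<bar> \<le> cc * vnorm M u"
    and le: "mat_norm d M Q \<le> c" and u: "u \<in> carrier_vec d"
  shows "u \<bullet> (Q *\<^sub>v u) \<le> c * (vnorm M u)\<^sup>2"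
proof (cases "vnorm M u = 0")
  case True
  then have "u = 0\<^sub>v d" using spd_vnorm_pos[OF M u] by auto
  then show ?thesis using True Q by simp
next
  case False
  have Mc: "M \<in> carrier_mat d d" using M by (simp add: spd_def)
  have p: "vnorm M u > 0" using False psd_vnorm_square(2)[OF spd_imp_psd[OF M] u] by simp
  define w where "w = (1 / vnorm M u) \<cdot>\<^sub>v u"
  have w: "w \<in> carrier_vec d" using u by (simp add: w_def)
  have w1: "vnorm M w = 1" using p vnorm_smult[OF Mc u] by (simp add: w_def)
  have "\<bar>z \<bullet> (Q *\<^sub>v z)\<bar> \<le> (\<Sum>i<d. \<Sum>j<d. \<bar>Q $$ (i, j)\<bar> * cc * cc)"
    if z: "z \<in> carrier_vec d" "vnorm M z = 1" for z
  proof -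
    have "\<bar>z \<bullet> (Q *\<^sub>v z)\<bar> \<le> (\<Sum>i<d. \<Sum>j<d. \<bar>Q $$ (i, j) * z $ i * z $ j\<bar>)"
      unfolding quad_form_sum[OF Q z(1)] by (rule order.trans[OF sum_abs]) (intro sum_mono sum_abs)
    also have "\<dots> \<le> (\<Sum>i<d. \<Sum>j<d. \<bar>Q $$ (i, j)\<bar> * cc * cc)"
      unfolding abs_mult using coord[OF z(1)] z(2)
      by (intro sum_mono mult_mono) (auto simp: cc)
    finally show ?thesis .
  qed
  then have "bdd_above ((\<lambda>z. \<bar>tensor_pow_inner d 2 (\<lambda>js. Q $$ (js ! 0, js ! 1)) z\<bar>) ` {z \<in> carrier_vec d. vnorm M z = 1})"
    using tensor_pow_inner_mat[OF Q] by (auto simp: bdd_above_def)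
  then have "\<bar>w \<bullet> (Q *\<^sub>v w)\<bar> \<le> mat_norm d M Q"
    unfolding mat_norm_def tensor_norm_def tensor_pow_inner_mat[OF Q w, symmetric]
    using w w1 by (intro cSUP_upper) auto
  then have "w \<bullet> (Q *\<^sub>v w) \<le> c" using le by linarith
  moreover have "u = vnorm M u \<cdot>\<^sub>v w" using p by (simp add: w_def smult_smult_assoc)
  then have "u \<bullet> (Q *\<^sub>v u) = (vnorm M u)\<^sup>2 * (w \<bullet> (Q *\<^sub>v w))"
    using quad_form_smult[OF Q w] by metis
  ultimately show ?thesis using p by (simp add: mult.commute)
qed

text \<open>Positive dimension makes the unit sphere of \<open>H\<close> nonempty, so that the real
  supremum is governed by its upper bounds.\<close>

lemma tensor_norm_le:
  assumes "1 \<le> d" and H: "spd d H"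
    and B: "\<And>u. u \<in> carrier_vec d \<Longrightarrow> vnorm H u = 1 \<Longrightarrow> \<bar>tensor_pow_inner d k T u\<bar> \<le> B"
  shows "tensor_norm d k H T \<le> B"
proof -
  define e :: "real vec" where "e = unit_vec d 0"
  have e: "e \<in> carrier_vec d" "e \<noteq> 0\<^sub>v d"
    using assms(1) by (auto simp: e_def dest: arg_cong[where f = "\<lambda>v. v $ 0"])
  have Hc: "H \<in> carrier_mat d d" using H by (simp add: spd_def)
  have "vnorm H ((1 / vnorm H e) \<cdot>\<^sub>v e) = 1"
    using vnorm_smult[OF Hc e(1)] spd_vnorm_pos[OF H e] by simp
  then have "(1 / vnorm H e) \<cdot>\<^sub>v e \<in> {u \<in> carrier_vec d. vnorm H u = 1}" using e(1) by simp
  then have "{u \<in> carrier_vec d. vnorm H u = 1} \<noteq> {}" by blast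
  then show ?thesis
    unfolding tensor_norm_def by (rule cSUP_least) (use B in auto)
qed

text \<open>A vector is represented by a function on \<open>nat\<close> vanishing from
  \<open>d\<close> on and is read back through \<open>vec d\<close>. Boxes of such functions are
  compact in the product topology by Tychonoff's theorem.\<close>

lemma compact_box:
  fixes c :: real
  shows "compact {z :: nat \<Rightarrow> real. \<forall>i. (i < d \<longrightarrow> \<bar>z i - a i\<bar> \<le> c) \<and> (\<not> i < d \<longrightarrow> z i = 0)}"
proof -
  define S where "S = (\<lambda>i. if i < d then {a i - c..a i + c} else {0})"
  have "compactin (product_topology (\<lambda>_. euclidean) UNIV) (Pi\<^sub>E UNIV S)"
    unfolding compactin_PiE by (auto simp: S_def)
  then have "compact (Pi\<^sub>E UNIV S)"
    by (simp add: euclidean_product_topology)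
  moreover have "Pi\<^sub>E UNIV S = {z. \<forall>i. (i < d \<longrightarrow> \<bar>z i - a i\<bar> \<le> c) \<and> (\<not> i < d \<longrightarrow> z i = 0)}"
    by (auto simp: PiE_def Pi_def S_def abs_le_iff)
  ultimately show ?thesis by simp
qed

context logit_sample
begin

lemma nabla_inner:
  assumes b: "b \<in> carrier_vec d" and u: "u \<in> carrier_vec d" and k: "k \<ge> 3"
  shows "tensor_pow_inner d k (nabla d v b) u = (\<Sum>i<n. softplus_deriv k (x i \<bullet> b) * (x i \<bullet> u) ^ k) / real n"
proof -
  let ?L = "{js. length js = k \<and> set js \<subseteq> {..<d}}"
  have "linear_quadratic_deriv n Q \<omega> js b = 0" if "length js = k" for js
    using that k by (auto simp: linear_quadratic_deriv_def split: list.split)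
  then have "tensor_pow_inner d k (nabla d v b) u
      = (\<Sum>js\<in>?L. (\<Sum>i<n. softplus_deriv k (x i \<bullet> b) * (\<Prod>j\<leftarrow>js. x i $ j)) / real n * (\<Prod>j\<leftarrow>js. u $ j))"
    unfolding tensor_pow_inner_def nabla_def using iter_partial_v[OF _ b]
    by (intro sum.cong refl) (auto simp del: softplus_deriv.simps)
  also have "\<dots> = (\<Sum>js\<in>?L. \<Sum>i<n. softplus_deriv k (x i \<bullet> b) / real n * (\<Prod>j\<leftarrow>js. x i $ j * u $ j))"
    by (simp add: sum_divide_distrib sum_distrib_right sum_distrib_left prod_list_map_mult mult_ac
        del: softplus_deriv.simps)
  \<comment> \<open>With the sum over index lists innermost, \<open>sum_lists_prod\<close> recovers
    \<open>(x i \<bullet> u) ^ k\<close>: the derivative tensor is a weighted sum of tensor powers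
    of the features.\<close>
  also have "\<dots> = (\<Sum>i<n. softplus_deriv k (x i \<bullet> b) / real n * (\<Sum>js\<in>?L. \<Prod>j\<leftarrow>js. x i $ j * u $ j))"
    by (subst sum.swap) (simp add: sum_distrib_left)
  also have "\<dots> = (\<Sum>i<n. softplus_deriv k (x i \<bullet> b) / real n * (x i \<bullet> u) ^ k)"
    unfolding sum_lists_prod using u by (simp add: scalar_prod_def atLeast0LessThan)
  finally show ?thesis by (simp add: sum_divide_distrib)
qed

lemma hessian_carrier: "hessian d v b \<in> carrier_mat d d"
  by (simp add: hessian_def)

lemma hessian_entry:
  assumes b: "b \<in> carrier_vec d" and "i < d" "j < d"
  shows "hessian d v b $$ (i, j) = ((\<Sum>k<n. softplus_deriv 2 (x k \<bullet> b) * (x k $ i * x k $ j)) + Q $$ (i, j)) / real n"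
  using assms iter_partial_v[of "[i, j]" b]
  by (simp add: hessian_def nabla_def linear_quadratic_deriv_def numeral_2_eq_2 del: softplus_deriv.simps)

lemma hessian_symmetric:
  assumes b: "b \<in> carrier_vec d"
  shows "transpose_mat (hessian d v b) = hessian d v b"
proof (rule eq_matI)
  fix i j assume "i < dim_row (hessian d v b)" "j < dim_col (hessian d v b)"
  then have ij: "i < d" "j < d" by (auto simp: hessian_def)
  have "Q $$ (j, i) = transpose_mat Q $$ (i, j)" using Qc(1) ij by simp
  then have "Q $$ (j, i) = Q $$ (i, j)" by (simp only: Qc(2))
  then show "transpose_mat (hessian d v b) $$ (i, j) = hessian d v b $$ (i, j)"
    using ij hessian_carrier[of b] hessian_entry[OF b] by (simp add: mult.commute)
qed (auto simp: hessian_def)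

lemma hessian_quad_form:
  assumes b: "b \<in> carrier_vec d" and u: "u \<in> carrier_vec d"
  shows "u \<bullet> (hessian d v b *\<^sub>v u) = curvature b u"
proof -
  have xu: "x k \<bullet> u = (\<Sum>i<d. x k $ i * u $ i)" for k
    using u by (simp add: scalar_prod_def atLeast0LessThan)
  let ?f = "\<lambda>k. softplus_deriv 2 (x k \<bullet> b)"
  let ?A = "\<lambda>i j. \<Sum>k<n. ?f k * ((x k $ i * u $ i) * (x k $ j * u $ j))"
  let ?B = "\<lambda>i j. Q $$ (i, j) * u $ i * u $ j"
  have entry: "hessian d v b $$ (i, j) * u $ i * u $ j = (?A i j + ?B i j) / real n" if "i < d" "j < d" for i j
    unfolding hessian_entry[OF b that]
    by (simp add: sum_distrib_left sum_distrib_right algebra_simps del: softplus_deriv.simps)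
  have "u \<bullet> (hessian d v b *\<^sub>v u) = (\<Sum>i<d. \<Sum>j<d. (?A i j + ?B i j) / real n)"
    unfolding quad_form_sum[OF hessian_carrier u] by (intro sum.cong refl entry) auto
  also have "\<dots> = ((\<Sum>i<d. \<Sum>j<d. ?A i j) + (\<Sum>i<d. \<Sum>j<d. ?B i j)) / real n"
    by (simp only: sum.distrib sum_divide_distrib[symmetric])
  also have "(\<Sum>i<d. \<Sum>j<d. ?A i j) = (\<Sum>i<d. \<Sum>k<n. \<Sum>j<d. ?f k * ((x k $ i * u $ i) * (x k $ j * u $ j)))"
    by (intro sum.cong refl sum.swap)
  also have "\<dots> = (\<Sum>k<n. \<Sum>i<d. \<Sum>j<d. ?f k * ((x k $ i * u $ i) * (x k $ j * u $ j)))"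
    by (rule sum.swap)
  also have "\<dots> = (\<Sum>k<n. ?f k * (x k \<bullet> u)\<^sup>2)"
    unfolding xu power2_eq_square sum_product by (simp only: sum_distrib_left)
  finally show ?thesis
    unfolding curvature_def quad_form_sum[OF Qc(1) u] .
qed

lemma hessian_vnorm:
  assumes "b \<in> carrier_vec d" "u \<in> carrier_vec d"
  shows "vnorm (hessian d v b) u = sqrt (curvature b u)"
  by (simp add: vnorm_def hessian_quad_form[OF assms])

section \<open>Localization of the minimizer and growth away from it\<close>

lemma continuous_on_v: "continuous_on A (\<lambda>z. v (vec d z))"
proof -
  have c: "continuous_on A (\<lambda>z::nat \<Rightarrow> real. z i)" for i
    by (rule continuous_on_subset[OF continuous_on_product_coordinates]) simp
  have xz: "x i \<bullet> vec d z = (\<Sum>j<d. x i $ j * z j)" for i z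
    by (simp add: scalar_prod_def atLeast0LessThan)
  have Qz: "vec d z \<bullet> (Q *\<^sub>v vec d z) = (\<Sum>i<d. \<Sum>j<d. Q $$ (i, j) * z i * z j)" for z
    using quad_form_sum[OF Qc(1), of "vec d z"] by simp
  have nz: "1 + exp t \<noteq> 0" for t :: real using exp_gt_zero[of t] by linarith
  show ?thesis
    unfolding scaled_nlp_def neg_log_post_def xz Qz softplus_def
    by (intro continuous_intros c) (use n nz in auto)
qed

lemma continuous_on_vnorm: "continuous_on A (\<lambda>z. vnorm M (vec d z - \<beta>))"
proof -
  have Mc: "M \<in> carrier_mat d d" using M by (simp add: spd_def)
  have c: "continuous_on A (\<lambda>z::nat \<Rightarrow> real. z i)" for i
    by (rule continuous_on_subset[OF continuous_on_product_coordinates]) simp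
  have "vec d z - \<beta> \<in> carrier_vec d" for z using beta by auto
  then have "vnorm M (vec d z - \<beta>) = sqrt (\<Sum>i<d. \<Sum>j<d. M $$ (i, j) * (z i - \<beta> $ i) * (z j - \<beta> $ j))" for z
    unfolding vnorm_def using beta by (subst quad_form_sum[OF Mc]) (auto intro!: sum.cong)
  then show ?thesis
    by (auto intro!: continuous_intros c)
qed

text \<open>On the sphere of radius 1 around \<beta>, Taylor expansion at \<beta> gives at least
  \<open>v \<beta> - c / 4 + c / 2\<close>, more than \<open>v \<beta>\<close>. A minimizer over the
  compact ball is therefore interior, convexity makes it global, and strictly positive curvature
  makes it unique.\<close>

lemma minimizer_exists:
  assumes c: "0 < c"
    and coord: "\<And>u i. u \<in> carrier_vec d \<Longrightarrow> i < d \<Longrightarrow> \<bar>u $ i\<bar> \<le> cc * vnorm M u" and cc: "0 \<le> cc"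
    and hess: "\<And>\<theta> u. \<theta> \<in> carrier_vec d \<Longrightarrow> vnorm M (\<theta> - \<beta>) \<le> 1 \<Longrightarrow> u \<in> carrier_vec d \<Longrightarrow>
      c * (vnorm M u)\<^sup>2 \<le> curvature \<theta> u"
    and grad: "\<And>u. u \<in> carrier_vec d \<Longrightarrow> \<bar>slope \<beta> u\<bar> \<le> c / 4 * vnorm M u"
    and pos: "\<And>b u. u \<in> carrier_vec d \<Longrightarrow> u \<noteq> 0\<^sub>v d \<Longrightarrow> 0 < curvature b u"
  obtains b0 where "b0 \<in> carrier_vec d" "vnorm M (b0 - \<beta>) \<le> 1" "\<And>h. h \<in> carrier_vec d \<Longrightarrow> slope b0 h = 0"
    "\<And>b. b \<in> carrier_vec d \<Longrightarrow> b \<noteq> b0 \<Longrightarrow> v b0 < v b"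
proof -
  have Mc: "M \<in> carrier_mat d d" using M by (simp add: spd_def)
  define K where "K = {z :: nat \<Rightarrow> real. \<forall>i. (i < d \<longrightarrow> \<bar>z i - \<beta> $ i\<bar> \<le> cc) \<and> (\<not> i < d \<longrightarrow> z i = 0)}
      \<inter> {z. vnorm M (vec d z - \<beta>) \<le> 1}"
  have cl: "closed {z. vnorm M (vec d z - \<beta>) \<le> 1}"
    by (intro closed_Collect_le continuous_on_vnorm continuous_on_const)
  have K: "compact K" unfolding K_def by (intro compact_Int_closed compact_box cl)
  define ext where "ext = (\<lambda>b::real vec. \<lambda>i. if i < d then b $ i else 0)"
  have vext: "vec d (ext b) = b" if "b \<in> carrier_vec d" for b
    using that by (intro eq_vecI) (auto simp: ext_def)
  have ball: "ext b \<in> K" if b: "b \<in> carrier_vec d" and le: "vnorm M (b - \<beta>) \<le> 1" for b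
  proof -
    have "\<bar>b $ i - \<beta> $ i\<bar> \<le> cc" if i: "i < d" for i
    proof -
      have "\<bar>(b - \<beta>) $ i\<bar> \<le> cc * vnorm M (b - \<beta>)" using b beta i by (intro coord) auto
      also have "\<dots> \<le> cc * 1" using cc le by (intro mult_left_mono)
      finally show ?thesis using b beta i by simp
    qed
    then show ?thesis using le vext[OF b] by (auto simp: K_def ext_def)
  qed
  have bb: "vnorm M (\<beta> - \<beta>) = 0" using beta Mc by (simp add: vnorm_def minus_cancel_vec)
  have "ext \<beta> \<in> K" using ball[OF beta] bb by simp
  then have "K \<noteq> {}" by blast
  from continuous_attains_inf[OF K this continuous_on_v] obtain z where z: "z \<in> K"
    and zmin: "\<And>z'. z' \<in> K \<Longrightarrow> v (vec d z) \<le> v (vec d z')" by blast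
  define b0 where "b0 = vec d z"
  have b0: "b0 \<in> carrier_vec d" and b01: "vnorm M (b0 - \<beta>) \<le> 1" using z by (auto simp: b0_def K_def)
  have lmin: "v b0 \<le> v b" if "b \<in> carrier_vec d" "vnorm M (b - \<beta>) \<le> 1" for b
    using zmin[OF ball[OF that]] vext[OF that(1)] by (simp add: b0_def)
  have interior: "vnorm M (b0 - \<beta>) < 1"
  proof (rule ccontr)
    assume "\<not> ?thesis"
    then have one: "vnorm M (b0 - \<beta>) = 1" using b01 by simp
    define h where "h = b0 - \<beta>"
    have h: "h \<in> carrier_vec d" and bh: "\<beta> + h = b0" using b0 beta by (auto simp: h_def)
    from taylor2[OF beta h] obtain \<xi> where \<xi>: "0 < \<xi>" "\<xi> < 1"
      and T: "v (\<beta> + h) = v \<beta> + slope \<beta> h + curvature (\<beta> + \<xi> \<cdot>\<^sub>v h) h / 2" .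
    have "\<beta> + \<xi> \<cdot>\<^sub>v h - \<beta> = \<xi> \<cdot>\<^sub>v h" using beta h by (intro eq_vecI) auto
    then have "vnorm M (\<beta> + \<xi> \<cdot>\<^sub>v h - \<beta>) \<le> 1"
      using vnorm_smult[OF Mc h, of \<xi>] \<xi> one by (simp add: h_def)
    then have "c \<le> curvature (\<beta> + \<xi> \<cdot>\<^sub>v h) h"
      using hess[of "\<beta> + \<xi> \<cdot>\<^sub>v h" h] beta h one by (simp add: h_def)
    moreover have "\<bar>slope \<beta> h\<bar> \<le> c / 4" using grad[OF h] one by (simp add: h_def)
    moreover have "v b0 \<le> v \<beta>" using lmin[OF beta] bb by simp
    ultimately show False using T c unfolding bh by linarith
  qed
  have gmin: "v b0 \<le> v b" if b: "b \<in> carrier_vec d" for b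
  proof -
    define h where "h = b - b0"
    have h: "h \<in> carrier_vec d" and bh: "b0 + h = b" using b0 b by (auto simp: h_def)
    \<comment> \<open>A short move from the interior point \<open>b0\<close> towards
      \<open>b\<close> stays in the ball, where \<open>b0\<close> is minimal; convexity carries the
      comparison on to \<open>b\<close>.\<close>
    have "continuous_on UNIV (\<lambda>t::real. vnorm M (vec d (\<lambda>i. b0 $ i + t * h $ i) - \<beta>))"
      by (rule continuous_on_compose2[OF continuous_on_vnorm[of UNIV]])
        (auto intro!: continuous_on_coordinatewise_then_product continuous_intros)
    moreover have eq: "vec d (\<lambda>i. b0 $ i + t * h $ i) = b0 + t \<cdot>\<^sub>v h" for t
      using b0 h by (intro eq_vecI) auto
    ultimately have "isCont (\<lambda>t::real. vnorm M (b0 + t \<cdot>\<^sub>v h - \<beta>)) 0"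
      by (simp add: continuous_on_eq_continuous_at)
    moreover have "b0 + 0 \<cdot>\<^sub>v h = b0" using b0 h by auto
    ultimately have "((\<lambda>t. vnorm M (b0 + t \<cdot>\<^sub>v h - \<beta>)) \<longlongrightarrow> vnorm M (b0 - \<beta>)) (at 0)"
      by (simp add: isCont_def)
    then have "eventually (\<lambda>t. vnorm M (b0 + t \<cdot>\<^sub>v h - \<beta>) < 1) (at 0)"
      by (rule order_tendstoD(2)) (rule interior)
    then obtain e where e: "e > 0" "\<And>t. t \<noteq> 0 \<Longrightarrow> dist t 0 < e \<Longrightarrow> vnorm M (b0 + t \<cdot>\<^sub>v h - \<beta>) < 1"
      unfolding eventually_at by auto
    define t where "t = min 1 (e / 2)"
    have t: "0 < t" "t \<le> 1" "t < e" using e(1) by (auto simp: t_def)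
    have "vnorm M (b0 + t \<cdot>\<^sub>v h - \<beta>) \<le> 1" using e(2)[of t] t by (simp add: dist_real_def)
    then have "v b0 \<le> v (b0 + t \<cdot>\<^sub>v h)" using b0 h by (intro lmin) auto
    also have "\<dots> \<le> (1 - t) * v b0 + t * v b" using v_convex[OF b0 h, of t] t bh by simp
    finally have "t * v b0 \<le> t * v b" by (simp add: algebra_simps)
    then show ?thesis using t by simp
  qed
  have slope0: "slope b0 h = 0" if h: "h \<in> carrier_vec d" for h
  proof -
    have "b0 + 0 \<cdot>\<^sub>v h = b0" using b0 h by auto
    then have D: "((\<lambda>t. v (b0 + t \<cdot>\<^sub>v h)) has_real_derivative slope b0 h) (at 0)"
      using v_DERIV[OF b0 h, of 0] by simp
    show ?thesis
    proof (rule DERIV_local_min[OF D, where d = 1], simp, intro allI impI)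
      fix t :: real
      have "b0 + t \<cdot>\<^sub>v h \<in> carrier_vec d" using b0 h by simp
      then show "v (b0 + 0 \<cdot>\<^sub>v h) \<le> v (b0 + t \<cdot>\<^sub>v h)"
        using gmin \<open>b0 + 0 \<cdot>\<^sub>v h = b0\<close> by simp
    qed
  qed
  have "v b0 < v b" if b: "b \<in> carrier_vec d" and ne: "b \<noteq> b0" for b
  proof -
    define h where "h = b - b0"
    have h: "h \<in> carrier_vec d" and bh: "b0 + h = b" using b0 b by (auto simp: h_def)
    have "h \<noteq> 0\<^sub>v d" using bh ne b0 by auto
    moreover from taylor2[OF b0 h] obtain \<xi> where
      "v (b0 + h) = v b0 + slope b0 h + curvature (b0 + \<xi> \<cdot>\<^sub>v h) h / 2" .
    ultimately show ?thesis using pos[OF h, of "b0 + \<xi> \<cdot>\<^sub>v h"] slope0[OF h] bh by simp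
  qed
  then show thesis using that b0 b01 slope0 by blast
qed

text \<open>The segment from \<open>b0\<close> to \<open>b\<close> crosses the Hessian sphere of
  radius \<open>a\<close>. There the quadratic term is \<open>a\<^sup>2 / 2\<close>, and the
  condition on \<open>a * G\<close> limits the cubic remainder to \<open>a\<^sup>2 / 4\<close>, as
  3/2 divided by 6 is 1/4. Convexity stretches the gain \<open>a\<^sup>2 / 4\<close> at distance
  \<open>a\<close> to \<open>a / 4 * L\<close> at distance \<open>L\<close>.\<close>

lemma linear_growth:
  assumes b0: "b0 \<in> carrier_vec d" and slope0: "\<And>h. h \<in> carrier_vec d \<Longrightarrow> slope b0 h = 0"
    and c: "0 < c" and hess: "\<And>u. u \<in> carrier_vec d \<Longrightarrow> c * (vnorm M u)\<^sup>2 \<le> curvature b0 u"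
    and G: "0 \<le> G" and third: "\<And>b h. b \<in> carrier_vec d \<Longrightarrow> h \<in> carrier_vec d \<Longrightarrow> \<bar>third b h\<bar> \<le> G * vnorm M h ^ 3"
    and a: "0 < a" "a * G \<le> 3 / 2 * (c * sqrt c)"
    and b: "b \<in> carrier_vec d" and L: "a < vnorm (hessian d v b0) (b - b0)"
  shows "v b - v b0 \<ge> a / 4 * vnorm (hessian d v b0) (b - b0)"
proof -
  let ?H = "hessian d v b0"
  define L where "L = vnorm ?H (b - b0)"
  have aL: "a < L" using L by (simp add: L_def)
  define t where "t = a / L"
  have t: "0 < t" "t \<le> 1" using a aL by (auto simp: t_def)
  have bc: "b - b0 \<in> carrier_vec d" using b b0 by simp
  define h where "h = t \<cdot>\<^sub>v (b - b0)"
  have h: "h \<in> carrier_vec d" using bc by (simp add: h_def)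
  have ha: "vnorm ?H h = a"
    unfolding h_def vnorm_smult[OF hessian_carrier bc] L_def[symmetric] using t a aL by (simp add: t_def)
  then have "curvature b0 h = a\<^sup>2"
    using hessian_vnorm[OF b0 h] curvature_nonneg[OF h, of b0] by (metis real_sqrt_pow2)
  moreover have nn: "0 \<le> vnorm M h" by (rule psd_vnorm_square(2)[OF spd_imp_psd[OF M] h])
  ultimately have "(sqrt c * vnorm M h)\<^sup>2 \<le> a\<^sup>2" using hess[OF h] c by (simp add: power_mult_distrib)
  then have "sqrt c * vnorm M h \<le> a" by (rule power2_le_imp_le) (use a in simp)
  then have "(sqrt c * vnorm M h) ^ 3 \<le> a ^ 3" using c nn by (intro power_mono) auto
  moreover have "(sqrt c * vnorm M h) ^ 3 = c * sqrt c * vnorm M h ^ 3"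
    using c by (simp add: power3_eq_cube)
  ultimately have cube: "c * sqrt c * vnorm M h ^ 3 \<le> a ^ 3" by simp
  from taylor3[OF b0 h] obtain \<xi> where
    T: "v (b0 + h) = v b0 + slope b0 h + curvature b0 h / 2 + third (b0 + \<xi> \<cdot>\<^sub>v h) h / 6" .
  have "b0 + \<xi> \<cdot>\<^sub>v h \<in> carrier_vec d" using b0 h by simp
  from third[OF this h] have "\<bar>third (b0 + \<xi> \<cdot>\<^sub>v h) h\<bar> \<le> G * vnorm M h ^ 3" .
  moreover have "a * (G * vnorm M h ^ 3) \<le> a * (3 / 2 * a\<^sup>2)"
  proof -
    have "a * (G * vnorm M h ^ 3) = (a * G) * vnorm M h ^ 3" by simp
    also have "\<dots> \<le> 3 / 2 * (c * sqrt c) * vnorm M h ^ 3"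
      using a(2) nn by (intro mult_right_mono) auto
    also have "\<dots> \<le> 3 / 2 * a ^ 3" using cube by simp
    finally show ?thesis by (simp add: power2_eq_square power3_eq_cube)
  qed
  then have "G * vnorm M h ^ 3 \<le> 3 / 2 * a\<^sup>2" using a(1) by simp
  ultimately have lower: "v (b0 + h) \<ge> v b0 + a\<^sup>2 / 4"
    using T slope0[OF h] \<open>curvature b0 h = a\<^sup>2\<close> by linarith
  have "b0 + (b - b0) = b" using b b0 by auto
  then have "v (b0 + h) \<le> (1 - t) * v b0 + t * v b"
    using v_convex[OF b0 bc, of t] t by (simp add: h_def)
  then have "a\<^sup>2 / 4 \<le> t * (v b - v b0)" using lower by (simp add: algebra_simps)
  also have "\<dots> = a * (v b - v b0) / L" by (simp add: t_def)
  finally have "a * (a / 4 * L) \<le> a * (v b - v b0)"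
    using a aL by (simp add: pos_le_divide_eq power2_eq_square)
  then show ?thesis using a unfolding L_def[symmetric] by simp
qed

end

subsection \<open>Uniform bounds from bounds on a net\<close>

text \<open>The factor \<open>2 ^ k\<close> pays for the passage from the net to all directions; the
  other one is \<open>D ^ (k - 1)\<close> of \<open>sum_power_le_of_tempered\<close> with
  \<open>D = 4 * (moment_const k + 1)\<close>.\<close>

definition norm_const :: "nat \<Rightarrow> real" where
  "norm_const k = 2 ^ k * (4 * (moment_const k + 1)) ^ (k - 1)"

lemma moment_const_nonneg: "0 \<le> moment_const k"
  by (simp add: moment_const_def)

lemma norm_const_ge: "1 \<le> norm_const k"
proof -
  have "1 \<le> (4 * (moment_const k + 1)) ^ (k - 1)"
    using moment_const_nonneg[of k] by (intro one_le_power) simp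
  then have "1 * 1 \<le> 2 ^ k * (4 * (moment_const k + 1)) ^ (k - 1)"
    by (intro mult_mono) auto
  then show ?thesis by (simp add: norm_const_def)
qed

text \<open>Substituting \<open>z = Q *\<^sub>v u\<close> turns the form of \<open>Q\<close> at
  \<open>u\<close> into that of the covariance \<open>S\<close> at \<open>z\<close>.\<close>

lemma prior_precision_psd:
  assumes "prior_precision d Q"
  shows "psd d Q"
proof (cases "Q = 0\<^sub>m d d")
  case True
  have "0\<^sub>m d d *\<^sub>v u = 0\<^sub>v d" if "u \<in> carrier_vec d" for u :: "real vec"
    using that by (intro eq_vecI) auto
  then show ?thesis using True by (auto simp: psd_def)
next
  case False
  then obtain S where S: "spd d S" and Q: "Q \<in> carrier_mat d d" and SQ: "inverts_mat S Q" and QS: "inverts_mat Q S"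
    using assms by (auto simp: prior_precision_def)
  have Sc: "S \<in> carrier_mat d d" and St: "transpose_mat S = S" using S by (auto simp: spd_def)
  have 1: "S * Q = 1\<^sub>m d" and 2: "Q * S = 1\<^sub>m d" using SQ QS Sc Q by (auto simp: inverts_mat_def)
  have Qt: "transpose_mat Q \<in> carrier_mat d d" using Q by simp
  have "transpose_mat Q * S = transpose_mat (S * Q)"
    using transpose_mult[OF Sc Q] St by simp
  then have 3: "transpose_mat Q * S = 1\<^sub>m d" using 1 by simp
  have "transpose_mat Q = transpose_mat Q * (S * Q)" using 1 Qt by simp
  also have "\<dots> = (transpose_mat Q * S) * Q" using Qt Sc Q by (simp add: assoc_mult_mat[of _ d d _ d _ d])
  also have "\<dots> = Q" unfolding 3 using Q by simp
  finally have sym: "transpose_mat Q = Q" .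
  have "0 \<le> u \<bullet> (Q *\<^sub>v u)" if u: "u \<in> carrier_vec d" for u
  proof -
    define z where "z = Q *\<^sub>v u"
    have z: "z \<in> carrier_vec d" using Q u by (simp add: z_def)
    have "S *\<^sub>v z = (S * Q) *\<^sub>v u" unfolding z_def using Sc Q u by simp
    then have "S *\<^sub>v z = u" using u by (simp only: 1 one_mult_mat_vec)
    moreover have "0 \<le> z \<bullet> (S *\<^sub>v z)" using spd_imp_psd[OF S] z by (auto simp: psd_def)
    ultimately have "0 \<le> z \<bullet> u" by simp
    then show ?thesis using comm_scalar_prod[OF z u] by (simp add: z_def)
  qed
  then show ?thesis using Q sym by (simp add: psd_def)
qed

context logit_sample
begin

lemma Mc: "M \<in> carrier_mat d d"
  using M by (simp add: spd_def)

lemma x_add: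
  assumes "i < n" "u \<in> carrier_vec d" "w \<in> carrier_vec d"
  shows "x i \<bullet> (u + w) = x i \<bullet> u + x i \<bullet> w"
  using assms X[OF assms(1)] by (simp add: scalar_prod_add_distrib[of _ d])

lemma x_smult:
  assumes "i < n" "u \<in> carrier_vec d"
  shows "x i \<bullet> (c \<cdot>\<^sub>v u) = c * (x i \<bullet> u)"
  using assms X[OF assms(1)] by simp

text \<open>A crude bound depending on the sample; it furnishes the finiteness required by
  \<open>net_homogeneous_bound\<close>.\<close>

lemma feature_bound:
  assumes cc: "0 \<le> cc" and coord: "\<And>u i. u \<in> carrier_vec d \<Longrightarrow> i < d \<Longrightarrow> \<bar>u $ i\<bar> \<le> cc * vnorm M u"
    and u: "u \<in> carrier_vec d" "vnorm M u \<le> 1"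
  shows "\<bar>x i \<bullet> u\<bar> \<le> (\<Sum>j<d. \<bar>x i $ j\<bar> * cc)"
proof -
  have "\<bar>x i \<bullet> u\<bar> = \<bar>\<Sum>j<d. x i $ j * u $ j\<bar>"
    using u(1) by (simp add: scalar_prod_def atLeast0LessThan)
  also have "\<dots> \<le> (\<Sum>j<d. \<bar>x i $ j\<bar> * \<bar>u $ j\<bar>)"
    by (rule order.trans[OF sum_abs]) (simp add: abs_mult)
  also have "\<dots> \<le> (\<Sum>j<d. \<bar>x i $ j\<bar> * cc)"
  proof (intro sum_mono mult_left_mono)
    fix j assume "j \<in> {..<d}"
    then have "\<bar>u $ j\<bar> \<le> cc * vnorm M u" using coord[OF u(1)] by simp
    also have "\<dots> \<le> cc * 1" using cc u(2) by (intro mult_left_mono)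
    finally show "\<bar>u $ j\<bar> \<le> cc" by simp
  qed simp
  finally show ?thesis .
qed

lemma moments_from_net:
  assumes cc: "0 \<le> cc" and coord: "\<And>u i. u \<in> carrier_vec d \<Longrightarrow> i < d \<Longrightarrow> \<bar>u $ i\<bar> \<le> cc * vnorm M u"
    and W: "W \<subseteq> carrier_vec d"
    and net: "\<And>u. u \<in> carrier_vec d \<Longrightarrow> vnorm M u \<le> 1 \<Longrightarrow> \<exists>w\<in>W. vnorm M (u - w) \<le> 1 / 2"
    and k: "k \<ge> 2" and t: "t > 0"
    and S: "\<And>w. w \<in> W \<Longrightarrow> (\<Sum>i<n. tempered_power k t (x i \<bullet> w)) \<le> (moment_const k + 1) * t\<^sup>2"
    and u: "u \<in> carrier_vec d"
  shows "(\<Sum>i<n. \<bar>x i \<bullet> u\<bar> ^ k) \<le> norm_const k * t ^ k * vnorm M u ^ k"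
proof -
  define D where "D = 4 * (moment_const k + 1)"
  have D: "D \<ge> 1" using moment_const_nonneg[of k] by (simp add: D_def)
  obtain k' where k': "k = Suc k'" using k by (cases k) auto
  have "(\<Sum>i<n. \<bar>x i \<bullet> u\<bar> ^ k) \<le> 2 ^ k * (D ^ (k - 1) * t ^ k) * vnorm M u ^ k"
  proof (rule net_homogeneous_bound[OF M _ W net, where B = "\<Sum>i<n. (\<Sum>j<d. \<bar>x i $ j\<bar> * cc) ^ k"])
    show "1 \<le> k" using k by simp
    show "u \<in> carrier_vec d" by (rule u)
    fix w assume "w \<in> W"
    then show "(\<Sum>i<n. \<bar>x i \<bullet> w\<bar> ^ k) \<le> D ^ (k - 1) * t ^ k"
      using S[of w] by (intro sum_power_le_of_tempered[OF t D k])
        (simp add: D_def algebra_simps)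
  next
    fix u assume "u \<in> carrier_vec d" "vnorm M u \<le> 1"
    then show "(\<Sum>i<n. \<bar>x i \<bullet> u\<bar> ^ k) \<le> (\<Sum>i<n. (\<Sum>j<d. \<bar>x i $ j\<bar> * cc) ^ k)"
      using feature_bound[OF cc coord] by (intro sum_mono power_mono) auto
  next
    fix u w :: "real vec" assume uw: "u \<in> carrier_vec d" "w \<in> carrier_vec d"
    have "(\<Sum>i<n. \<bar>x i \<bullet> (u + w)\<bar> ^ k) \<le> (\<Sum>i<n. 2 ^ (k - 1) * (\<bar>x i \<bullet> u\<bar> ^ k + \<bar>x i \<bullet> w\<bar> ^ k))"
    proof (rule sum_mono)
      fix i assume "i \<in> {..<n}"
      then have "x i \<bullet> (u + w) = x i \<bullet> u + x i \<bullet> w" using x_add uw by simp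
      then show "\<bar>x i \<bullet> (u + w)\<bar> ^ k \<le> 2 ^ (k - 1) * (\<bar>x i \<bullet> u\<bar> ^ k + \<bar>x i \<bullet> w\<bar> ^ k)"
        using abs_add_power_le[of "x i \<bullet> u" "x i \<bullet> w" k'] by (simp only: k' diff_Suc_1)
    qed
    then show "(\<Sum>i<n. \<bar>x i \<bullet> (u + w)\<bar> ^ k) \<le> 2 ^ (k - 1) * ((\<Sum>i<n. \<bar>x i \<bullet> u\<bar> ^ k) + (\<Sum>i<n. \<bar>x i \<bullet> w\<bar> ^ k))"
      by (simp add: sum_distrib_left sum.distrib distrib_left)
  next
    fix u :: "real vec" and c :: real assume "u \<in> carrier_vec d"
    then show "(\<Sum>i<n. \<bar>x i \<bullet> (c \<cdot>\<^sub>v u)\<bar> ^ k) = \<bar>c\<bar> ^ k * (\<Sum>i<n. \<bar>x i \<bullet> u\<bar> ^ k)"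
      unfolding sum_distrib_left by (intro sum.cong refl) (simp add: x_smult abs_mult power_mult_distrib)
  qed
  then show ?thesis by (simp add: norm_const_def D_def mult.assoc)
qed

lemma score_from_net:
  assumes cc: "0 \<le> cc" and coord: "\<And>u i. u \<in> carrier_vec d \<Longrightarrow> i < d \<Longrightarrow> \<bar>u $ i\<bar> \<le> cc * vnorm M u"
    and W: "W \<subseteq> carrier_vec d"
    and net: "\<And>u. u \<in> carrier_vec d \<Longrightarrow> vnorm M u \<le> 1 \<Longrightarrow> \<exists>w\<in>W. vnorm M (u - w) \<le> 1 / 2"
    and S: "\<And>w. w \<in> W \<Longrightarrow> \<bar>\<Sum>i<n. (sigmoid (x i \<bullet> \<beta>) - y i) * (x i \<bullet> w)\<bar> \<le> s"
    and u: "u \<in> carrier_vec d"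
  shows "\<bar>\<Sum>i<n. (sigmoid (x i \<bullet> \<beta>) - y i) * (x i \<bullet> u)\<bar> \<le> 2 * s * vnorm M u"
proof -
  let ?F = "\<lambda>u. \<bar>\<Sum>i<n. (sigmoid (x i \<bullet> \<beta>) - y i) * (x i \<bullet> u)\<bar>"
  have "?F u \<le> 2 ^ 1 * s * vnorm M u ^ 1"
  proof (rule net_homogeneous_bound[OF M _ W net, where B = "\<Sum>i<n. \<Sum>j<d. \<bar>x i $ j\<bar> * cc" and F = ?F])
    show "u \<in> carrier_vec d" by (rule u)
    fix u assume u: "u \<in> carrier_vec d" "vnorm M u \<le> 1"
    have "?F u \<le> (\<Sum>i<n. \<bar>sigmoid (x i \<bullet> \<beta>) - y i\<bar> * \<bar>x i \<bullet> u\<bar>)"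
      by (rule order.trans[OF sum_abs]) (simp add: abs_mult)
    also have "\<dots> \<le> (\<Sum>i<n. 1 * (\<Sum>j<d. \<bar>x i $ j\<bar> * cc))"
    proof (intro sum_mono mult_mono feature_bound[OF cc coord u])
      show "\<bar>sigmoid (x i \<bullet> \<beta>) - y i\<bar> \<le> 1" for i
        using sigmoid_bounds[of "x i \<bullet> \<beta>"] by (cases "snd (\<omega> i)") auto
    qed auto
    finally show "?F u \<le> (\<Sum>i<n. \<Sum>j<d. \<bar>x i $ j\<bar> * cc)" by simp
  next
    fix u w :: "real vec" assume uw: "u \<in> carrier_vec d" "w \<in> carrier_vec d"
    have "(\<Sum>i<n. (sigmoid (x i \<bullet> \<beta>) - y i) * (x i \<bullet> (u + w)))
        = (\<Sum>i<n. (sigmoid (x i \<bullet> \<beta>) - y i) * (x i \<bullet> u)) + (\<Sum>i<n. (sigmoid (x i \<bullet> \<beta>) - y i) * (x i \<bullet> w))"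
      unfolding sum.distrib[symmetric] using uw by (intro sum.cong refl) (simp add: x_add distrib_left)
    then show "?F (u + w) \<le> 2 ^ (1 - 1) * (?F u + ?F w)" by simp
  next
    fix u :: "real vec" and c :: real assume u: "u \<in> carrier_vec d"
    have "(\<Sum>i<n. (sigmoid (x i \<bullet> \<beta>) - y i) * (x i \<bullet> (c \<cdot>\<^sub>v u)))
        = c * (\<Sum>i<n. (sigmoid (x i \<bullet> \<beta>) - y i) * (x i \<bullet> u))"
      unfolding sum_distrib_left using u by (intro sum.cong refl) (simp add: x_smult)
    then show "?F (c \<cdot>\<^sub>v u) = \<bar>c\<bar> ^ 1 * ?F u" by (simp add: abs_mult)
  qed (use S in auto)
  then show ?thesis by simp
qed

text \<open>Absorption works for upper bounds only, so here the mesh must be small relative to the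
  upper constant \<open>G\<close>. For a unit vector the nearby net point has squared norm at least
  1/4, hence energy at least \<open>n / 24\<close>; the difference has energy at most
  \<open>n / 96\<close>. What remains is \<open>(n / 24 - 2 * n / 96) / 2 = n / 96\<close>.\<close>

lemma energy_from_net:
  assumes W: "W \<subseteq> carrier_vec d" and \<epsilon>: "0 \<le> \<epsilon>" "\<epsilon> \<le> 1 / 2" "\<epsilon>\<^sup>2 * G \<le> 1 / 96"
    and net: "\<And>u. u \<in> carrier_vec d \<Longrightarrow> vnorm M u \<le> 1 \<Longrightarrow> \<exists>w\<in>W. vnorm M (u - w) \<le> \<epsilon>"
    and S: "\<And>w. w \<in> W \<Longrightarrow> (vnorm M w)\<^sup>2 * real n / 6 \<le> (\<Sum>i<n. (x i \<bullet> w)\<^sup>2)"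
    and upper: "\<And>u. u \<in> carrier_vec d \<Longrightarrow> (\<Sum>i<n. \<bar>x i \<bullet> u\<bar> ^ 2) \<le> G * real n * vnorm M u ^ 2"
    and G: "0 \<le> G" and u: "u \<in> carrier_vec d"
  shows "real n / 96 * (vnorm M u)\<^sup>2 \<le> (\<Sum>i<n. (x i \<bullet> u)\<^sup>2)"
proof -
  note psd = spd_imp_psd[OF M]
  have one: "real n / 96 \<le> (\<Sum>i<n. (x i \<bullet> u)\<^sup>2)" if u: "u \<in> carrier_vec d" and u1: "vnorm M u = 1" for u
  proof -
    obtain w where w: "w \<in> W" and h: "vnorm M (u - w) \<le> \<epsilon>" using net[OF u] u1 by auto
    have wc: "w \<in> carrier_vec d" using w W by auto
    have hc: "u - w \<in> carrier_vec d" using u wc by simp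
    have h2: "(vnorm M (u - w))\<^sup>2 \<le> \<epsilon>\<^sup>2" by (rule power_mono[OF h psd_vnorm_square(2)[OF psd hc]])
    have "\<epsilon>\<^sup>2 \<le> (1 / 2)\<^sup>2" using \<epsilon> by (intro power_mono) auto
    then have w2: "1 / 4 \<le> (vnorm M w)\<^sup>2"
      using psd_vnorm_square_add_le[OF psd u wc] h2 u1 by (simp add: power_divide)
    then have "real n * (1 / 4) \<le> real n * (vnorm M w)\<^sup>2"
      by (intro mult_left_mono) auto
    then have 1: "real n / 24 \<le> (\<Sum>i<n. (x i \<bullet> w)\<^sup>2)" using S[OF w] by (simp add: mult.commute)
    have "(\<Sum>i<n. (x i \<bullet> (u - w))\<^sup>2) \<le> G * real n * (vnorm M (u - w))\<^sup>2" using upper[OF hc] by simp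
    also have "\<dots> \<le> G * real n * \<epsilon>\<^sup>2" using h2 G by (intro mult_left_mono) auto
    also have "\<dots> = (\<epsilon>\<^sup>2 * G) * real n" by simp
    also have "\<dots> \<le> 1 / 96 * real n" using \<epsilon>(3) by (intro mult_right_mono) auto
    finally have 2: "(\<Sum>i<n. (x i \<bullet> (u - w))\<^sup>2) \<le> real n / 96" by simp
    have "(\<Sum>i<n. (x i \<bullet> w)\<^sup>2) \<le> (\<Sum>i<n. 2 * (x i \<bullet> u)\<^sup>2 + 2 * (x i \<bullet> (u - w))\<^sup>2)"
    proof (rule sum_mono)
      fix i assume "i \<in> {..<n}"
      then have uw: "x i \<bullet> (u - w) = x i \<bullet> u - x i \<bullet> w"
        using X[of i] u wc by (simp add: scalar_prod_minus_distrib[of _ d])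
      have "2 * (x i \<bullet> u)\<^sup>2 + 2 * (x i \<bullet> (u - w))\<^sup>2 - (x i \<bullet> w)\<^sup>2 = (2 * (x i \<bullet> u) - x i \<bullet> w)\<^sup>2"
        unfolding uw by (simp add: power2_eq_square algebra_simps)
      then show "(x i \<bullet> w)\<^sup>2 \<le> 2 * (x i \<bullet> u)\<^sup>2 + 2 * (x i \<bullet> (u - w))\<^sup>2"
        using zero_le_power2[of "2 * (x i \<bullet> u) - x i \<bullet> w"] by linarith
    qed
    then have "(\<Sum>i<n. (x i \<bullet> w)\<^sup>2) \<le> 2 * (\<Sum>i<n. (x i \<bullet> u)\<^sup>2) + 2 * (\<Sum>i<n. (x i \<bullet> (u - w))\<^sup>2)"
      by (simp add: sum.distrib sum_distrib_left)
    then show ?thesis using 1 2 by linarith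
  qed
  show ?thesis
  proof (cases "vnorm M u = 0")
    case True
    then show ?thesis by (simp add: sum_nonneg)
  next
    case False
    define u1 where "u1 = (1 / vnorm M u) \<cdot>\<^sub>v u"
    have p: "vnorm M u > 0" using False psd_vnorm_square(2)[OF psd u] by simp
    have "u1 \<in> carrier_vec d" "vnorm M u1 = 1" using u p vnorm_smult[OF Mc u] by (auto simp: u1_def)
    from one[OF this] have "real n / 96 * (vnorm M u)\<^sup>2 \<le> (\<Sum>i<n. (x i \<bullet> u1)\<^sup>2) * (vnorm M u)\<^sup>2"
      by (intro mult_right_mono) auto
    also have "\<dots> = (\<Sum>i<n. (x i \<bullet> u)\<^sup>2)"
      unfolding sum_distrib_right u1_def using u p
      by (intro sum.cong refl) (simp add: x_smult power_divide power_mult_distrib)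
    finally show ?thesis .
  qed
qed

text \<open>
  Features with \<open>\<bar>x i \<bullet> \<theta>\<bar> > \<tau>\<close> are discarded through \<open>1 - (x i \<bullet> \<theta>)\<^sup>2 / \<tau>\<^sup>2 \<le> 0\<close>; the resulting
  quartic term is absorbed by the fourth moments.
\<close>

lemma curvature_from_moments:
  assumes G: "0 < G" and R: "0 < R"
    and lower: "\<And>u. u \<in> carrier_vec d \<Longrightarrow> real n / 96 * (vnorm M u)\<^sup>2 \<le> (\<Sum>i<n. (x i \<bullet> u)\<^sup>2)"
    and upper: "\<And>u. u \<in> carrier_vec d \<Longrightarrow> (\<Sum>i<n. \<bar>x i \<bullet> u\<bar> ^ 4) \<le> G * real n * vnorm M u ^ 4"
    and \<theta>: "\<theta> \<in> carrier_vec d" "(vnorm M \<theta>)\<^sup>2 \<le> R" and u: "u \<in> carrier_vec d"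
  shows "softplus_deriv 2 (sqrt (192 * G * R)) / 192 * (vnorm M u)\<^sup>2 \<le> curvature \<theta> u"
proof (cases "vnorm M u = 0")
  case True
  then show ?thesis using curvature_nonneg[OF u] by simp
next
  case False
  \<comment> \<open>At this level the bound on the quartic correction is exactly half of the lower
    bound \<open>real n / 96 * (vnorm M u)\<^sup>2\<close>, whence the 192 in the
    conclusion.\<close>
  define \<tau> where "\<tau> = sqrt (192 * G * R)"
  have \<tau>: "0 < \<tau>" "\<tau>\<^sup>2 = 192 * G * R" using G R by (auto simp: \<tau>_def)
  define N where "N = vnorm M u"
  have N: "N > 0" using False psd_vnorm_square(2)[OF spd_imp_psd[OF M] u] by (simp add: N_def)
  \<comment> \<open>The weight in the arithmetic-geometric mean inequality, chosen so that both sums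
    of fourth powers receive the same bound.\<close>
  define l where "l = R / N\<^sup>2"
  have l: "l > 0" using R N by (simp add: l_def)
  have amgm: "a\<^sup>2 * b\<^sup>2 \<le> (l * \<bar>a\<bar> ^ 4 + \<bar>b\<bar> ^ 4 / l) / 2" for a b :: real
  proof -
    have e: "\<bar>a\<bar> ^ 4 = (a\<^sup>2)\<^sup>2" "\<bar>b\<bar> ^ 4 = (b\<^sup>2)\<^sup>2" by (simp_all add: power_mult[symmetric])
    have "0 \<le> (l * a\<^sup>2 - b\<^sup>2)\<^sup>2 / (2 * l)" using l by simp
    also have "\<dots> = (l * (a\<^sup>2)\<^sup>2 + (b\<^sup>2)\<^sup>2 / l) / 2 - a\<^sup>2 * b\<^sup>2"
      using l by (simp add: power2_eq_square field_simps)
    finally show ?thesis unfolding e by simp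
  qed
  have "(\<Sum>i<n. (x i \<bullet> u)\<^sup>2 * (x i \<bullet> \<theta>)\<^sup>2) \<le> (\<Sum>i<n. (l * \<bar>x i \<bullet> u\<bar> ^ 4 + \<bar>x i \<bullet> \<theta>\<bar> ^ 4 / l) / 2)"
    by (intro sum_mono amgm)
  also have "\<dots> = (l * (\<Sum>i<n. \<bar>x i \<bullet> u\<bar> ^ 4) + (\<Sum>i<n. \<bar>x i \<bullet> \<theta>\<bar> ^ 4) / l) / 2"
    by (simp add: sum.distrib sum_distrib_left sum_divide_distrib add_divide_distrib)
  also have "\<dots> \<le> (l * (G * real n * N ^ 4) + (G * real n * R\<^sup>2) / l) / 2"
  proof -
    have "vnorm M \<theta> ^ 4 \<le> R\<^sup>2"
      using power_mono[OF \<theta>(2), of 2] by (simp add: power_mult[symmetric])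
    then have "G * real n * vnorm M \<theta> ^ 4 \<le> G * real n * R\<^sup>2" using G by (intro mult_left_mono) auto
    then show ?thesis
      using upper[OF u] upper[OF \<theta>(1)] l unfolding N_def
      by (intro divide_right_mono add_mono mult_left_mono) auto
  qed
  also have "\<dots> = G * real n * R * N\<^sup>2"
    using R N by (simp add: l_def power2_eq_square power4_eq_xxxx field_simps)
  finally have cross: "(\<Sum>i<n. (x i \<bullet> u)\<^sup>2 * (x i \<bullet> \<theta>)\<^sup>2) \<le> G * real n * R * N\<^sup>2" .
  let ?p = "softplus_deriv 2 \<tau>"
  have p: "?p > 0" by (rule softplus_deriv2_bounds)
  have pt: "?p * (1 - s\<^sup>2 / \<tau>\<^sup>2) \<le> softplus_deriv 2 s" for s
  proof (cases "\<bar>s\<bar> \<le> \<tau>")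
    case True
    have "?p * (1 - s\<^sup>2 / \<tau>\<^sup>2) \<le> ?p * 1" using p by (intro mult_left_mono) auto
    then show ?thesis using softplus_deriv2_bounds(2)[OF True] by linarith
  next
    case False
    then have "\<tau>\<^sup>2 \<le> \<bar>s\<bar>\<^sup>2" using \<tau> by (intro power_mono) auto
    then have "1 - s\<^sup>2 / \<tau>\<^sup>2 \<le> 0" using \<tau>(1) by simp
    then have "?p * (1 - s\<^sup>2 / \<tau>\<^sup>2) \<le> 0" using p by (simp add: mult_nonneg_nonpos)
    then show ?thesis using softplus_deriv2_bounds(1)[of s] by linarith
  qed
  have "?p / 192 * N\<^sup>2 * real n = ?p * (real n / 96 * N\<^sup>2 - G * real n * R * N\<^sup>2 / \<tau>\<^sup>2)"
    unfolding \<tau>(2) using G R by (simp add: field_simps)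
  also have "\<dots> \<le> ?p * ((\<Sum>i<n. (x i \<bullet> u)\<^sup>2) - (\<Sum>i<n. (x i \<bullet> u)\<^sup>2 * (x i \<bullet> \<theta>)\<^sup>2) / \<tau>\<^sup>2)"
    using p lower[OF u] cross unfolding N_def
    by (intro mult_left_mono diff_mono divide_right_mono) auto
  also have "\<dots> = (\<Sum>i<n. ?p * (1 - (x i \<bullet> \<theta>)\<^sup>2 / \<tau>\<^sup>2) * (x i \<bullet> u)\<^sup>2)"
    by (simp add: sum_distrib_left sum_divide_distrib sum_subtractf algebra_simps)
  also have "\<dots> \<le> (\<Sum>i<n. softplus_deriv 2 (x i \<bullet> \<theta>) * (x i \<bullet> u)\<^sup>2)"
    by (intro sum_mono mult_right_mono pt) auto
  also have "\<dots> \<le> curvature \<theta> u * real n"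
    using Q u n by (simp add: curvature_def psd_def del: softplus_deriv.simps)
  finally show ?thesis using n unfolding \<tau>_def N_def by simp
qed

text \<open>The derivative bounds are given in the norm of \<open>M\<close>. Since the Hessian at
  the minimizer dominates \<open>c\<close> times \<open>M\<close>, its unit vectors have
  \<open>vnorm M u \<le> 1 / sqrt c\<close>, which accounts for the division by
  \<open>sqrt c ^ k\<close>. The last hypothesis is the smallness condition of
  \<open>linear_growth\<close> for \<open>a = 4 * sqrt (real d / real n)\<close>.\<close>

lemma posterior_geometry:
  assumes c: "0 < c" and cc: "0 \<le> cc"
    and coord: "\<And>u i. u \<in> carrier_vec d \<Longrightarrow> i < d \<Longrightarrow> \<bar>u $ i\<bar> \<le> cc * vnorm M u"
    and hess: "\<And>\<theta> u. \<theta> \<in> carrier_vec d \<Longrightarrow> vnorm M (\<theta> - \<beta>) \<le> 1 \<Longrightarrow> u \<in> carrier_vec d \<Longrightarrow>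
      c * (vnorm M u)\<^sup>2 \<le> curvature \<theta> u"
    and lower: "\<And>u. u \<in> carrier_vec d \<Longrightarrow> real n / 96 * (vnorm M u)\<^sup>2 \<le> (\<Sum>i<n. (x i \<bullet> u)\<^sup>2)"
    and grad: "\<And>u. u \<in> carrier_vec d \<Longrightarrow> \<bar>slope \<beta> u\<bar> \<le> c / 4 * vnorm M u"
    and tensor: "\<And>k b u. k \<in> {3, 4, 5} \<Longrightarrow> b \<in> carrier_vec d \<Longrightarrow> u \<in> carrier_vec d \<Longrightarrow>
      \<bar>tensor_pow_inner d k (nabla d v b) u\<bar> \<le> T k * vnorm M u ^ k"
    and T0: "\<And>k. k \<in> {3, 4, 5} \<Longrightarrow> 0 \<le> T k"
    and U: "\<And>k. k \<in> {3, 4, 5} \<Longrightarrow> T k / sqrt c ^ k \<le> U k"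
    and a: "4 * sqrt (real d / real n) * T 3 \<le> 3 / 2 * (c * sqrt c)"
  shows "\<exists>b\<^sub>0. is_arg_min v (\<lambda>b. b \<in> carrier_vec d) b\<^sub>0 \<and>
      (\<forall>b. is_arg_min v (\<lambda>b. b \<in> carrier_vec d) b \<longrightarrow> b = b\<^sub>0) \<and>
      (let H = hessian d v b\<^sub>0 in
         loewner_le d (c \<cdot>\<^sub>m M) H \<and>
         (\<forall>k\<in>{3, 4, 5}. (SUP b\<in>carrier_vec d. ereal (tensor_norm d k H (nabla d v b))) \<le> ereal (U k)) \<and>
         (\<forall>b\<in>carrier_vec d. vnorm H (b - b\<^sub>0) > 4 * sqrt (real d / real n) \<longrightarrow>
            v b - v b\<^sub>0 \<ge> sqrt (real d / real n) * vnorm H (b - b\<^sub>0)))"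
proof -
  \<comment> \<open>Holds at every \<open>b\<close>, even for the flat prior: the energy bound
    yields a feature not orthogonal to \<open>u\<close>, and all Hessian weights are
    positive.\<close>
  have pos: "0 < curvature b u" if u: "u \<in> carrier_vec d" and ne: "u \<noteq> 0\<^sub>v d" for b u
  proof -
    have "0 < real n / 96 * (vnorm M u)\<^sup>2" using spd_vnorm_pos[OF M u ne] n by simp
    then have S: "0 < (\<Sum>i<n. (x i \<bullet> u)\<^sup>2)" using lower[OF u] by linarith
    have "\<exists>i<n. x i \<bullet> u \<noteq> 0"
    proof (rule ccontr)
      assume "\<not> ?thesis"
      then have "(\<Sum>i<n. (x i \<bullet> u)\<^sup>2) = 0" by (intro sum.neutral) auto
      then show False using S by simp
    qed
    then obtain i where i: "i < n" "x i \<bullet> u \<noteq> 0" by blast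
    have "0 < softplus_deriv 2 (x i \<bullet> b) * (x i \<bullet> u)\<^sup>2" using i softplus_deriv2_bounds(1) by simp
    also have "\<dots> \<le> (\<Sum>i<n. softplus_deriv 2 (x i \<bullet> b) * (x i \<bullet> u)\<^sup>2)"
      using i softplus_deriv2_bounds(1) by (intro member_le_sum) (auto simp: less_imp_le)
    finally have "0 < (\<Sum>i<n. softplus_deriv 2 (x i \<bullet> b) * (x i \<bullet> u)\<^sup>2)" .
    then show ?thesis
      using Q u n by (auto simp: curvature_def psd_def add_pos_nonneg simp del: softplus_deriv.simps)
  qed
  obtain b0 where b0: "b0 \<in> carrier_vec d" and b01: "vnorm M (b0 - \<beta>) \<le> 1"
    and slope0: "\<And>h. h \<in> carrier_vec d \<Longrightarrow> slope b0 h = 0"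
    and min: "\<And>b. b \<in> carrier_vec d \<Longrightarrow> b \<noteq> b0 \<Longrightarrow> v b0 < v b"
    by (rule minimizer_exists[OF c coord cc hess grad pos]) blast+
  let ?H = "hessian d v b0"
  note hess0 = hess[OF b0 b01]
  have spdH: "spd d ?H"
    using hessian_carrier hessian_symmetric[OF b0] hessian_quad_form[OF b0] pos by (auto simp: spd_def)
  have "is_arg_min v (\<lambda>b. b \<in> carrier_vec d) b0"
    using b0 min by (force simp: is_arg_min_def)
  moreover have "\<forall>b. is_arg_min v (\<lambda>b. b \<in> carrier_vec d) b \<longrightarrow> b = b0"
    using b0 min by (force simp: is_arg_min_def)
  moreover have "loewner_le d (c \<cdot>\<^sub>m M) ?H"
  proof -
    have cM: "c \<cdot>\<^sub>m M \<in> carrier_mat d d" using Mc by simp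
    have Mt: "transpose_mat M = M" using M by (simp add: spd_def)
    have "transpose_mat (?H - c \<cdot>\<^sub>m M) = ?H - c \<cdot>\<^sub>m M"
    proof (rule eq_matI)
      fix i j assume "i < dim_row (?H - c \<cdot>\<^sub>m M)" "j < dim_col (?H - c \<cdot>\<^sub>m M)"
      then have ij: "i < d" "j < d" using Mc by auto
      have "?H $$ (j, i) = transpose_mat ?H $$ (i, j)" using hessian_carrier[of b0] ij by simp
      moreover have "M $$ (j, i) = transpose_mat M $$ (i, j)" using Mc ij by simp
      ultimately show "transpose_mat (?H - c \<cdot>\<^sub>m M) $$ (i, j) = (?H - c \<cdot>\<^sub>m M) $$ (i, j)"
        using ij hessian_carrier[of b0] Mc Mt hessian_symmetric[OF b0] by simp
    qed (use hessian_carrier[of b0] Mc in auto)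
    moreover have "0 \<le> u \<bullet> ((?H - c \<cdot>\<^sub>m M) *\<^sub>v u)" if u: "u \<in> carrier_vec d" for u
    proof -
      have "(?H - c \<cdot>\<^sub>m M) *\<^sub>v u = ?H *\<^sub>v u - c \<cdot>\<^sub>v (M *\<^sub>v u)"
      proof -
        have "(c \<cdot>\<^sub>m M) *\<^sub>v u = c \<cdot>\<^sub>v (M *\<^sub>v u)"
          using Mc u by (intro eq_vecI) auto
        then show ?thesis
          using hessian_carrier[of b0] Mc u by (simp add: minus_mult_distrib_mat_vec[of _ d d])
      qed
      then have "u \<bullet> ((?H - c \<cdot>\<^sub>m M) *\<^sub>v u) = u \<bullet> (?H *\<^sub>v u) - c * (u \<bullet> (M *\<^sub>v u))"
        using u Mc hessian_carrier[of b0] by (simp add: scalar_prod_minus_distrib[of _ d])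
      then show ?thesis
        using hess0[OF u] hessian_quad_form[OF b0 u] psd_vnorm_square(1)[OF spd_imp_psd[OF M] u] by simp
    qed
    ultimately show ?thesis
      using minus_carrier_mat[OF cM, of ?H] by (auto simp: loewner_le_def psd_def)
  qed
  moreover have "(SUP b\<in>carrier_vec d. ereal (tensor_norm d k ?H (nabla d v b))) \<le> ereal (U k)"
    if k: "k \<in> {3, 4, 5}" for k
  proof (rule SUP_least)
    fix b :: "real vec" assume b: "b \<in> carrier_vec d"
    have "tensor_norm d k ?H (nabla d v b) \<le> T k / sqrt c ^ k"
    proof (rule tensor_norm_le[OF d spdH])
      fix u assume u: "u \<in> carrier_vec d" and u1: "vnorm ?H u = 1"
      have "curvature b0 u = 1" using u1 hessian_vnorm[OF b0 u] by simp
      then have "(sqrt c * vnorm M u)\<^sup>2 \<le> 1\<^sup>2" using hess0[OF u] c by (simp add: power_mult_distrib)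
      then have "sqrt c * vnorm M u \<le> 1" by (rule power2_le_imp_le) simp
      then have "vnorm M u \<le> 1 / sqrt c" using c by (simp add: field_simps)
      then have "vnorm M u ^ k \<le> (1 / sqrt c) ^ k"
        using psd_vnorm_square(2)[OF spd_imp_psd[OF M] u] by (intro power_mono)
      then have "T k * vnorm M u ^ k \<le> T k * (1 / sqrt c) ^ k" using T0[OF k] by (intro mult_left_mono)
      then show "\<bar>tensor_pow_inner d k (nabla d v b) u\<bar> \<le> T k / sqrt c ^ k"
        using tensor[OF k b u] by (simp add: power_divide)
    qed
    then show "ereal (tensor_norm d k ?H (nabla d v b)) \<le> ereal (U k)" using U[OF k] by simp
  qed
  moreover have "v b - v b0 \<ge> sqrt (real d / real n) * vnorm ?H (b - b0)"
    if b: "b \<in> carrier_vec d" and L: "vnorm ?H (b - b0) > 4 * sqrt (real d / real n)" for b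
  proof -
    have third: "\<bar>third b h\<bar> \<le> T 3 * vnorm M h ^ 3" if "b \<in> carrier_vec d" "h \<in> carrier_vec d" for b h
      using tensor[of 3 b h] nabla_inner[of b h 3] that by (simp add: third_def del: softplus_deriv.simps)
    have "0 < 4 * sqrt (real d / real n)" using d n by simp
    from linear_growth[OF b0 slope0 c hess0 _ third this a b L] T0[of 3]
    show ?thesis by simp
  qed
  ultimately show ?thesis
    unfolding Let_def by blast
qed

end

subsection \<open>Choice of the constants\<close>

lemma radius_power_le:
  fixes n d k :: nat and B :: real
  assumes "k \<ge> 1" "B \<ge> 0"
  shows "(root k (real n) + B * sqrt (real d)) ^ k \<le> 2 ^ (k - 1) * (real n + (B * sqrt (real d)) ^ k)"
proof -
  obtain j where j: "k = Suc j" using assms(1) by (cases k) auto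
  have "root k (real n) ^ k = real n" using assms(1) by simp
  then show ?thesis
    using abs_add_power_le[of "root k (real n)" "B * sqrt (real d)" j] assms
    by (simp only: j diff_Suc_1) simp
qed

text \<open>By the choice of \<open>B\<close> the moment terms have exponent at most
  \<open>- (real d + \<rho>\<^sup>2)\<close> with \<rho> the \<open>k\<close>-th root of
  \<open>n\<close>, and \<open>\<rho>\<^sup>2 \<ge> 2 * ln \<rho> \<ge> 2 / 5 * ln (real n)\<close>
  as \<open>k \<le> 5\<close>. In the score term half of the exponent
  \<open>real n * \<eta>\<^sup>2 / 576\<close> pays for the net, which explains 1152. The factor 7 =
  4 + 1 + 2 counts the events per net point.\<close>

lemma failure_probability_le:
  fixes n d :: nat and B K \<eta> :: real
  assumes d: "1 \<le> d" and n: "1 \<le> n" and K: "1 \<le> K" and B: "B\<^sup>2 = ln K + 1" "0 \<le> B"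
    and \<eta>: "0 < \<eta>" "\<eta> \<le> 1" and dn: "real d * B\<^sup>2 \<le> \<eta>\<^sup>2 / 1152 * real n"
  shows "K ^ d * ((\<Sum>k=2..5. exp (- (root k (real n) + B * sqrt (real d))\<^sup>2))
      + exp (- real n / 4) + 2 * exp (- (real n * \<eta>\<^sup>2 / 576)))
    \<le> 7 * exp (- (\<eta>\<^sup>2 / 1152) * max (sqrt (real d)) (ln (real n)))"
proof -
  define m where "m = max (sqrt (real d)) (ln (real n))"
  let ?e = "\<eta>\<^sup>2 / 1152"
  have \<eta>2: "\<eta>\<^sup>2 \<le> 1" using \<eta> by (simp add: power_le_one)
  have lnK: "0 \<le> ln K" using K by simp
  have Kd: "K ^ d = exp (real d * ln K)"
    using K by (simp add: exp_of_nat_mult)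
  have sd: "sqrt (real d) \<le> real d"
    using d by (intro real_le_lsqrt) (auto simp: power2_eq_square)
  have lnn: "0 \<le> ln (real n)" "ln (real n) \<le> real n" using n ln_le_minus_one[of "real n"] by auto
  have dl: "real d * ln K + real d \<le> ?e * real n" using dn unfolding B(1) by (simp add: distrib_left)
  have "?e * real n \<le> 1 * real n" using \<eta>2 by (intro mult_right_mono) auto
  moreover have "0 \<le> real d * ln K" using lnK by simp
  ultimately have d_le: "real d \<le> real n" using dl by linarith
  have m0: "0 \<le> m" and mn: "m \<le> real n" using lnn sd d_le by (auto simp: m_def)
  have em: "?e * m \<le> ?e * real n" using mn by (intro mult_left_mono) auto
  have e1: "?e * m \<le> real d + 2 / 5 * ln (real n)"
  proof -
    have "?e * m \<le> 2 / 5 * m" using \<eta>2 m0 by (intro mult_right_mono) auto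
    also have "\<dots> \<le> real d + 2 / 5 * ln (real n)" using sd lnn d unfolding m_def by (auto simp: max_def)
    finally show ?thesis .
  qed
  have t1: "K ^ d * exp (- (root k (real n) + B * sqrt (real d))\<^sup>2) \<le> exp (- ?e * m)" if k: "k \<in> {2..5}" for k
  proof -
    define \<rho> where "\<rho> = root k (real n)"
    have \<rho>: "\<rho> > 0" using k n by (simp add: \<rho>_def)
    have "ln \<rho> = ln (real n) / real k" using k n by (simp add: \<rho>_def ln_root)
    moreover have "ln (real n) / real k \<ge> ln (real n) / 5" using k lnn by (intro divide_left_mono) auto
    moreover have "2 * ln \<rho> \<le> \<rho>\<^sup>2"
      using ln_le_minus_one[OF \<rho>] zero_le_power2[of "\<rho> - 1"] by (simp add: power2_diff)
    ultimately have "2 / 5 * ln (real n) \<le> \<rho>\<^sup>2" by linarith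
    moreover have "(\<rho> + B * sqrt (real d))\<^sup>2 \<ge> \<rho>\<^sup>2 + B\<^sup>2 * real d"
      using \<rho> B(2) by (simp add: power2_sum power_mult_distrib)
    ultimately have "real d * ln K - (\<rho> + B * sqrt (real d))\<^sup>2 \<le> - (real d + 2 / 5 * ln (real n))"
      unfolding B(1) by (simp add: algebra_simps)
    then have "exp (real d * ln K - (\<rho> + B * sqrt (real d))\<^sup>2) \<le> exp (- ?e * m)"
      using e1 by simp
    then show ?thesis unfolding Kd \<rho>_def[symmetric] by (simp add: exp_add[symmetric])
  qed
  have t2: "K ^ d * exp (- real n / 4) \<le> exp (- ?e * m)"
  proof -
    have "?e * real n \<le> 1 / 8 * real n" using \<eta>2 by (intro mult_right_mono) auto
    then have "real d * ln K - real n / 4 \<le> - ?e * m" using dl em by linarith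
    then show ?thesis unfolding Kd by (simp add: exp_add[symmetric])
  qed
  have t3: "K ^ d * exp (- (real n * \<eta>\<^sup>2 / 576)) \<le> exp (- ?e * m)"
  proof -
    have "real n * \<eta>\<^sup>2 / 576 = 2 * (?e * real n)" by simp
    then have "real d * ln K - real n * \<eta>\<^sup>2 / 576 \<le> - ?e * m" using dl em by linarith
    then show ?thesis unfolding Kd by (simp add: exp_add[symmetric])
  qed
  have "(\<Sum>k=2..5. K ^ d * exp (- (root k (real n) + B * sqrt (real d))\<^sup>2)) \<le> (\<Sum>k::nat=2..5. exp (- ?e * m))"
    by (intro sum_mono t1)
  also have "\<dots> = 4 * exp (- ?e * m)" by simp
  finally show ?thesis
    using t2 t3 unfolding distrib_left sum_distrib_left m_def[symmetric] by linarith
qed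

text \<open>Quantifying the constants before \<open>d\<close>, \<open>n\<close> and \<open>M\<close>
  expresses that they depend on \<open>vnorm M \<beta>\<close> alone. The set \<open>E\<close> is a
  measurable part of the intersection of the three events. The supremum over \<open>b\<close> is
  taken in \<open>ereal\<close>, so that its bound includes finiteness.\<close>

theorem proposition5p3:
  "\<exists>C > (0::real). \<exists>C\<^sub>1 C\<^sub>2 C\<^sub>3 C\<^sub>4 C\<^sub>5 :: real \<Rightarrow> real.
     (\<forall>r. 0 < C\<^sub>1 r \<and> 0 < C\<^sub>2 r \<and> 0 < C\<^sub>3 r \<and> 0 < C\<^sub>4 r \<and> 0 < C\<^sub>5 r) \<and>
     (\<forall>(d::nat) (n::nat) (M::real mat) (\<beta>::real vec) (Q::real mat) (\<mu>::real vec measure).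
        1 \<le> d \<longrightarrow> 1 \<le> n \<longrightarrow> spd d M \<longrightarrow> \<beta> \<in> carrier_vec d \<longrightarrow>
        prior_precision d Q \<longrightarrow> gaussian_law d M \<mu> \<longrightarrow>
        mat_norm d M Q \<le> C\<^sub>1 (vnorm M \<beta>) * real n \<longrightarrow>
        max (sqrt (real d)) (ln (2 * real n)) * sqrt (real d / real n) \<le> min (C\<^sub>2 (vnorm M \<beta>)) 1 \<longrightarrow>
        (\<exists>E \<in> sets (sample_law n \<mu> \<beta>).
           measure (sample_law n \<mu> \<beta>) E
             \<ge> 1 - C * exp (- C\<^sub>3 (vnorm M \<beta>) * max (sqrt (real d)) (ln (real n))) \<and>
           (\<forall>\<omega>\<in>E. let v = scaled_nlp n Q \<omega> in
              \<exists>b\<^sub>0. is_arg_min v (\<lambda>b. b \<in> carrier_vec d) b\<^sub>0 \<and>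
                (\<forall>b. is_arg_min v (\<lambda>b. b \<in> carrier_vec d) b \<longrightarrow> b = b\<^sub>0) \<and>
                (let H = hessian d v b\<^sub>0 in
                   loewner_le d (C\<^sub>4 (vnorm M \<beta>) \<cdot>\<^sub>m M) H \<and>
                   (\<forall>k\<in>{3, 4, 5}.
                      (SUP b\<in>carrier_vec d. ereal (tensor_norm d k H (nabla d v b)))
                        \<le> ereal (C\<^sub>5 (vnorm M \<beta>) * max (real d powr (real k / 2) / real n) 1)) \<and>
                   (\<forall>b\<in>carrier_vec d. vnorm H (b - b\<^sub>0) > 4 * sqrt (real d / real n) \<longrightarrow>
                      v b - v b\<^sub>0 \<ge> sqrt (real d / real n) * vnorm H (b - b\<^sub>0))))))"
proof -
  \<comment> \<open>Once \<open>t k ^ k \<le> 2 ^ k * real n\<close> is known for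
    \<open>k \<le> 4\<close>, this is the moment constant per observation. It involves neither
    \<open>K\<close> nor \<open>B\<close>, so the mesh can be chosen from it.\<close>
  define G where "G = (\<lambda>k. 2 ^ k * norm_const k)"
  have G: "1 \<le> G k" for k
    using norm_const_ge[of k] mult_mono[of 1 "2 ^ k" 1 "norm_const k"] by (simp add: G_def)
  define \<epsilon> where "\<epsilon> = 1 / sqrt (96 * G 2)"
  have G2: "0 < G 2" using G[of 2] by linarith
  have \<epsilon>: "0 < \<epsilon>" "\<epsilon>\<^sup>2 * G 2 \<le> 1 / 96" "\<epsilon> \<le> 1 / 2"
  proof -
    show "0 < \<epsilon>" using G2 by (simp add: \<epsilon>_def)
    show "\<epsilon>\<^sup>2 * G 2 \<le> 1 / 96" using G2 by (simp add: \<epsilon>_def power_divide)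
    have "2 \<le> sqrt (96 * G 2)" using G[of 2] by (intro real_le_rsqrt) simp
    then show "\<epsilon> \<le> 1 / 2" unfolding \<epsilon>_def using G2 by (intro divide_left_mono) auto
  qed
  obtain K :: real where K: "1 \<le> K" and nets: "\<And>d M A. 1 \<le> d \<Longrightarrow> spd d M \<Longrightarrow> A \<in> carrier_mat d d \<Longrightarrow>
      A * transpose_mat A = M \<Longrightarrow> \<exists>W. finite W \<and> W \<subseteq> carrier_vec d \<and> real (card W) \<le> K ^ d \<and>
      (\<forall>u\<in>carrier_vec d. vnorm M u \<le> 1 \<longrightarrow> (\<exists>w\<in>W. vnorm M w \<le> 1 \<and> vnorm M (u - w) \<le> \<epsilon>))"
    using elliptic_net[OF \<epsilon>(1)] by blast
  define B where "B = sqrt (ln K + 1)"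
  have B2: "B\<^sup>2 = ln K + 1" and B1: "1 \<le> B" using K by (auto simp: B_def)
  have "\<forall>k. \<exists>b. \<forall>t. \<bar>softplus_deriv (Suc k) t\<bar> \<le> b" using softplus_deriv_bounded by blast
  then obtain bd' where bd': "\<And>k t. \<bar>softplus_deriv (Suc k) t\<bar> \<le> bd' k" by metis
  define bd where "bd = (\<lambda>k. bd' (k - 1))"
  have bd: "\<bar>softplus_deriv k t\<bar> \<le> bd k" if "k \<ge> 1" for k t
    using bd'[of "k - 1" t] that by (simp add: bd_def del: softplus_deriv.simps)
  have bd0: "0 \<le> bd k" if "k \<ge> 1" for k
    using bd[OF that, of 0] by linarith
  \<comment> \<open>The constant of \<open>curvature_from_moments\<close> with
    \<open>R = 2 * r\<^sup>2 + 2\<close>, which bounds the squared norm of every point within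
    distance 1 of \<beta>.\<close>
  define c where "c = (\<lambda>r. softplus_deriv 2 (sqrt (192 * G 4 * (2 * r\<^sup>2 + 2))) / 192)"
  have c0: "0 < c r" for r
    using softplus_deriv2_bounds(1) by (simp add: c_def del: softplus_deriv.simps)
  have c1: "c r \<le> 1" for r
  proof -
    have "sigmoid t * (1 - sigmoid t) \<le> 1 * 1" for t
      using sigmoid_bounds[of t] by (intro mult_mono) auto
    then show ?thesis
      by (simp add: c_def softplus_deriv_simps order.trans[of _ 1] del: softplus_deriv.simps)
  qed
  \<comment> \<open>The slope at \<beta> may be at most \<open>c r / 4\<close>: the score uses
    \<open>2 * \<eta> r = c r / 8\<close>, the prior the other half through
    \<open>C1\<close>.\<close>
  define \<eta> where "\<eta> = (\<lambda>r. c r / 16)"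
  have \<eta>: "0 < \<eta> r" "\<eta> r \<le> 1" for r using c0[of r] c1[of r] by (auto simp: \<eta>_def)
  define g where "g = bd 3 * G 3"
  have g: "0 \<le> g" using bd0[of 3] G[of 3] by (simp add: g_def)
  define S where "S = 1 + (\<Sum>k\<in>{3, 4, 5}. bd k * norm_const k)"
  have S: "bd k * norm_const k \<le> S" if "k \<in> {3, 4, 5}" for k
  proof -
    have "bd k * norm_const k \<le> (\<Sum>k\<in>{3, 4, 5}. bd k * norm_const k)"
      using that bd0 norm_const_ge by (intro member_le_sum mult_nonneg_nonneg) (auto intro: order.trans[OF zero_le_one])
    then show ?thesis by (simp only: S_def)
  qed
  have S0: "0 < S"
    using bd0 norm_const_ge unfolding S_def
    by (intro add_pos_nonneg sum_nonneg mult_nonneg_nonneg) (auto intro: order.trans[OF zero_le_one])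
  \<comment> \<open>The absolute value keeps \<open>C1\<close> positive at every real argument; for
    nonnegative \<open>r\<close> it gives \<open>C1 r * r \<le> c r / 8\<close>.\<close>
  define C1 where "C1 = (\<lambda>r. c r / (8 * (\<bar>r\<bar> + 1)))"
  \<comment> \<open>The three bounds serve, in this order:
    \<open>B ^ 4 * (real d)\<^sup>2 \<le> real n\<close> for the moments, the net against the
    probability of the score event, and the Taylor remainder at radius
    \<open>4 * sqrt (real d / real n)\<close>.\<close>
  define C2 where "C2 = (\<lambda>r. min (1 / B\<^sup>2) (min (\<eta> r / (40 * B)) (c r * sqrt (c r) / (4 * (g + 1)))))"
  define C3 where "C3 = (\<lambda>r. (\<eta> r)\<^sup>2 / 1152)"
  \<comment> \<open>In 32 = 16 * 2, the 16 bounds \<open>2 ^ (k - 1)\<close> and the 2 counts the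
    summands \<open>n\<close> and \<open>d\<close> to the power \<open>k / 2\<close>, each at most
    \<open>n\<close> times the maximum. As \<open>B \<ge> 1\<close> and \<open>c r \<le> 1\<close>,
    the exponent 5 serves all three orders.\<close>
  define C5 where "C5 = (\<lambda>r. 32 * S * B ^ 5 / sqrt (c r) ^ 5)"
  have pos: "0 < C1 r \<and> 0 < C2 r \<and> 0 < C3 r \<and> 0 < c r \<and> 0 < C5 r" for r
    using c0[of r] \<eta>[of r] B1 g S0 by (auto simp: C1_def C2_def C3_def C5_def add_nonneg_pos)
  show ?thesis
  proof (rule exI[of _ 7], rule conjI, simp, rule exI[of _ C1], rule exI[of _ C2], rule exI[of _ C3],
      rule exI[of _ c], rule exI[of _ C5], rule conjI, use pos in blast, intro allI impI)
    fix d n :: nat and M Q :: "real mat" and \<beta> :: "real vec" and \<mu> :: "real vec measure"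
    assume d: "1 \<le> d" and n: "1 \<le> n" and M: "spd d M" and beta: "\<beta> \<in> carrier_vec d"
      and prior: "prior_precision d Q" and gauss: "gaussian_law d M \<mu>"
      and Qn: "mat_norm d M Q \<le> C1 (vnorm M \<beta>) * real n"
      and small: "max (sqrt (real d)) (ln (2 * real n)) * sqrt (real d / real n) \<le> min (C2 (vnorm M \<beta>)) 1"
    define r where "r = vnorm M \<beta>"
    have r: "0 \<le> r" unfolding r_def by (rule psd_vnorm_square(2)[OF spd_imp_psd[OF M] beta])
    have Q: "psd d Q" by (rule prior_precision_psd[OF prior])
    have sqd: "1 \<le> sqrt (real d)" using d by simp
    have dn0: "0 \<le> sqrt (real d / real n)" by simp
    have ds: "sqrt (real d) * sqrt (real d / real n) \<le> C2 r"
    proof -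
      have "sqrt (real d) * sqrt (real d / real n) \<le> max (sqrt (real d)) (ln (2 * real n)) * sqrt (real d / real n)"
        by (intro mult_right_mono) auto
      then show ?thesis using small by (simp add: r_def)
    qed
    have sdn: "sqrt (real d / real n) \<le> C2 r"
      using ds mult_right_mono[OF sqd dn0] by simp
    have C2: "C2 r * B\<^sup>2 \<le> 1" "C2 r * B \<le> \<eta> r / 40" "4 * C2 r * (g + 1) \<le> c r * sqrt (c r)"
    proof -
      have "C2 r \<le> 1 / B\<^sup>2" "C2 r \<le> \<eta> r / (40 * B)" "C2 r \<le> c r * sqrt (c r) / (4 * (g + 1))"
        by (auto simp: C2_def)
      then show "C2 r * B\<^sup>2 \<le> 1" "C2 r * B \<le> \<eta> r / 40" "4 * C2 r * (g + 1) \<le> c r * sqrt (c r)"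
        using B1 g by (auto simp: field_simps)
    qed
    have d2: "(real d)\<^sup>2 \<le> (C2 r)\<^sup>2 * real n"
    proof -
      have "(sqrt (real d) * sqrt (real d / real n))\<^sup>2 \<le> (C2 r)\<^sup>2"
        using ds by (intro power_mono) auto
      moreover have "(sqrt (real d) * sqrt (real d / real n))\<^sup>2 = (real d)\<^sup>2 / real n"
        by (simp add: power_mult_distrib) (simp add: power2_eq_square)
      ultimately show ?thesis using n by (simp add: pos_divide_le_eq)
    qed
    have C20: "0 \<le> C2 r" using pos[of r] by simp
    have B4: "B ^ 4 * (real d)\<^sup>2 \<le> real n"
    proof -
      have "B ^ 4 * (real d)\<^sup>2 \<le> B ^ 4 * ((C2 r)\<^sup>2 * real n)" using d2 by (intro mult_left_mono) auto
      also have "\<dots> = (C2 r * B\<^sup>2)\<^sup>2 * real n" by (simp add: power_mult_distrib power_mult[symmetric])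
      also have "\<dots> \<le> 1 * real n" using C2(1) C20 by (intro mult_right_mono) (auto simp: power_le_one)
      finally show ?thesis by simp
    qed
    have dB: "real d * B\<^sup>2 \<le> (\<eta> r)\<^sup>2 / 1152 * real n"
    proof -
      have "real d * B\<^sup>2 \<le> (real d)\<^sup>2 * B\<^sup>2" using d by (intro mult_right_mono) (auto simp: power2_eq_square)
      also have "\<dots> \<le> (C2 r)\<^sup>2 * real n * B\<^sup>2" using d2 by (intro mult_right_mono) auto
      also have "\<dots> = (C2 r * B)\<^sup>2 * real n" by (simp add: power_mult_distrib)
      also have "\<dots> \<le> (\<eta> r / 40)\<^sup>2 * real n" using C2(2) C20 B1 by (intro mult_right_mono power_mono) auto
      also have "\<dots> \<le> (\<eta> r)\<^sup>2 / 1152 * real n" by (intro mult_right_mono) (auto simp: power_divide)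
      finally show ?thesis .
    qed
    define t where "t = (\<lambda>k. root k (real n) + B * sqrt (real d))"
    have Bd: "1 \<le> B * sqrt (real d)" using B1 sqd mult_mono[of 1 B 1 "sqrt (real d)"] by simp
    have t: "t k > 0 \<and> real n \<le> t k ^ k" if "k \<in> {2..5}" for k
    proof -
      have r0: "0 \<le> root k (real n)" by (rule real_root_ge_zero) simp
      then have "root k (real n) ^ k \<le> t k ^ k" using Bd by (intro power_mono) (auto simp: t_def)
      moreover have "root k (real n) ^ k = real n" using that by simp
      ultimately show ?thesis using Bd r0 by (simp add: t_def)
    qed
    have tle: "t k ^ k \<le> 2 ^ (k - 1) * (real n + (B * sqrt (real d)) ^ k)" if "k \<ge> 1" for k
      unfolding t_def using that B1 by (intro radius_power_le) auto
    \<comment> \<open>Order 5 is different: \<open>d\<close> to the power 5/2 may exceed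
      \<open>n\<close>, and then the maximum in the tensor bound takes effect.\<close>
    have tn: "t k ^ k \<le> 2 ^ k * real n" if k: "1 \<le> k" "k \<le> 4" for k
    proof -
      have "(B * sqrt (real d)) ^ k \<le> (B * sqrt (real d)) ^ 4" using Bd k by (intro power_increasing) auto
      also have "\<dots> = B ^ 4 * (real d)\<^sup>2"
        by (simp add: power_mult_distrib power_mult[of "sqrt (real d)" 2 2, simplified])
      finally have "(B * sqrt (real d)) ^ k \<le> real n" using B4 by simp
      then have "t k ^ k \<le> 2 ^ (k - 1) * (real n + real n)"
        by (intro order.trans[OF tle[OF k(1)]] mult_left_mono) auto
      also have "\<dots> = 2 ^ k * real n" using k by (cases k) auto
      finally show ?thesis .
    qed
    obtain A where A: "A \<in> carrier_mat d d" and AM: "A * transpose_mat A = M"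
      using gauss by (auto simp: gaussian_law_def)
    obtain cc where cc: "0 \<le> cc" and coord: "\<And>u i. u \<in> carrier_vec d \<Longrightarrow> i < d \<Longrightarrow> \<bar>u $ i\<bar> \<le> cc * vnorm M u"
      using vnorm_coordinate_bound[OF M A AM] by blast
    obtain W0 where W0: "finite W0" "W0 \<subseteq> carrier_vec d" "real (card W0) \<le> K ^ d"
      and net0: "\<And>u. u \<in> carrier_vec d \<Longrightarrow> vnorm M u \<le> 1 \<Longrightarrow> \<exists>w\<in>W0. vnorm M w \<le> 1 \<and> vnorm M (u - w) \<le> \<epsilon>"
      using nets[OF d M A AM] by blast
    \<comment> \<open>Only net points in the unit ball are kept, as the tail bounds for moments and
      score apply to them; the approximating points lie among these.\<close>
    define W where "W = {w \<in> W0. vnorm M w \<le> 1}"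
    have W: "finite W" "W \<subseteq> carrier_vec d" using W0 by (auto simp: W_def)
    have W1: "vnorm M w \<le> 1" if "w \<in> W" for w using that by (simp add: W_def)
    have "card W \<le> card W0" using W0 by (intro card_mono) (auto simp: W_def)
    then have cW: "real (card W) \<le> K ^ d" using W0(3) by linarith
    have net: "\<exists>w\<in>W. vnorm M (u - w) \<le> \<epsilon>" if "u \<in> carrier_vec d" "vnorm M u \<le> 1" for u
      using net0[OF that] by (auto simp: W_def)
    have net2: "\<exists>w\<in>W. vnorm M (u - w) \<le> 1 / 2" if "u \<in> carrier_vec d" "vnorm M u \<le> 1" for u
      using net[OF that] \<epsilon>(3) order.trans by blast
    obtain E where E: "E \<in> sets (sample_law n \<mu> \<beta>)"
      and PE: "measure (sample_law n \<mu> \<beta>) E \<ge> 1 - real (card W) *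
        ((\<Sum>k=2..5. exp (- (t k)\<^sup>2)) + exp (- real n / 4) + 2 * exp (- (real n * (\<eta> r)\<^sup>2 / 576)))"
      and EX: "\<And>\<omega> i. \<omega> \<in> E \<Longrightarrow> i < n \<Longrightarrow> fst (\<omega> i) \<in> carrier_vec d"
      and Emom: "\<And>\<omega> w k. \<omega> \<in> E \<Longrightarrow> w \<in> W \<Longrightarrow> k \<in> {2..5} \<Longrightarrow>
        (\<Sum>i<n. tempered_power k (t k) (fst (\<omega> i) \<bullet> w)) \<le> (moment_const k + 1) * (t k)\<^sup>2"
      and Een: "\<And>\<omega> w. \<omega> \<in> E \<Longrightarrow> w \<in> W \<Longrightarrow>
        (vnorm M w)\<^sup>2 * real n / 6 \<le> (\<Sum>i<n. (fst (\<omega> i) \<bullet> w)\<^sup>2)"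
      and Esc: "\<And>\<omega> w. \<omega> \<in> E \<Longrightarrow> w \<in> W \<Longrightarrow>
        \<bar>\<Sum>i<n. (sigmoid (fst (\<omega> i) \<bullet> \<beta>) - of_bool (snd (\<omega> i))) * (fst (\<omega> i) \<bullet> w)\<bar> \<le> \<eta> r * real n"
      using sample_good_event[where n = n and t = t and \<eta> = "\<eta> r", OF gauss beta W W1 t \<eta>] by blast
    let ?m = "max (sqrt (real d)) (ln (real n))"
    have "real (card W) * ((\<Sum>k=2..5. exp (- (t k)\<^sup>2)) + exp (- real n / 4) + 2 * exp (- (real n * (\<eta> r)\<^sup>2 / 576)))
        \<le> K ^ d * ((\<Sum>k=2..5. exp (- (t k)\<^sup>2)) + exp (- real n / 4) + 2 * exp (- (real n * (\<eta> r)\<^sup>2 / 576)))"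
      using cW by (intro mult_right_mono) (auto intro!: add_nonneg_nonneg sum_nonneg)
    also have "\<dots> \<le> 7 * exp (- ((\<eta> r)\<^sup>2 / 1152) * ?m)"
      unfolding t_def using B1 by (intro failure_probability_le[OF d n K B2 _ \<eta> dB]) auto
    finally have PE': "measure (sample_law n \<mu> \<beta>) E \<ge> 1 - 7 * exp (- C3 r * ?m)"
      using PE by (simp add: C3_def)
    have geometry: "let v = scaled_nlp n Q \<omega> in
        \<exists>b\<^sub>0. is_arg_min v (\<lambda>b. b \<in> carrier_vec d) b\<^sub>0 \<and>
          (\<forall>b. is_arg_min v (\<lambda>b. b \<in> carrier_vec d) b \<longrightarrow> b = b\<^sub>0) \<and>
          (let H = hessian d v b\<^sub>0 in
             loewner_le d (c r \<cdot>\<^sub>m M) H \<and>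
             (\<forall>k\<in>{3, 4, 5}. (SUP b\<in>carrier_vec d. ereal (tensor_norm d k H (nabla d v b)))
                \<le> ereal (C5 r * max (real d powr (real k / 2) / real n) 1)) \<and>
             (\<forall>b\<in>carrier_vec d. vnorm H (b - b\<^sub>0) > 4 * sqrt (real d / real n) \<longrightarrow>
                v b - v b\<^sub>0 \<ge> sqrt (real d / real n) * vnorm H (b - b\<^sub>0)))"
      if \<omega>: "\<omega> \<in> E" for \<omega>
    proof -
      interpret L: logit_sample d n M Q \<beta> \<omega>
        by unfold_locales (use d n M Q beta EX[OF \<omega>] in auto)
      have mom: "(\<Sum>i<n. \<bar>fst (\<omega> i) \<bullet> u\<bar> ^ k) \<le> norm_const k * t k ^ k * vnorm M u ^ k"
        if k: "k \<in> {2..5}" and u: "u \<in> carrier_vec d" for k u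
        using k t by (intro L.moments_from_net[OF cc coord W(2) net2 _ _ Emom[OF \<omega>] u]) auto
      have mom': "(\<Sum>i<n. \<bar>fst (\<omega> i) \<bullet> u\<bar> ^ k) \<le> G k * real n * vnorm M u ^ k"
        if k: "k \<in> {2..4}" and u: "u \<in> carrier_vec d" for k u
      proof -
        have "norm_const k * t k ^ k \<le> norm_const k * (2 ^ k * real n)"
          using k norm_const_ge[of k] by (intro mult_left_mono tn) auto
        then have "norm_const k * t k ^ k * vnorm M u ^ k \<le> norm_const k * (2 ^ k * real n) * vnorm M u ^ k"
          using psd_vnorm_square(2)[OF spd_imp_psd[OF M] u] by (intro mult_right_mono) auto
        also have "\<dots> = G k * real n * vnorm M u ^ k" by (simp add: G_def)
        finally show ?thesis using mom[of k u] k u by simp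
      qed
      have lower: "real n / 96 * (vnorm M u)\<^sup>2 \<le> (\<Sum>i<n. (fst (\<omega> i) \<bullet> u)\<^sup>2)" if u: "u \<in> carrier_vec d" for u
        using \<epsilon> G2 mom'[of 2] by (intro L.energy_from_net[OF W(2) _ _ \<epsilon>(2) net Een[OF \<omega>] _ _ u]) auto
      have hess: "c r * (vnorm M u)\<^sup>2 \<le> L.curvature \<theta> u"
        if \<theta>: "\<theta> \<in> carrier_vec d" "vnorm M (\<theta> - \<beta>) \<le> 1" and u: "u \<in> carrier_vec d" for \<theta> u
        unfolding c_def
      proof (rule L.curvature_from_moments[OF _ _ lower mom' \<theta>(1) _ u])
        have "\<theta> - \<beta> \<in> carrier_vec d" using \<theta>(1) beta by simp
        then have "(vnorm M (\<theta> - \<beta>))\<^sup>2 \<le> 1"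
          using psd_vnorm_square(2)[OF spd_imp_psd[OF M]] \<theta>(2) by (simp add: power_le_one)
        then show "(vnorm M \<theta>)\<^sup>2 \<le> 2 * r\<^sup>2 + 2"
          using psd_vnorm_square_add_le[OF spd_imp_psd[OF M] \<theta>(1) beta] by (simp add: r_def)
        show "0 < G 4" using G[of 4] by linarith
        show "0 < 2 * r\<^sup>2 + 2" by (simp add: add_nonneg_pos)
      qed auto
      have quadQ: "u \<bullet> (Q *\<^sub>v u) \<le> C1 r * real n * (vnorm M u)\<^sup>2" if u: "u \<in> carrier_vec d" for u
        using mat_norm_bound[OF M L.Qc(1) cc coord Qn u] by (simp add: r_def)
      have vQ: "vnorm Q u \<le> sqrt (C1 r * real n) * vnorm M u" if u: "u \<in> carrier_vec d" for u
        unfolding vnorm_def[of Q u] using quadQ[OF u] psd_vnorm_square(2)[OF spd_imp_psd[OF M] u]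
        by (metis real_sqrt_abs abs_of_nonneg real_sqrt_le_mono real_sqrt_mult)
      have grad: "\<bar>L.slope \<beta> u\<bar> \<le> c r / 4 * vnorm M u" if u: "u \<in> carrier_vec d" for u
      proof -
        define N where "N = vnorm M u"
        have N: "0 \<le> N" unfolding N_def by (rule psd_vnorm_square(2)[OF spd_imp_psd[OF M] u])
        have C1: "0 \<le> C1 r * real n" using pos[of r] by simp
        have s1: "\<bar>\<Sum>i<n. (sigmoid (fst (\<omega> i) \<bullet> \<beta>) - of_bool (snd (\<omega> i))) * (fst (\<omega> i) \<bullet> u)\<bar>
            \<le> 2 * (\<eta> r * real n) * N"
          unfolding N_def by (rule L.score_from_net[OF cc coord W(2) net2 Esc[OF \<omega>] u])
        have "\<bar>u \<bullet> (Q *\<^sub>v \<beta>)\<bar> \<le> vnorm Q u * vnorm Q \<beta>"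
          by (rule psd_cauchy_schwarz[OF Q u beta])
        also have "\<dots> \<le> (sqrt (C1 r * real n) * N) * (sqrt (C1 r * real n) * r)"
          using vQ[OF u] vQ[OF beta] psd_vnorm_square(2)[OF Q u] psd_vnorm_square(2)[OF Q beta] N C1
          unfolding N_def r_def by (intro mult_mono) auto
        also have "\<dots> = C1 r * r * real n * N" using C1 by (simp add: mult_ac)
        also have "\<dots> \<le> c r / 8 * real n * N"
        proof -
          have "C1 r * r = c r / 8 * (r / (r + 1))" using r by (simp add: C1_def)
          also have "\<dots> \<le> c r / 8 * 1" using r c0[of r] by (intro mult_left_mono) auto
          finally show ?thesis using N by (intro mult_right_mono) auto
        qed
        finally have s2: "\<bar>u \<bullet> (Q *\<^sub>v \<beta>)\<bar> \<le> c r / 8 * real n * N" .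
        have "\<bar>(\<Sum>i<n. (sigmoid (fst (\<omega> i) \<bullet> \<beta>) - of_bool (snd (\<omega> i))) * (fst (\<omega> i) \<bullet> u)) + u \<bullet> (Q *\<^sub>v \<beta>)\<bar>
            \<le> 2 * (\<eta> r * real n) * N + c r / 8 * real n * N"
          by (rule order.trans[OF abs_triangle_ineq add_mono[OF s1 s2]])
        also have "\<dots> = c r / 4 * N * real n"
          by (simp add: \<eta>_def)
        finally show ?thesis using n unfolding L.slope_def N_def[symmetric] by (simp add: pos_divide_le_eq)
      qed
      define T where "T = (\<lambda>k. bd k * norm_const k * t k ^ k / real n)"
      have T0: "0 \<le> T k" if "k \<in> {3, 4, 5}" for k
        using that t[of k] bd0[of k] norm_const_ge[of k] unfolding T_def
        by (intro divide_nonneg_nonneg mult_nonneg_nonneg) (auto intro: less_imp_le order.trans[OF zero_le_one])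
      have tensor: "\<bar>tensor_pow_inner d k (nabla d (scaled_nlp n Q \<omega>) b) u\<bar> \<le> T k * vnorm M u ^ k"
        if k: "k \<in> {3, 4, 5}" and b: "b \<in> carrier_vec d" and u: "u \<in> carrier_vec d" for k b u
      proof -
        have k': "k \<ge> 3" "k \<in> {2..5}" "k \<ge> 1" using k by auto
        have "\<bar>\<Sum>i<n. softplus_deriv k (fst (\<omega> i) \<bullet> b) * (fst (\<omega> i) \<bullet> u) ^ k\<bar>
            \<le> (\<Sum>i<n. bd k * \<bar>fst (\<omega> i) \<bullet> u\<bar> ^ k)"
          by (rule order.trans[OF sum_abs])
            (auto simp: abs_mult power_abs simp del: softplus_deriv.simps intro!: sum_mono mult_right_mono bd k'(3))
        also have "\<dots> \<le> bd k * (norm_const k * t k ^ k * vnorm M u ^ k)"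
          unfolding sum_distrib_left[symmetric] by (intro mult_left_mono mom k'(2) u bd0 k'(3))
        finally show ?thesis
          unfolding L.nabla_inner[OF b u k'(1)] T_def using n by (simp add: divide_right_mono mult.assoc)
      qed
      have a: "4 * sqrt (real d / real n) * T 3 \<le> 3 / 2 * (c r * sqrt (c r))"
      proof -
        have "T 3 \<le> bd 3 * norm_const 3 * (2 ^ 3 * real n) / real n"
          unfolding T_def using bd0[of 3] norm_const_ge[of 3]
          by (intro divide_right_mono mult_left_mono tn mult_nonneg_nonneg) auto
        also have "\<dots> = g" using n by (simp add: g_def G_def)
        finally have "T 3 \<le> g + 1" by simp
        then have "4 * sqrt (real d / real n) * T 3 \<le> 4 * C2 r * (g + 1)"
          using sdn T0[of 3] C20 by (intro mult_mono) auto
        also have "\<dots> \<le> 1 * (c r * sqrt (c r))"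
          using C2(3) by simp
        also have "\<dots> \<le> 3 / 2 * (c r * sqrt (c r))"
          using c0[of r] by (intro mult_right_mono) auto
        finally show ?thesis .
      qed
      have Tle: "T k / sqrt (c r) ^ k \<le> C5 r * max (real d powr (real k / 2) / real n) 1" if k: "k \<in> {3, 4, 5}" for k
      proof -
        define D where "D = real d powr (real k / 2)"
        have D: "sqrt (real d) ^ k = D"
          using d by (simp add: D_def powr_half_sqrt[symmetric] powr_powr flip: powr_realpow)
        have k1: "k \<ge> 1" "k \<le> 5" using k by auto
        have BB: "B ^ k \<le> B ^ 5" "1 \<le> B ^ 5" using B1 k1 by (auto intro: power_increasing one_le_power)
        have D0: "0 \<le> D" by (simp add: D_def)
        have "t k ^ k \<le> 2 ^ (k - 1) * (real n + B ^ k * D)"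
          using tle[OF k1(1)] by (simp add: power_mult_distrib D)
        also have "\<dots> \<le> 16 * (B ^ 5 * real n + B ^ 5 * D)"
        proof (rule mult_mono)
          show "2 ^ (k - 1) \<le> (16 :: real)" using k by auto
          have "1 * real n \<le> B ^ 5 * real n" using BB(2) by (intro mult_right_mono) auto
          moreover have "B ^ k * D \<le> B ^ 5 * D" using BB(1) D0 by (rule mult_right_mono)
          ultimately show "real n + B ^ k * D \<le> B ^ 5 * real n + B ^ 5 * D" by simp
          show "0 \<le> real n + B ^ k * D" using B1 D0 by simp
        qed simp
        also have "\<dots> \<le> 16 * (B ^ 5 * (real n * max (D / real n) 1) + B ^ 5 * (real n * max (D / real n) 1))"
        proof -
          have "real n \<le> real n * max (D / real n) 1" using mult_left_mono[of 1 "max (D / real n) 1" "real n"] by simp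
          moreover have "D \<le> real n * max (D / real n) 1"
            using n mult_left_mono[of "D / real n" "max (D / real n) 1" "real n"] by simp
          ultimately show ?thesis using B1 by (intro mult_left_mono add_mono) auto
        qed
        finally have tk: "t k ^ k / real n \<le> 32 * B ^ 5 * max (D / real n) 1"
          using n by (simp add: pos_divide_le_eq mult_ac)
        have sc: "0 < sqrt (c r)" "sqrt (c r) \<le> 1" using c0[of r] c1[of r] by auto
        have "T k = (bd k * norm_const k) * (t k ^ k / real n)" by (simp add: T_def)
        also have "\<dots> \<le> S * (32 * B ^ 5 * max (D / real n) 1)"
          using S[OF k] tk S0 t[of k] k by (intro mult_mono) (auto intro!: divide_nonneg_nonneg simp: less_imp_le)
        finally have "T k / sqrt (c r) ^ k \<le> S * (32 * B ^ 5 * max (D / real n) 1) / sqrt (c r) ^ 5"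
          using sc S0 B1 k1 by (intro frac_le) (auto intro!: mult_nonneg_nonneg power_decreasing simp: le_max_iff_disj)
        then show ?thesis by (simp add: C5_def D_def mult_ac)
      qed
      show ?thesis
        unfolding Let_def[of "scaled_nlp n Q \<omega>"]
        by (rule L.posterior_geometry[OF c0[of r] cc coord hess lower grad tensor T0 Tle a])
    qed
    show "\<exists>E\<in>sets (sample_law n \<mu> \<beta>).
           measure (sample_law n \<mu> \<beta>) E
             \<ge> 1 - 7 * exp (- C3 (vnorm M \<beta>) * max (sqrt (real d)) (ln (real n))) \<and>
           (\<forall>\<omega>\<in>E. let v = scaled_nlp n Q \<omega> in
              \<exists>b\<^sub>0. is_arg_min v (\<lambda>b. b \<in> carrier_vec d) b\<^sub>0 \<and>
                (\<forall>b. is_arg_min v (\<lambda>b. b \<in> carrier_vec d) b \<longrightarrow> b = b\<^sub>0) \<and>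
                (let H = hessian d v b\<^sub>0 in
                   loewner_le d (c (vnorm M \<beta>) \<cdot>\<^sub>m M) H \<and>
                   (\<forall>k\<in>{3, 4, 5}.
                      (SUP b\<in>carrier_vec d. ereal (tensor_norm d k H (nabla d v b)))
                        \<le> ereal (C5 (vnorm M \<beta>) * max (real d powr (real k / 2) / real n) 1)) \<and>
                   (\<forall>b\<in>carrier_vec d. vnorm H (b - b\<^sub>0) > 4 * sqrt (real d / real n) \<longrightarrow>
                      v b - v b\<^sub>0 \<ge> sqrt (real d / real n) * vnorm H (b - b\<^sub>0))))"
      using E PE' geometry unfolding r_def by blast
  qed
qed

end
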